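(* Let $m\ge2$ and $I=[0,1]$. Consider the basis of $\Pi^{2m-1}_0$ consisting of the associated Legendre polynomials $Q_j$, $j=2,\dots,2m-1$, of order $2$ translated to the unit interval $I$. For $k=2,\dots,2m-1$ define $$a_{jk}:=\frac{(j+k+k^2)\,\Gamma(j+2)\,\Gamma(j)}{\Gamma(j+k+2)\,\Gamma(j-k+1)},\qquad k\le j\le 2m-1,$$ $$\tilde h_k(t):=\sum_{j=k}^{2m-1}(-1)^{j+1}a_{jk}\,e_{2m-1-j}(t,t),\qquad t\in I^{m-1}.$$ Then for $j,k\in\{2,\dots,2m-1\}$ with $j\equiv k\pmod 2$, $$\int_{I^{m-1}}\tilde h_k(t)\,\Sigma Q_j(t)\prod_{j'=1}^{m-1}t_{j'}^2\cdot\Delta_{m-1}^4(t)\,dt=\mathrm{Vol}(M^{2m-1})\,(2m-1)!\,(m-1)!\,\frac{(k+2)!}{(8k+4)(k-2)!}\,\delta_{jk}.$$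
   Context: $\Pi^{n}_0$ is the space of real polynomials $\phi$ of degree at most $n$ with $\phi(0)=\phi(1)=0$. $P_k(r)=\frac{1}{k!}\frac{d^k}{dr^k}(r^2-r)^k$ are the Legendre polynomials shifted to $I$, and $Q_k(r):=(r-r^2)P_k''(r)$. $\Sigma Q_j(t):=\sum_{i=1}^{m-1}Q_j(t_i)$ for $t\in I^{m-1}$. $e_j(t):=\sum_{i_1<\cdots<i_j}t_{i_1}\cdots t_{i_j}$ are the elementary symmetric functions of $t=(t_1,\dots,t_{m-1})$ ($e_0:=1$, $e_j:=0$ for $j>m-1$), and $e_j(t,t):=\sum_{j_1+j_2=j}e_{j_1}(t)e_{j_2}(t)$, $j=0,\dots,2m-2$ (sum over nonnegative integers). $\Delta_N(t):=\prod_{1\le j<k\le N}(t_k-t_j)$, $\Delta_N^4(t)=(\Delta_N(t))^4$. $M^n\subset\mathbb{R}^n$ is the set of vectors $(\mathbb{E}_{t\sim\mu}[t^i])_{i=1}^n$ as $\mu$ ranges over Borel probability measures on $[0,1]$, and $\mathrm{Vol}$ is $n$-dimensional Lebesgue measure. $\delta_{jk}$ is the Kronecker delta. *)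

theory Defs
  imports "HOL-Probability.Probability" "HOL-Computational_Algebra.Polynomial"
begin

definition Pi0 :: "nat \<Rightarrow> real poly set" where
  "Pi0 n = {p. degree p \<le> n \<and> poly p 0 = 0 \<and> poly p 1 = 0}"

definition shifted_legendre :: "nat \<Rightarrow> real poly" where
  "shifted_legendre k = smult (1 / fact k) ((pderiv ^^ k) (([:0, 1:]^2 - [:0, 1:]) ^ k))"

definition assoc_legendre2 :: "nat \<Rightarrow> real poly" where
  "assoc_legendre2 k = ([:0, 1:] - [:0, 1:]^2) * pderiv (pderiv (shifted_legendre k))"

interpretation rpoly: vector_space "smult :: real \<Rightarrow> real poly \<Rightarrow> real poly"
  by unfold_locales (simp_all add: smult_add_right smult_add_left)

lemma degree_funpow_pderiv: "degree ((pderiv ^^ n) p) = degree (p :: real poly) - n"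
  by (induction n) (simp_all add: degree_pderiv)

lemma degree_shifted_legendre: "degree (shifted_legendre k) = k"
proof -
  have "degree ([:0, 1:]^2 - [:0, 1:] :: real poly) = 2" by (simp add: power2_eq_square)
  then show ?thesis
    by (subst shifted_legendre_def, subst degree_smult_eq, subst degree_funpow_pderiv, subst degree_power_eq) auto
qed

lemma degree_assoc_legendre2: "k \<ge> 2 \<Longrightarrow> degree (assoc_legendre2 k) = k"
proof -
  assume k: "k \<ge> 2"
  have d: "degree (pderiv (pderiv (shifted_legendre k))) = k - 2"
    by (simp add: degree_pderiv degree_shifted_legendre)
  have 1: "pderiv (pderiv (shifted_legendre k)) \<noteq> 0"
  proof
    assume "pderiv (pderiv (shifted_legendre k)) = 0"
    then have "degree (pderiv (shifted_legendre k)) = 0" by (simp add: pderiv_eq_0_iff)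
    then show False using k by (simp add: degree_pderiv degree_shifted_legendre)
  qed
  have "degree ([:0, 1:] - [:0, 1:]^2 :: real poly) = 2" by (simp add: power2_eq_square)
  moreover then have "([:0, 1:] - [:0, 1:]^2 :: real poly) \<noteq> 0" by fastforce
  ultimately show ?thesis unfolding assoc_legendre2_def using 1 k
    by (subst degree_mult_eq) (auto simp: d)
qed

lemma assoc_legendre2_in_Pi0: "k \<ge> 2 \<Longrightarrow> k \<le> n \<Longrightarrow> assoc_legendre2 k \<in> Pi0 n"
  by (simp add: Pi0_def degree_assoc_legendre2) (simp add: assoc_legendre2_def)

lemma Pi0_in_span: "p \<in> Pi0 n \<Longrightarrow> p \<in> rpoly.span (assoc_legendre2 ` {2..n})"
proof (induction n arbitrary: p)
  case 0
  then have "p = 0" by (auto simp: Pi0_def elim!: degree_eq_zeroE)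
  then show ?case by (simp add: rpoly.span_zero)
next
  case (Suc n)
  show ?case
  proof (cases "degree p \<le> n")
    case True
    then have "p \<in> rpoly.span (assoc_legendre2 ` {2..n})" using Suc by (simp add: Pi0_def)
    then show ?thesis by (rule subsetD[OF rpoly.span_mono, rotated]) auto
  next
    case False
    then have dp: "degree p = Suc n" using Suc by (simp add: Pi0_def)
    have n1: "Suc n \<ge> 2"
    proof (rule ccontr)
      assume "\<not> Suc n \<ge> 2"
      then have "degree p = 1" using dp by simp
      obtain a q where p: "p = pCons a q" by (cases p)
      with \<open>degree p = 1\<close> have "q \<noteq> 0" "degree q = 0" by (auto simp: degree_pCons_eq_if split: if_splits)
      then obtain b where "p = [:a, b:]" "b \<noteq> 0" using p by (auto elim: degree_eq_zeroE)
      then show False using Suc.prems by (simp add: Pi0_def)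
    qed
    let ?q = "assoc_legendre2 (Suc n)"
    let ?c = "lead_coeff p / lead_coeff ?q"
    let ?r = "p - smult ?c ?q"
    have dq: "degree ?q = Suc n" using degree_assoc_legendre2 n1 by blast
    then have nz: "lead_coeff ?q \<noteq> 0" by (metis degree_0 leading_coeff_0_iff nat.distinct(1))
    have r0: "coeff ?r (Suc n) = 0" using nz dp dq by simp
    have rd: "degree ?r \<le> Suc n" using dp dq by (intro degree_diff_le) auto
    have "degree ?r \<le> n"
      using r0 rd by (intro degree_le) (metis Suc_lessI coeff_eq_0 le_less_trans)
    moreover have "?r \<in> Pi0 (Suc n)" using rd Suc.prems assoc_legendre2_in_Pi0[OF n1, of "Suc n"] by (simp add: Pi0_def)
    ultimately have "?r \<in> rpoly.span (assoc_legendre2 ` {2..n})" using Suc.IH by (simp add: Pi0_def)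
    then have "?r \<in> rpoly.span (assoc_legendre2 ` {2..Suc n})"
      by (rule subsetD[OF rpoly.span_mono, rotated]) auto
    moreover have "?q \<in> rpoly.span (assoc_legendre2 ` {2..Suc n})" using n1 by (intro rpoly.span_base) auto
    ultimately have "?r + smult ?c ?q \<in> rpoly.span (assoc_legendre2 ` {2..Suc n})"
      by (intro rpoly.span_add rpoly.span_scale)
    then show ?thesis by simp
  qed
qed

lemma subspace_Pi0: "rpoly.subspace (Pi0 n)"
  unfolding rpoly.subspace_def Pi0_def by (auto intro: degree_add_le)

lemma independent_assoc_legendre2: "rpoly.independent (assoc_legendre2 ` {2..n})"
proof (induction n)
  case 0
  then show ?case by (simp add: rpoly.independent_empty)
next
  case (Suc n)
  show ?case
  proof (cases "Suc n \<ge> 2")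
    case True
    then have "{2..Suc n} = insert (Suc n) {2..n}" by auto
    moreover have "assoc_legendre2 (Suc n) \<notin> rpoly.span (assoc_legendre2 ` {2..n})"
    proof
      assume "assoc_legendre2 (Suc n) \<in> rpoly.span (assoc_legendre2 ` {2..n})"
      also have "\<dots> \<subseteq> Pi0 n" by (intro rpoly.span_minimal subspace_Pi0) (auto intro: assoc_legendre2_in_Pi0)
      finally show False using degree_assoc_legendre2[OF True] by (simp add: Pi0_def)
    qed
    ultimately show ?thesis using Suc by (simp add: rpoly.independent_insertI)
  qed (simp add: rpoly.independent_empty)
qed

lemma inj_on_assoc_legendre2: "inj_on assoc_legendre2 {2..n}"
  by (rule inj_onI) (metis atLeastAtMost_iff degree_assoc_legendre2)

lemma assoc_legendre2_basis:
  "inj_on assoc_legendre2 {2..n}"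
  "rpoly.independent (assoc_legendre2 ` {2..n})"
  "rpoly.span (assoc_legendre2 ` {2..n}) = Pi0 n"
  using inj_on_assoc_legendre2 independent_assoc_legendre2 Pi0_in_span rpoly.span_minimal[OF _ subspace_Pi0, of "assoc_legendre2 ` {2..n}" n] assoc_legendre2_in_Pi0
  by (auto simp: image_subset_iff)

text \<open>A point \<open>t = (t\<^sub>1, \<dots>, t\<^sub>N)\<close> of \<open>\<real>\<^sup>N\<close> is a function on the index set \<open>{1..N}\<close>.
  Lebesgue measure is taken on product-Borel sets; the cube and the moment space are compact, so
  completing the measure would change nothing.\<close>

definition Leb :: "nat \<Rightarrow> (nat \<Rightarrow> real) measure" where
  "Leb N = Pi\<^sub>M {1..N} (\<lambda>_. lborel)"

definition unit_cube :: "nat \<Rightarrow> (nat \<Rightarrow> real) set" where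
  "unit_cube N = {1..N} \<rightarrow>\<^sub>E {0..1}"

definition SigmaQ :: "nat \<Rightarrow> nat \<Rightarrow> (nat \<Rightarrow> real) \<Rightarrow> real" where
  "SigmaQ N j t = (\<Sum>i = 1..N. poly (assoc_legendre2 j) (t i))"

text \<open>An increasing index tuple \<open>i\<^sub>1 < \<dots> < i\<^sub>j\<close> is encoded as the \<open>j\<close>-element set of its entries;
  in particular \<open>elem_sym N 0 t = 1\<close>, and \<open>elem_sym N j t = 0\<close> for \<open>j > N\<close>.\<close>

definition elem_sym :: "nat \<Rightarrow> nat \<Rightarrow> (nat \<Rightarrow> real) \<Rightarrow> real" where
  "elem_sym N j t = (\<Sum>S | S \<subseteq> {1..N} \<and> card S = j. \<Prod>i\<in>S. t i)"

definition elem_sym2 :: "nat \<Rightarrow> nat \<Rightarrow> (nat \<Rightarrow> real) \<Rightarrow> real" where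
  "elem_sym2 N j t = (\<Sum>(j1, j2)\<in>{(j1, j2). j1 + j2 = j}. elem_sym N j1 t * elem_sym N j2 t)"

definition vandermonde :: "nat \<Rightarrow> (nat \<Rightarrow> real) \<Rightarrow> real" where
  "vandermonde N t = (\<Prod>(j, k)\<in>{(j, k). 1 \<le> j \<and> j < k \<and> k \<le> N}. t k - t j)"

definition moment_space :: "nat \<Rightarrow> (nat \<Rightarrow> real) set" where
  "moment_space n = {\<lambda>i\<in>{1..n}. \<integral>t. t ^ i \<partial>\<mu> | \<mu> :: real measure.
      prob_space \<mu> \<and> sets \<mu> = sets (restrict_space borel {0..1})}"

definition a_coeff :: "nat \<Rightarrow> nat \<Rightarrow> real" where
  "a_coeff j k = (real j + real k + real k ^ 2) * Gamma (real j + 2) * Gamma (real j) /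
      (Gamma (real j + real k + 2) * Gamma (real j - real k + 1))"

definition h_tilde :: "nat \<Rightarrow> nat \<Rightarrow> (nat \<Rightarrow> real) \<Rightarrow> real" where
  "h_tilde m k t =
     (\<Sum>j = k..2*m-1. (-1) ^ (j + 1) * a_coeff j k * elem_sym2 (m - 1) (2*m - 1 - j) t)"

end

theory Submission
  imports Defs
begin

text \<open>
  Write \<open>N = m - 1\<close>, \<open>n = 2 * m - 1\<close> and \<open>\<pi>\<^sub>t(x) = \<Prod>\<^sub>i (x - t\<^sub>i)\<^sup>2\<close>.  The \<open>a\<^sub>j\<^sub>k\<close> are \<open>1 - \<integral> x\<^sup>j Q\<^sub>k\<close>, and the
  \<open>e\<^sub>j(t,t)\<close> are up to sign the coefficients of \<open>\<pi>\<^sub>t\<close>, so that \<open>h\<^sub>k(t) = \<pi>\<^sub>t(1) - \<integral> x \<pi>\<^sub>t(x) Q\<^sub>k(x) dx\<close>.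
  The integral in question is therefore \<open>A(1) - \<integral> A Q\<^sub>k\<close> for the polynomial \<open>A\<close> that is \<open>x\<close> times the
  integral of \<open>\<pi>\<^sub>t(x) \<Sum>Q\<^sub>j(t) \<Prod>t\<^sub>i\<^sup>2 \<Delta>\<^sup>4\<close> over the cube.  The sum of the residues of \<open>\<psi>(z) / \<Prod>(z - s\<^sub>i)\<^sup>2\<close> at
  \<open>N + 1\<close> points \<open>s\<^sub>i\<close> vanishes for \<open>deg \<psi> \<le> 2 * N\<close>; multiplied by \<open>\<Delta>\<^sup>4\<close> and integrated over \<open>s\<close> it becomes a
  relation for the skew form \<open>\<integral> (a b' - a' b)\<close> that determines the part of \<open>A\<close> of the same parity as
  \<open>Q\<^sub>j\<close>: it is \<open>- S Q\<^sub>j / 4\<close> up to an affine polynomial, where \<open>S = \<integral> \<Prod>t\<^sub>i\<^sup>2 (1 - t\<^sub>i)\<^sup>2 \<Delta>\<^sup>4\<close>.  Orthogonality of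
  the \<open>Q\<^sub>k\<close> gives the identity with \<open>S\<close> in place of the volume.

  Without the factor \<open>\<Sum>Q\<^sub>j(t)\<close> the same relation yields \<open>S (1 + P\<^sub>n) / 2\<close> instead of \<open>A\<close>, and comparing leading
  coefficients gives a recursion for \<open>S\<close> in \<open>N\<close>.  The volume is computed by stripping the first
  canonical moment \<open>p\<close> off a measure: this maps the part \<open>0 < p < 1\<close> of \<open>M\<^sup>n\<close> bijectively to
  \<open>(0,1) \<times> M\<^sup>n\<^sup>-\<^sup>1\<close> with a triangular Jacobian \<open>(p (1 - p))\<^sup>1\<^sup>-\<^sup>n\<close>.
\<close>

section \<open>Legendre polynomials on the unit interval\<close>

definition unif :: "real measure" where
  "unif = restrict_space lborel {0..1}"

lemma space_unif [simp]: "space unif = {0..1}"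
  by (simp add: unif_def space_restrict_space)

lemma measurable_unif [measurable (raw)]: "f \<in> borel_measurable borel \<Longrightarrow> f \<in> borel_measurable unif"
  unfolding unif_def by (rule measurable_restrict_space1) simp

lemma prob_space_unif: "prob_space unif"
  by (rule prob_spaceI) (simp add: unif_def space_restrict_space emeasure_restrict_space)

lemma integral_unif: "(\<integral>x. f x \<partial>unif) = (LINT x:{0..1}|lborel. f x)"
  for f :: "real \<Rightarrow> real"
  unfolding unif_def by (subst integral_restrict_space) (auto simp: set_lebesgue_integral_def)

lemma borel_measurable_poly [measurable]: "poly p \<in> borel_measurable borel" for p :: "real poly"
  by (intro borel_measurable_continuous_onI continuous_intros)

lemma poly_bounded_unit: "\<exists>C. \<forall>x\<in>{0..1}. \<bar>poly p x\<bar> \<le> C" for p :: "real poly"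
proof -
  have "compact (poly p ` {0..1})" by (intro compact_continuous_image continuous_intros) simp
  then have "bounded (poly p ` {0..1})" by (rule compact_imp_bounded)
  then show ?thesis by (auto simp: bounded_iff)
qed

lemma integrable_unif_poly: "integrable unif (poly p)" for p :: "real poly"
proof -
  interpret prob_space unif by (rule prob_space_unif)
  obtain C where "\<forall>x\<in>{0..1}. \<bar>poly p x\<bar> \<le> C" using poly_bounded_unit by blast
  then show ?thesis by (intro integrable_const_bound[of _ C]) auto
qed

definition pint :: "real poly \<Rightarrow> real" where
  "pint p = (\<integral>x. poly p x \<partial>unif)"

lemma pint_0 [simp]: "pint 0 = 0"
  by (simp add: pint_def)

lemma pint_add: "pint (p + q) = pint p + pint q"
  by (simp add: pint_def integrable_unif_poly)

lemma pint_diff: "pint (p - q) = pint p - pint q"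
  by (simp add: pint_def integrable_unif_poly)

lemma pint_smult: "pint (smult c p) = c * pint p"
  by (simp add: pint_def)

lemma pint_uminus: "pint (- p) = - pint p"
  by (simp add: pint_def)

lemma pint_sum: "pint (\<Sum>i\<in>A. f i) = (\<Sum>i\<in>A. pint (f i))"
  by (induction A rule: infinite_finite_induct) (simp_all add: pint_add)

lemma pint_pderiv: "pint (pderiv p) = poly p 1 - poly p 0"
proof -
  have "(\<integral>x. poly (pderiv p) x * indicator {0..1} x \<partial>lborel) = poly p 1 - poly p 0"
    by (rule integral_FTC_Icc_real) (auto intro: poly_DERIV)
  then show ?thesis by (simp add: pint_def integral_unif set_lebesgue_integral_def mult.commute)
qed

lemma pint_const [simp]: "pint [:c:] = c"
  using pint_pderiv[of "[:0, c:]"] by (simp add: pderiv_pCons)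

lemma pint_by_parts: "pint (p * pderiv q) = poly p 1 * poly q 1 - poly p 0 * poly q 0 - pint (pderiv p * q)"
  using pint_pderiv[of "p * q"] by (simp add: pderiv_mult pint_add algebra_simps)

text \<open>A nonnegative integrand with integral zero vanishes almost everywhere, while a nonzero
  polynomial has only finitely many roots.\<close>

lemma pint_square_eq_0D:
  assumes "pint (p * p) = 0"
  shows "p = 0"
proof (rule ccontr)
  assume "p \<noteq> 0"
  interpret prob_space unif by (rule prob_space_unif)
  have "AE x in unif. poly (p * p) x = 0"
    using assms unfolding pint_def
    by (subst (asm) integral_nonneg_eq_0_iff_AE) (auto simp: integrable_unif_poly simp del: poly_mult, simp)
  moreover have "AE x in unif. poly p x \<noteq> 0"
  proof -
    have "finite {x. poly p x = 0}" using \<open>p \<noteq> 0\<close> by (rule poly_roots_finite)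
    then have "AE x in lborel. x \<notin> {x. poly p x = 0}"
      by (intro AE_not_in) (simp add: null_sets_def emeasure_lborel_countable finite_imp_closed countable_finite)
    then show ?thesis unfolding unif_def
      by (subst AE_restrict_space_iff) (auto elim: eventually_mono)
  qed
  ultimately have "AE x in unif. False" by eventually_elim auto
  then show False by simp
qed

text \<open>Precomposition with the reflection of the unit interval; it splits polynomials into even
  and odd ones about 1/2, which is the parity used throughout.\<close>

definition refl_poly :: "real poly \<Rightarrow> real poly" where
  "refl_poly p = pcompose p [:1, -1:]"

lemma poly_refl_poly [simp]: "poly (refl_poly p) x = poly p (1 - x)"
  by (simp add: refl_poly_def poly_pcompose)

lemma degree_refl_poly [simp]: "degree (refl_poly p) = degree p"
  by (simp add: refl_poly_def degree_pcompose)

lemma refl_poly_mult: "refl_poly (p * q) = refl_poly p * refl_poly q"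
  by (simp add: refl_poly_def pcompose_mult)

lemma pderiv_refl_poly: "pderiv (refl_poly p) = - refl_poly (pderiv p)"
  by (simp add: refl_poly_def pderiv_pcompose pderiv_pCons)

lemma refl_poly_refl_poly [simp]: "refl_poly (refl_poly p) = p"
  by (simp add: poly_eq_poly_eq_iff[symmetric] fun_eq_iff)

lemma pint_refl_poly: "pint (refl_poly p) = pint p"
proof -
  have "pint p = (\<integral>x. indicator {0..1} x * poly p x \<partial>lborel)"
    by (simp add: pint_def integral_unif set_lebesgue_integral_def)
  also have "\<dots> = (\<integral>x. indicator {0..1} (1 + (-1) * x) * poly p (1 + (-1) * x) \<partial>lborel)"
    by (subst lborel_integral_real_affine[of "-1" _ 1]) simp_all
  also have "\<dots> = (\<integral>x. indicator {0..1} x * poly (refl_poly p) x \<partial>lborel)"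
    by (intro Bochner_Integration.integral_cong) (auto simp: indicator_def)
  also have "\<dots> = pint (refl_poly p)"
    by (simp add: pint_def integral_unif set_lebesgue_integral_def)
  finally show ?thesis ..
qed

text \<open>Euler's beta integral by induction on \<open>k\<close>: an integration by parts trades
  one factor \<open>1 - x\<close> for a factor \<open>x\<close>, which is why \<open>j\<close> is
  arbitrary.\<close>

lemma pint_beta: "pint ([:0, 1:] ^ j * [:1, -1:] ^ k) = fact j * fact k / fact (j + k + 1)"
proof (induction k arbitrary: j)
  case 0
  have "pderiv ([:0, 1:] ^ Suc j) = smult (real j + 1) ([:0, 1:] ^ j)"
    by (subst pderiv_power_Suc) (simp add: pderiv_pCons del: power_Suc)
  then have "(real j + 1) * pint ([:0, 1:] ^ j) = 1"
    using pint_pderiv[of "[:0, 1:] ^ Suc j"] by (simp add: pint_smult)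
  then have "pint ([:0, 1:] ^ j) = 1 / (real j + 1)" by (simp add: eq_divide_eq mult.commute)
  then show ?case by (simp add: add.commute)
next
  case (Suc k)
  have 1: "pderiv ([:0, 1:] ^ Suc j) = smult (real j + 1) ([:0, 1:] ^ j)" for j
    by (subst pderiv_power_Suc) (simp add: pderiv_pCons del: power_Suc)
  have 2: "pderiv ([:1, -1:] ^ Suc k) = smult (- 1 - real k) ([:1, -1:] ^ k)"
    by (subst pderiv_power_Suc) (simp add: pderiv_pCons del: power_Suc)
  have "(real j + 1) * pint ([:0, 1:] ^ j * [:1, -1:] ^ Suc k) =
      (real k + 1) * pint ([:0, 1:] ^ Suc j * [:1, -1:] ^ k)"
    using pint_by_parts[of "[:1, -1:] ^ Suc k" "[:0, 1:] ^ Suc j"]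
    by (simp only: 1 2) (simp add: pint_smult mult.commute del: power_Suc, simp add: algebra_simps)
  also have "\<dots> = (real k + 1) * (fact (Suc j) * fact k / fact (Suc j + k + 1))"
    by (simp only: Suc.IH)
  finally have "(real j + 1) * pint ([:0, 1:] ^ j * [:1, -1:] ^ Suc k) =
      (real j + 1) * (fact j * fact (Suc k) / fact (j + Suc k + 1))"
    by (simp add: algebra_simps)
  moreover have "real j + 1 \<noteq> 0" by simp
  ultimately show ?case by (simp only: mult_cancel_left simp_thms)
qed

section \<open>Shifted Legendre polynomials: orthogonality, parity, special values\<close>

abbreviation legbase :: "real poly" where "legbase \<equiv> [:0, 1:]\<^sup>2 - [:0, 1:]"

text \<open>Each derivative costs at most one factor \<open>q\<close>. With
  \<open>q = legbase\<close> this makes the boundary terms of repeated integration by parts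
  vanish.\<close>

lemma dvd_higher_pderiv_power:
  fixes q :: "real poly"
  shows "i \<le> k \<Longrightarrow> q ^ (k - i) dvd (pderiv ^^ i) (q ^ k)"
proof (induction i)
  case (Suc i)
  then obtain r where r: "(pderiv ^^ i) (q ^ k) = q ^ (k - i) * r" by (auto simp: dvd_def)
  have "k - i = Suc (k - Suc i)" using Suc.prems by simp
  then have "(pderiv ^^ i) (q ^ k) = q ^ Suc (k - Suc i) * r" using r by simp
  then have "(pderiv ^^ Suc i) (q ^ k) = pderiv (q ^ Suc (k - Suc i) * r)" by simp
  also have "\<dots> = q ^ (k - Suc i) * (q * pderiv r + smult (1 + real (k - Suc i)) (pderiv q * r))"
    unfolding pderiv_mult pderiv_power_Suc by (simp add: algebra_simps)
  finally show ?case by simp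
qed simp

lemma poly_higher_pderiv_legbase_0:
  assumes "i < k" "x = 0 \<or> x = 1"
  shows "poly ((pderiv ^^ i) (legbase ^ k)) x = 0"
proof -
  have "legbase dvd legbase ^ (k - i)" using assms by (intro dvd_power) auto
  then have "legbase dvd (pderiv ^^ i) (legbase ^ k)" using dvd_higher_pderiv_power[of i k legbase] assms dvd_trans by auto
  then obtain r where "(pderiv ^^ i) (legbase ^ k) = legbase * r" by (auto simp: dvd_def)
  then show ?thesis using assms by (auto simp: power2_eq_square)
qed

text \<open>Rodrigues' formula and \<open>k\<close> integrations by parts; derivatives of
  \<open>legbase ^ k\<close> of order below \<open>k\<close> vanish at both endpoints.\<close>

lemma pint_mult_shifted_legendre:
  "fact k * pint (g * shifted_legendre k) = (-1) ^ k * pint ((pderiv ^^ k) g * legbase ^ k)"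
proof -
  have "i \<le> k \<Longrightarrow> pint (g * (pderiv ^^ k) (legbase ^ k)) = (-1) ^ i * pint ((pderiv ^^ i) g * (pderiv ^^ (k - i)) (legbase ^ k))" for i
  proof (induction i)
    case (Suc i)
    have *: "(pderiv ^^ (k - i)) (legbase ^ k) = pderiv ((pderiv ^^ (k - Suc i)) (legbase ^ k))"
      using Suc.prems by (metis Suc_diff_Suc Suc_le_lessD comp_apply funpow.simps(2))
    show ?case
      unfolding Suc.IH[OF Suc_leD[OF Suc.prems]] * pint_by_parts
      using Suc.prems by (simp add: poly_higher_pderiv_legbase_0)
  qed simp
  from this[of k] show ?thesis by (simp add: shifted_legendre_def pint_smult)
qed

lemma pint_mult_shifted_legendre_eq_0:
  assumes "degree g < k"
  shows "pint (g * shifted_legendre k) = 0"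
proof -
  have "(pderiv ^^ k) g = 0"
  proof (rule poly_eqI)
    fix i show "coeff ((pderiv ^^ k) g) i = coeff 0 i"
      using assms by (simp add: coeff_higher_pderiv coeff_eq_0)
  qed
  then show ?thesis using pint_mult_shifted_legendre[of k g] by simp
qed

text \<open>The \<open>k\<close>-th derivative of \<open>x^j\<close> is a multiple of
  \<open>x^(j - k)\<close>, so a beta integral remains. The sign of the integrations by parts
  cancels the one in \<open>legbase = - x (1 - x)\<close>.\<close>

lemma pint_monom_shifted_legendre:
  assumes "k \<le> j"
  shows "pint (monom 1 j * shifted_legendre k) = fact j * fact j / (fact (j + k + 1) * fact (j - k))"
proof -
  have legbase: "legbase ^ k = smult ((-1) ^ k) ([:0, 1:] ^ k * [:1, -1:] ^ k)"
  proof -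
    have "legbase = - ([:0, 1:] * [:1, -1:])" by (simp add: power2_eq_square)
    then have "legbase ^ k = (-1) ^ k * ([:0, 1:] ^ k * [:1, -1:] ^ k)"
      by (metis power_minus power_mult_distrib)
    also have "(-1 :: real poly) ^ k = [:(-1) ^ k:]" by (induction k) (simp_all add: one_pCons)
    finally show ?thesis by simp
  qed
  have m: "monom 1 j = [:0, 1::real:] ^ j" for j by (simp add: monom_altdef)
  have "(pderiv ^^ k) (monom 1 j) = smult (pochhammer (real (Suc j) - real k) k) (monom 1 (j - k))"
    using assms by (intro poly_eqI) (auto simp: coeff_higher_pderiv of_nat_diff)
  moreover have "pochhammer (real (Suc j) - real k) k = fact j / fact (j - k)"
    using assms pochhammer_product'[of "1::real" "j - k" k]
    by (simp add: pochhammer_fact[symmetric] of_nat_diff eq_divide_eq mult.commute algebra_simps)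
  ultimately have "fact k * pint (monom 1 j * shifted_legendre k) =
      (-1) ^ k * ((-1) ^ k * (fact j / fact (j - k) * pint ([:0, 1:] ^ (j - k) * ([:0, 1:] ^ k * [:1, -1:] ^ k))))"
    unfolding pint_mult_shifted_legendre legbase by (simp add: pint_smult m)
  also have "[:0, 1:] ^ (j - k) * ([:0, 1::real:] ^ k * [:1, -1:] ^ k) = [:0, 1:] ^ j * [:1, -1:] ^ k"
    using assms by (simp add: mult.assoc[symmetric] power_add[symmetric])
  also have "pint \<dots> = fact j * fact k / fact (j + k + 1)" by (rule pint_beta)
  finally have *: "fact k * pint (monom 1 j * shifted_legendre k) =
      fact k * (fact j * fact j / (fact (j + k + 1) * fact (j - k)))"
    by (simp flip: mult.assoc power_mult_distrib del: fact_Suc) (simp add: mult.commute mult.left_commute del: fact_Suc)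
  then show ?thesis by (simp only: mult_cancel_left fact_nonzero simp_thms)
qed

lemma refl_poly_higher_pderiv: "refl_poly ((pderiv ^^ k) p) = smult ((-1) ^ k) ((pderiv ^^ k) (refl_poly p))"
proof (induction k)
  case (Suc k)
  have "refl_poly ((pderiv ^^ Suc k) p) = - pderiv (refl_poly ((pderiv ^^ k) p))"
    by (simp add: pderiv_refl_poly)
  also have "\<dots> = smult ((-1) ^ Suc k) ((pderiv ^^ Suc k) (refl_poly p))"
    by (simp only: Suc.IH) (simp add: pderiv_smult)
  finally show ?case .
qed simp

lemma refl_poly_power: "refl_poly (p ^ k) = refl_poly p ^ k"
  by (induction k) (simp_all add: refl_poly_mult, simp add: refl_poly_def one_pCons)

lemma refl_poly_legbase: "refl_poly legbase = legbase"
  by (simp add: poly_eq_poly_eq_iff[symmetric] fun_eq_iff power2_eq_square algebra_simps)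

lemma refl_poly_smult: "refl_poly (smult c p) = smult c (refl_poly p)"
  by (simp add: refl_poly_def pcompose_smult)

lemma refl_poly_shifted_legendre: "refl_poly (shifted_legendre k) = smult ((-1) ^ k) (shifted_legendre k)"
  unfolding shifted_legendre_def refl_poly_smult refl_poly_higher_pderiv refl_poly_power refl_poly_legbase
  by simp

lemma refl_poly_assoc_legendre2: "refl_poly (assoc_legendre2 k) = smult ((-1) ^ k) (assoc_legendre2 k)"
proof -
  have "pderiv (pderiv (refl_poly p)) = refl_poly (pderiv (pderiv p))" for p
    by (simp add: pderiv_refl_poly pderiv_minus)
  from this[of "shifted_legendre k"] have "refl_poly (pderiv (pderiv (shifted_legendre k))) =
      smult ((-1) ^ k) (pderiv (pderiv (shifted_legendre k)))"
    by (simp add: refl_poly_shifted_legendre pderiv_smult)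
  moreover have "refl_poly ([:0, 1:] - [:0, 1:]\<^sup>2) = [:0, 1:] - [:0, 1:]\<^sup>2"
    by (simp add: poly_eq_poly_eq_iff[symmetric] fun_eq_iff power2_eq_square algebra_simps)
  ultimately show ?thesis
    unfolding assoc_legendre2_def refl_poly_mult by simp
qed

lemma poly_shifted_legendre_0: "poly (shifted_legendre k) 0 = (-1) ^ k"
proof -
  have "legbase = [:0, 1:] * [:-1, 1:]" by (simp add: power2_eq_square)
  then have "coeff (legbase ^ k) k = coeff (monom 1 k * [:-1, 1:] ^ k) k"
    by (simp only: power_mult_distrib) (simp add: monom_altdef)
  also have "\<dots> = (-1) ^ k"
    by (simp add: coeff_monom_mult coeff_0_power)
  finally show ?thesis
    by (simp add: shifted_legendre_def poly_0_coeff_0 coeff_higher_pderiv pochhammer_fact[symmetric])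
qed

lemma poly_shifted_legendre_1: "poly (shifted_legendre k) 1 = 1"
  using arg_cong[OF refl_poly_shifted_legendre[of k], of "\<lambda>p. poly p 0"]
  by (simp add: poly_shifted_legendre_0 flip: power_mult_distrib)

lemma coeff_shifted_legendre: "coeff (shifted_legendre k) k = fact (2 * k) / (fact k * fact k)"
proof -
  have "degree legbase = 2" "lead_coeff legbase = 1" by (simp_all add: power2_eq_square)
  then have "degree (legbase ^ k) = 2 * k" "lead_coeff (legbase ^ k) = 1"
    by (subst degree_power_eq, auto simp: lead_coeff_power)
  then have "coeff (legbase ^ k) (k + k) = 1" by (simp add: mult_2)
  moreover have "pochhammer (real (Suc k)) k = fact (2 * k) / fact k"
    using pochhammer_product'[of "1::real" k k]
    by (simp add: pochhammer_fact[symmetric] eq_divide_eq mult.commute flip: mult_2)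
  ultimately show ?thesis
    by (simp add: shifted_legendre_def coeff_higher_pderiv del: of_nat_Suc)
qed

text \<open>After subtracting the multiple of the Legendre polynomial with the same coefficient at
  \<open>n\<close>, the rest is zero or of degree below \<open>n\<close>, hence orthogonal to
  itself.\<close>

lemma pint_orthogonal_eq_shifted_legendre:
  assumes "degree f \<le> n" "\<And>r. degree r < n \<Longrightarrow> pint (f * r) = 0"
  shows "f = smult (coeff f n / coeff (shifted_legendre n) n) (shifted_legendre n)"
proof -
  define g where "g = f - smult (coeff f n / coeff (shifted_legendre n) n) (shifted_legendre n)"
  have "degree g \<le> n"
    unfolding g_def using assms(1) by (intro degree_diff_le) (auto simp: degree_shifted_legendre)
  moreover have "coeff g n = 0" by (simp add: g_def coeff_shifted_legendre)
  ultimately have "g = 0 \<or> degree g < n"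
    by (metis eq_zero_or_degree_less)
  then have "pint (g * g) = 0"
  proof
    assume g: "degree g < n"
    have "pint (g * g) = pint (f * g) - coeff f n / coeff (shifted_legendre n) n * pint (g * shifted_legendre n)"
      by (subst g_def) (simp add: algebra_simps pint_diff pint_smult)
    then show ?thesis using g by (simp add: assms(2) pint_mult_shifted_legendre_eq_0)
  qed simp
  then show ?thesis using pint_square_eq_0D[of g] by (simp add: g_def)
qed

section \<open>Nondegeneracy of the skew form, and integrals of associated Legendre
  polynomials\<close>

definition antideriv :: "real poly \<Rightarrow> real poly" where
  "antideriv p = (\<Sum>i\<le>degree p. monom (coeff p i / (real i + 1)) (Suc i))"

lemma pderiv_antideriv: "pderiv (antideriv p) = p"
proof -
  have "pderiv (antideriv p) = (\<Sum>i\<le>degree p. monom (coeff p i) i)"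
  proof -
    have "pderiv (sum f A) = (\<Sum>x\<in>A. pderiv (f x))" for f :: "nat \<Rightarrow> real poly" and A
      using higher_pderiv_sum[of 1 f A] by simp
    moreover have "1 + real i \<noteq> 0" for i by (metis of_nat_Suc of_nat_neq_0)
    ultimately show ?thesis by (simp add: antideriv_def pderiv_monom add.commute)
  qed
  then show ?thesis by (simp add: poly_as_sum_of_monoms)
qed

lemma poly_antideriv_0: "poly (antideriv p) 0 = 0"
  by (simp add: antideriv_def poly_sum poly_monom)

lemma degree_antideriv: "degree (antideriv p) \<le> Suc (degree p)"
  unfolding antideriv_def by (intro degree_sum_le) (auto intro: order_trans[OF degree_monom_le])

text \<open>\<open>e\<close> minus its mean is a multiple of the Legendre polynomial of degree \<open>n\<close>, whose values at
  the two endpoints have opposite signs.\<close>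

lemma Pi0_skew_nondegenerate:
  assumes "odd n" "e \<in> Pi0 n" and orth: "\<And>b. b \<in> Pi0 n \<Longrightarrow> pint (pderiv e * b) = 0"
  shows "e = 0"
proof -
  have n: "n \<ge> 1" using \<open>odd n\<close> by (cases n) auto
  have e: "degree e \<le> n" "poly e 0 = 0" "poly e 1 = 0" using assms(2) by (auto simp: Pi0_def)
  have *: "pint (e * r) = pint e * pint r" if r: "degree r < n" for r
  proof -
    \<comment> \<open>The primitive of \<open>r\<close> minus its mean that vanishes at 0 vanishes
      at 1 as well, so it is an admissible test function for \<open>orth\<close>.\<close>
    define b where "b = antideriv r - [:0, pint r:]"
    have "degree b \<le> n"
      unfolding b_def using r n degree_antideriv[of r] by (intro degree_diff_le) auto
    moreover have "poly (antideriv r) 1 = pint r"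
      using pint_pderiv[of "antideriv r"] by (simp add: pderiv_antideriv poly_antideriv_0)
    ultimately have "b \<in> Pi0 n" by (simp add: Pi0_def b_def poly_antideriv_0)
    moreover have "pderiv b = r - [:pint r:]" by (simp add: b_def pderiv_diff pderiv_antideriv pderiv_pCons)
    then have "e * pderiv b = e * r - smult (pint r) e" by (simp only: right_diff_distrib) simp
    then have "pint (e * pderiv b) = pint (e * r) - pint r * pint e" by (simp add: pint_diff pint_smult)
    ultimately show ?thesis
      using orth[of b] pint_by_parts[of e b] e by simp
  qed
  define f where "f = e - [:pint e:]"
  have "f = smult (coeff f n / coeff (shifted_legendre n) n) (shifted_legendre n)"
  proof (rule pint_orthogonal_eq_shifted_legendre)
    show "degree f \<le> n" unfolding f_def using e by (intro degree_diff_le) auto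
    show "pint (f * r) = 0" if "degree r < n" for r
      using *[OF that] by (simp add: f_def algebra_simps pint_diff pint_smult)
  qed
  then obtain c where c: "f = smult c (shifted_legendre n)" by blast
  have "poly f 0 = - c" "poly f 1 = c"
    using \<open>odd n\<close> by (simp_all add: c poly_shifted_legendre_0 poly_shifted_legendre_1)
  moreover have "poly f 0 = poly f 1" by (simp add: f_def e)
  ultimately have "c = 0" by simp
  then have "e = [:pint e:]" using c by (simp add: f_def)
  then obtain d where "e = [:d:]" by blast
  then show ?thesis using e by simp
qed

text \<open>Two integrations by parts take both derivatives off the Legendre polynomial. The first
  boundary term is zero, the second is the constant 1, and two consecutive Legendre moments combine
  into \<open>a_coeff\<close>.\<close>

lemma pint_monom_assoc_legendre2:
  assumes "1 \<le> j" "2 \<le> k"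
  shows "pint (monom 1 j * assoc_legendre2 k) = 1 - (if k \<le> j then a_coeff j k else 0)"
proof -
  let ?P = "shifted_legendre k"
  let ?c = "\<lambda>j. pint (monom 1 j * ?P)"
  let ?g = "monom 1 (j + 1) - monom 1 (j + 2) :: real poly"
  let ?h = "pderiv ?g"
  have g': "?h = smult (real j + 1) (monom 1 j) - smult (real j + 2) (monom 1 (j + 1))"
    by (simp add: pderiv_diff pderiv_monom smult_monom add.commute)
  have h': "pderiv ?h = smult ((real j + 1) * real j) (monom 1 (j - 1)) - smult ((real j + 2) * (real j + 1)) (monom 1 j)"
    unfolding g' using assms by (simp add: pderiv_diff pderiv_monom pderiv_smult smult_monom algebra_simps)
  have g: "monom 1 j * assoc_legendre2 k = ?g * pderiv (pderiv ?P)"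
  proof -
    have "monom 1 j * ([:0, 1:] - [:0, 1:]\<^sup>2) = ?g"
      by (simp add: monom_altdef algebra_simps power2_eq_square)
    then show ?thesis unfolding assoc_legendre2_def by (metis mult.assoc)
  qed
  have "pint (monom 1 j * assoc_legendre2 k) = - pint (?h * pderiv ?P)"
    unfolding g pint_by_parts by (simp add: poly_monom)
  also have "\<dots> = 1 + pint (pderiv ?h * ?P)"
  proof -
    have "poly ?h 0 = 0" "poly ?h 1 = -1" unfolding g' using assms by (simp_all add: poly_monom)
    then show ?thesis unfolding pint_by_parts by (simp add: poly_shifted_legendre_1)
  qed
  also have "\<dots> = 1 + (real j + 1) * (real j * ?c (j - 1) - (real j + 2) * ?c j)"
    unfolding h' by (simp add: left_diff_distrib pint_diff pint_smult) (simp add: algebra_simps)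
  also have "(real j + 1) * (real j * ?c (j - 1) - (real j + 2) * ?c j) = - (if k \<le> j then a_coeff j k else 0)"
  proof (cases "k \<le> j")
    case False
    then have "?c (j - 1) = 0" "?c j = 0"
      by (auto intro!: pint_mult_shifted_legendre_eq_0 simp: degree_monom_eq)
    then show ?thesis using False by simp
  next
    case True
    have G: "Gamma (real j + 2) = fact (j + 1)" "Gamma (real j) = fact (j - 1)"
      "Gamma (real j + real k + 2) = fact (j + k + 1)" "Gamma (real j - real k + 1) = fact (j - k)"
      using assms True Gamma_fact[of "j + 1", where 'a=real] Gamma_fact[of "j - 1", where 'a=real]
        Gamma_fact[of "j + k + 1", where 'a=real] Gamma_fact[of "j - k", where 'a=real]
      by (simp_all add: of_nat_diff add_ac)
    obtain i where i: "j = Suc i" using assms by (cases j) auto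
    \<comment> \<open>Ratio of consecutive Legendre moments. For \<open>k = j\<close> the closed
      form does not apply at \<open>j - 1\<close>, but both sides vanish: the left by orthogonality,
      the right through \<open>j - k\<close>.\<close>
    have "real j * real j * ?c (j - 1) = (real j + real k + 1) * (real j - real k) * ?c j"
    proof (cases "k = j")
      case True
      then have "?c (j - 1) = 0" using assms by (intro pint_mult_shifted_legendre_eq_0) (simp add: degree_monom_eq)
      then show ?thesis using True by simp
    next
      case False
      with \<open>k \<le> j\<close> obtain d where d: "j = Suc (k + d)" by (metis less_imp_Suc_add le_neq_implies_less)
      define a F D :: real where "a = fact (k + d)" and "F = fact (k + d + k + 1)" and "D = fact d"
      have nz: "F \<noteq> 0" "D \<noteq> 0" "real j + real k + 1 \<noteq> 0" "real j - real k \<noteq> 0"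
        by (simp_all add: F_def D_def d)
      have "fact j = real j * a" "fact (j + k + 1) = (real j + real k + 1) * F"
          "fact (j - k) = (real j - real k) * D"
        by (simp_all add: d a_def F_def D_def Suc_diff_le algebra_simps)
      then have "?c j = (real j * a) * (real j * a) / (((real j + real k + 1) * F) * ((real j - real k) * D))"
        by (simp only: pint_monom_shifted_legendre[OF \<open>k \<le> j\<close>])
      moreover have "?c (j - 1) = a * a / (F * D)"
        by (simp add: d pint_monom_shifted_legendre a_def F_def D_def)
      moreover have "J * J * (a * a / (F * D)) = X * Y * ((J * a) * (J * a) / ((X * F) * (Y * D)))"
        if "X \<noteq> 0" "Y \<noteq> 0" for J X Y
        using that nz by (simp add: field_simps)
      ultimately show ?thesis using nz(3,4) by simp
    qed
    then have "real j * ?c (j - 1) = (real j + real k + 1) * (real j - real k) / real j * ?c j"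
      using assms by (simp add: eq_divide_eq mult_ac)
    then have "(real j + 1) * (real j * ?c (j - 1) - (real j + 2) * ?c j) =
       (real j + 1) * (((real j + real k + 1) * (real j - real k) / real j - (real j + 2)) * ?c j)"
      by (simp only: left_diff_distrib)
    also have "(real j + real k + 1) * (real j - real k) / real j - (real j + 2) =
        - ((real j + real k + real k ^ 2) / real j)"
      using assms by (simp add: field_simps power2_eq_square)
    also have "(real j + 1) * (\<dots> * ?c j) = - ((real j + 1) * ((real j + real k + real k ^ 2) / real j * ?c j))"
      by simp
    also have "\<dots> = - a_coeff j k"
    proof -
      have f: "fact j = real j * fact (j - 1)" "fact (j + 1) = (real j + 1) * (real j * fact (j - 1))"
        by (simp_all add: i add.commute)
      have "(J + 1) * (Z / J * ((J * f) * (J * f) / (F * D))) = Z * ((J + 1) * (J * f)) * f / (F * D)"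
        if "J \<noteq> 0" for J Z f F D :: real
        using that by simp
      moreover have "real j \<noteq> 0" using assms by simp
      ultimately show ?thesis
        unfolding a_coeff_def G pint_monom_shifted_legendre[OF True] f by (simp del: fact_Suc)
    qed
    finally show ?thesis using True by simp
  qed
  finally show ?thesis by simp
qed

text \<open>Expand \<open>Q_j\<close> in monomials: every moment of positive order up to
  \<open>j\<close> against \<open>Q_k\<close> is 1, except that of \<open>x^j\<close> when
  \<open>j = k\<close>. The ones add up to \<open>Q_j(1) = 0\<close>; what survives is minus the
  leading coefficient times \<open>a_coeff k k\<close>.\<close>

lemma pint_assoc_legendre2_ge:
  assumes "2 \<le> j" "j \<le> k"
  shows "pint (assoc_legendre2 j * assoc_legendre2 k) =
    (if j = k then fact (k + 2) / ((2 * real k + 1) * fact (k - 2)) else 0)"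
proof -
  let ?Q = "assoc_legendre2 j"
  have Q0: "coeff ?Q 0 = 0" "poly ?Q 1 = 0"
    by (simp_all add: assoc_legendre2_def poly_0_coeff_0[symmetric])
  have d: "degree ?Q = j" by (rule degree_assoc_legendre2) fact
  have "?Q = (\<Sum>i\<le>j. monom (coeff ?Q i) i)" using poly_as_sum_of_monoms[of ?Q] d by simp
  then have "?Q * assoc_legendre2 k = (\<Sum>i\<le>j. monom (coeff ?Q i) i) * assoc_legendre2 k"
    by presburger
  also have "\<dots> = (\<Sum>i\<le>j. smult (coeff ?Q i) (monom 1 i * assoc_legendre2 k))"
    unfolding mult_smult_left[symmetric] smult_monom sum_distrib_right by simp
  finally have "?Q * assoc_legendre2 k = (\<Sum>i\<le>j. smult (coeff ?Q i) (monom 1 i * assoc_legendre2 k))" .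
  then have "pint (?Q * assoc_legendre2 k) = (\<Sum>i\<le>j. coeff ?Q i * pint (monom 1 i * assoc_legendre2 k))"
    by (simp add: pint_sum pint_smult)
  also have "\<dots> = (\<Sum>i\<le>j. coeff ?Q i - (if i = j \<and> j = k then coeff ?Q j * a_coeff k k else 0))"
  proof (rule sum.cong)
    fix i assume i: "i \<in> {..j}"
    show "coeff ?Q i * pint (monom 1 i * assoc_legendre2 k) =
      coeff ?Q i - (if i = j \<and> j = k then coeff ?Q j * a_coeff k k else 0)"
      using i assms Q0 by (cases "i = 0") (auto simp: pint_monom_assoc_legendre2 right_diff_distrib)
  qed simp
  also have "\<dots> = poly ?Q 1 - (if j = k then coeff ?Q k * a_coeff k k else 0)"
    by (simp add: sum_subtractf poly_altdef d)
  also have "\<dots> = (if j = k then - coeff (assoc_legendre2 k) k * a_coeff k k else 0)"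
    using Q0 by simp
  also have "- coeff (assoc_legendre2 k) k * a_coeff k k = fact (k + 2) / ((2 * real k + 1) * fact (k - 2))"
  proof -
    have k: "k \<ge> 2" using assms by simp
    then obtain l where l: "k = Suc (Suc l)" by (metis add_2_eq_Suc le_Suc_ex)
    have "assoc_legendre2 k = monom 1 1 * pderiv (pderiv (shifted_legendre k)) - monom 1 2 * pderiv (pderiv (shifted_legendre k))"
      by (simp add: assoc_legendre2_def monom_altdef algebra_simps)
    then have "coeff (assoc_legendre2 k) k =
        - (real (k - 1) * real k * coeff (shifted_legendre k) k)"
      using degree_shifted_legendre[of k]
      by (simp add: l coeff_monom_mult coeff_pderiv coeff_eq_0 numeral_2_eq_2)
    then have "- coeff (assoc_legendre2 k) k =
       real (k - 1) * real k * (fact (2 * k) / (fact k * fact k))"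
      by (simp add: coeff_shifted_legendre)
    moreover have "a_coeff k k = real k * (real k + 2) * fact (k + 1) * fact (k - 1) / fact (2 * k + 1)"
      using k Gamma_fact[of "k + 1", where 'a=real] Gamma_fact[of "k - 1", where 'a=real]
        Gamma_fact[of "2 * k + 1", where 'a=real]
      by (simp add: a_coeff_def of_nat_diff add_ac power2_eq_square algebra_simps)
    moreover have "real (k - 1) * real k * (fact (2 * k) / (fact k * fact k)) *
       (real k * (real k + 2) * fact (k + 1) * fact (k - 1) / fact (2 * k + 1)) =
       fact (k + 2) / ((2 * real k + 1) * fact (k - 2))"
      by (simp add: l divide_simps)
    ultimately show ?thesis by presburger
  qed
  finally show ?thesis .
qed

lemma pint_assoc_legendre2:
  assumes "2 \<le> j" "2 \<le> k"
  shows "pint (assoc_legendre2 j * assoc_legendre2 k) =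
    (if j = k then fact (k + 2) / ((2 * real k + 1) * fact (k - 2)) else 0)"
  using pint_assoc_legendre2_ge[of j k] pint_assoc_legendre2_ge[of k j] assms
  by (cases "j \<le> k") (auto simp: mult.commute)

section \<open>A skew form from the residue theorem\<close>

definition sq_poly :: "'i set \<Rightarrow> ('i \<Rightarrow> real) \<Rightarrow> real poly" where
  "sq_poly I t = (\<Prod>i\<in>I. [:- t i, 1:] ^ 2)"

text \<open>Each unordered pair of indices occurs in both orders, so this is the fourth power of the
  Vandermonde product, written symmetrically and for any index set so that a node can be
  removed.\<close>

definition vdm4 :: "'i set \<Rightarrow> ('i \<Rightarrow> real) \<Rightarrow> real" where
  "vdm4 I t = (\<Prod>i\<in>I. \<Prod>j\<in>I - {i}. (t i - t j) ^ 2)"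

lemma poly_sq_poly: "poly (sq_poly I t) x = (\<Prod>i\<in>I. (x - t i) ^ 2)"
  by (simp add: sq_poly_def poly_prod)

lemma sq_poly_cong: "(\<And>i. i \<in> I \<Longrightarrow> s i = t i) \<Longrightarrow> sq_poly I s = sq_poly I t"
  by (simp add: sq_poly_def)

lemma vdm4_cong: "(\<And>i. i \<in> I \<Longrightarrow> s i = t i) \<Longrightarrow> vdm4 I s = vdm4 I t"
  by (simp add: vdm4_def)

lemma degree_sq_poly: "finite I \<Longrightarrow> degree (sq_poly I t) = 2 * card I"
  unfolding sq_poly_def by (subst degree_prod_eq_sum_degree) (auto simp: degree_power_eq)

lemma lead_coeff_sq_poly: "finite I \<Longrightarrow> coeff (sq_poly I t) (2 * card I) = 1"
proof -
  assume I: "finite I"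
  have "lead_coeff (sq_poly I t) = 1" unfolding sq_poly_def by (simp add: lead_coeff_prod lead_coeff_power)
  then show ?thesis by (simp add: degree_sq_poly[OF I])
qed

lemma vdm4_remove:
  assumes "finite K" "i \<in> K"
  shows "vdm4 K t = vdm4 (K - {i}) t * poly (sq_poly (K - {i}) t) (t i) ^ 2"
proof -
  have "vdm4 K t = (\<Prod>j\<in>K - {i}. (t i - t j) ^ 2) * (\<Prod>k\<in>K - {i}. \<Prod>j\<in>K - {k}. (t k - t j) ^ 2)"
    unfolding vdm4_def by (rule prod.remove) (use assms in auto)
  also have "(\<Prod>k\<in>K - {i}. \<Prod>j\<in>K - {k}. (t k - t j) ^ 2) =
      (\<Prod>k\<in>K - {i}. (t i - t k) ^ 2 * (\<Prod>j\<in>K - {i} - {k}. (t k - t j) ^ 2))"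
  proof (rule prod.cong)
    fix k assume k: "k \<in> K - {i}"
    then have "K - {k} = insert i (K - {i} - {k})" "i \<notin> K - {i} - {k}" using assms by auto
    then show "(\<Prod>j\<in>K - {k}. (t k - t j) ^ 2) = (t i - t k) ^ 2 * (\<Prod>j\<in>K - {i} - {k}. (t k - t j) ^ 2)"
      using assms by (simp add: power2_commute)
  qed simp
  finally show ?thesis
    by (simp add: vdm4_def poly_sq_poly prod.distrib power2_eq_square)
qed

lemma linear_square_dvd:
  fixes p :: "real poly"
  assumes "poly p a = 0" "poly (pderiv p) a = 0"
  shows "[:- a, 1:] ^ 2 dvd p"
proof -
  obtain q where q: "p = [:- a, 1:] * q" using assms(1) by (auto simp: poly_eq_0_iff_dvd dvd_def)
  then have "pderiv p = q + [:- a, 1:] * pderiv q" unfolding q pderiv_mult by (simp add: pderiv_pCons)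
  then have "poly q a = 0" using assms(2) by simp
  then obtain r where "q = [:- a, 1:] * r" by (auto simp: poly_eq_0_iff_dvd dvd_def)
  then have "p = [:- a, 1:] ^ 2 * r" using q by (simp only: power2_eq_square mult.assoc)
  then show ?thesis by (rule dvdI)
qed

text \<open>Roots are counted with multiplicity: the nodes are distinct and each has order at least
  2.\<close>

lemma sq_poly_dvd:
  fixes s :: "'i \<Rightarrow> real"
  assumes "finite K" "inj_on s K" "p \<noteq> 0" "\<And>i. i \<in> K \<Longrightarrow> [:- s i, 1:] ^ 2 dvd p"
  shows "2 * card K \<le> degree p"
proof -
  have "2 * card K = (\<Sum>i\<in>K. 2)" by simp
  also have "\<dots> \<le> (\<Sum>i\<in>K. order (s i) p)"
    using assms(3,4) by (intro sum_mono) (metis order_divides)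
  also have "\<dots> = (\<Sum>x\<in>s ` K. order x p)"
    using assms(2) by (simp add: sum.reindex)
  also have "\<dots> \<le> (\<Sum>x\<in>{x. poly p x = 0}. order x p)"
  proof (rule sum_mono2)
    show "s ` K \<subseteq> {x. poly p x = 0}"
    proof safe
      fix i assume "i \<in> K"
      then have "[:- s i, 1:] dvd p" using assms(4) by (meson dvd_power dvd_trans pos2)
      then show "poly p (s i) = 0" by (simp add: poly_eq_0_iff_dvd)
    qed
  qed (use \<open>p \<noteq> 0\<close> poly_roots_finite in auto)
  also have "\<dots> \<le> degree p" by (rule sum_order_le_degree) fact
  finally show ?thesis .
qed

text \<open>Hermite interpolation at the double nodes \<open>s i\<close>: the right-hand side is the leading
  coefficient of the interpolant, i.e. the sum of the residues of \<open>\<psi>(z) / \<Prod>(z - s i)\<^sup>2\<close>.\<close>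

lemma hermite_leading_coeff:
  fixes \<psi> :: "real poly" and s :: "'i \<Rightarrow> real"
  assumes "finite K" "card K = Suc N" "inj_on s K" "degree \<psi> \<le> 2 * N + 1"
  defines "H \<equiv> \<lambda>i. sq_poly (K - {i}) s"
  shows "(\<Sum>i\<in>K. (poly (pderiv \<psi>) (s i) * poly (H i) (s i) - poly \<psi> (s i) * poly (pderiv (H i)) (s i)) /
           poly (H i) (s i) ^ 2) = coeff \<psi> (2 * N + 1)"
proof -
  \<comment> \<open>These values make \<open>B i\<close> agree with \<open>\<psi>\<close> to first
    order at \<open>s i\<close>; at all other nodes \<open>B i\<close> has double zeros.\<close>
  define c d where "c i = poly \<psi> (s i) / poly (H i) (s i)"
    and "d i = (poly (pderiv \<psi>) (s i) - c i * poly (pderiv (H i)) (s i)) / poly (H i) (s i)" for i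
  define B where "B i = smult (c i) (H i) + smult (d i) ([:- s i, 1:] * H i)" for i
  define \<Theta> where "\<Theta> = \<psi> - (\<Sum>i\<in>K. B i)"
  have Hnz: "poly (H i) (s i) \<noteq> 0" if "i \<in> K" for i
    using assms(1,3) that by (auto simp: H_def poly_sq_poly inj_on_def)
  have dH: "degree (H i) = 2 * N" "coeff (H i) (2 * N) = 1" if "i \<in> K" for i
    using that assms(1,2) degree_sq_poly[of "K - {i}" s] lead_coeff_sq_poly[of "K - {i}" s]
    by (simp_all add: H_def)
  have dB: "degree (B i) \<le> 2 * N + 1" "coeff (B i) (2 * N + 1) = d i" if "i \<in> K" for i
  proof -
    have "degree ([:- s i, 1:] * H i) \<le> 2 * N + 1"
      using degree_mult_le[of "[:- s i, 1:]" "H i"] dH[OF that] by simp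
    then show "degree (B i) \<le> 2 * N + 1" unfolding B_def using dH[OF that]
      by (intro degree_add_le) (auto intro: order_trans[OF degree_smult_le])
    show "coeff (B i) (2 * N + 1) = d i"
      using dH[OF that] by (simp add: B_def coeff_eq_0)
  qed
  have "degree \<Theta> \<le> 2 * N + 1"
    unfolding \<Theta>_def using assms(4) dB(1) assms(1) by (intro degree_diff_le degree_sum_le) auto
  moreover have "[:- s i, 1:] ^ 2 dvd \<Theta>" if i: "i \<in> K" for i
  proof -
    have "\<Theta> = \<psi> - B i - (\<Sum>j\<in>K - {i}. B j)"
      using assms(1) i by (simp add: \<Theta>_def sum.remove[of K i])
    moreover have "[:- s i, 1:] ^ 2 dvd (\<Sum>j\<in>K - {i}. B j)"
    proof (rule dvd_sum)
      fix j assume j: "j \<in> K - {i}"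
      have "[:- s i, 1:] ^ 2 dvd H j"
        unfolding H_def sq_poly_def using assms(1) i j by (intro dvd_prodI) auto
      then show "[:- s i, 1:] ^ 2 dvd B j"
        unfolding B_def by (intro dvd_add dvd_smult dvd_mult)
    qed
    moreover have "[:- s i, 1:] ^ 2 dvd \<psi> - B i"
    proof (rule linear_square_dvd)
      show "poly (\<psi> - B i) (s i) = 0" using Hnz[OF i] by (simp add: B_def c_def)
      show "poly (pderiv (\<psi> - B i)) (s i) = 0"
        using Hnz[OF i] by (simp add: B_def d_def pderiv_diff pderiv_add pderiv_smult pderiv_mult pderiv_pCons)
    qed
    ultimately show ?thesis by (metis dvd_diff)
  qed
  \<comment> \<open>The interpolation error has double zeros at \<open>N + 1\<close> nodes but
    degree at most \<open>2 * N + 1\<close>.\<close>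
  ultimately have "\<Theta> = 0"
    using sq_poly_dvd[of K s \<Theta>] assms(1-3) by force
  then have "coeff \<psi> (2 * N + 1) = coeff (\<Sum>i\<in>K. B i) (2 * N + 1)" by (simp add: \<Theta>_def)
  also have "\<dots> = (\<Sum>i\<in>K. d i)" using dB(2) by (simp add: coeff_sum)
  also have "\<dots> = (\<Sum>i\<in>K. (poly (pderiv \<psi>) (s i) * poly (H i) (s i) - poly \<psi> (s i) * poly (pderiv (H i)) (s i)) /
           poly (H i) (s i) ^ 2)"
    using Hnz by (intro sum.cong) (auto simp: d_def c_def field_simps power2_eq_square)
  finally show ?thesis ..
qed

text \<open>The residue identity times \<open>vdm4 K s\<close>, which clears the denominators by
  \<open>vdm4_remove\<close>. If two nodes coincide, every term vanishes: either both remain in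
  \<open>K - {i}\<close> and kill \<open>vdm4\<close>, or one is removed and the other gives
  \<open>H i\<close> a double zero at \<open>s i\<close>.\<close>

lemma skew_pointwise:
  fixes \<psi> :: "real poly" and s :: "'i \<Rightarrow> real"
  assumes "finite K" "card K = Suc N" "degree \<psi> \<le> 2 * N + 1"
  defines "H \<equiv> \<lambda>i. sq_poly (K - {i}) s"
  shows "(\<Sum>i\<in>K. (poly (pderiv \<psi>) (s i) * poly (H i) (s i) - poly \<psi> (s i) * poly (pderiv (H i)) (s i)) *
           vdm4 (K - {i}) s) = coeff \<psi> (2 * N + 1) * vdm4 K s"
proof (cases "inj_on s K")
  case True
  have "poly (H i) (s i) \<noteq> 0" if "i \<in> K" for i
    using assms(1) True that by (auto simp: H_def poly_sq_poly inj_on_def)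
  then have *: "vdm4 (K - {i}) s = vdm4 K s / poly (H i) (s i) ^ 2" if "i \<in> K" for i
    using that vdm4_remove[OF assms(1) that, of s] by (simp add: H_def)
  have "(\<Sum>i\<in>K. (poly (pderiv \<psi>) (s i) * poly (H i) (s i) - poly \<psi> (s i) * poly (pderiv (H i)) (s i)) *
           vdm4 (K - {i}) s) = (\<Sum>i\<in>K. (poly (pderiv \<psi>) (s i) * poly (H i) (s i) -
           poly \<psi> (s i) * poly (pderiv (H i)) (s i)) / poly (H i) (s i) ^ 2) * vdm4 K s"
    unfolding sum_distrib_right by (intro sum.cong) (simp_all add: *)
  also have "\<dots> = coeff \<psi> (2 * N + 1) * vdm4 K s"
    using hermite_leading_coeff[OF assms(1,2) True assms(3)] by (simp add: H_def)
  finally show ?thesis .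
next
  case False
  then obtain a b where ab: "a \<in> K" "b \<in> K" "a \<noteq> b" "s a = s b" by (auto simp: inj_on_def)
  have v0: "vdm4 I s = 0" if "finite I" "a \<in> I" "b \<in> I" for I
    unfolding vdm4_def using that ab by (intro prod_zero bexI[of _ a] prod_zero bexI[of _ b]) auto
  have H0: "poly (H i) (s i) = 0 \<and> poly (pderiv (H i)) (s i) = 0"
    if i: "i \<in> K" "j \<in> K" "i \<noteq> j" "s i = s j" for i j
  proof -
    have "[:- s i, 1:] ^ 2 dvd H i" unfolding H_def sq_poly_def using i assms(1)
      by (intro dvd_prodI[of _ j, THEN dvd_trans[rotated]]) auto
    then obtain r where "H i = [:- s i, 1:] ^ 2 * r" by (auto simp: dvd_def)
    then show ?thesis unfolding power2_eq_square pderiv_mult by (simp only: pderiv_mult poly_add poly_mult) simp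
  qed
  have "(poly (pderiv \<psi>) (s i) * poly (H i) (s i) - poly \<psi> (s i) * poly (pderiv (H i)) (s i)) *
           vdm4 (K - {i}) s = 0" if "i \<in> K" for i
    using H0[of a b] H0[of b a] v0[of "K - {i}"] ab assms(1) by (cases "i = a"; cases "i = b") auto
  then show ?thesis using v0[of K] ab assms(1) by (subst sum.neutral) auto
qed

section \<open>Integration over cubes with arbitrary index sets\<close>

definition cube :: "nat set \<Rightarrow> (nat \<Rightarrow> real) measure" where
  "cube I = Pi\<^sub>M I (\<lambda>_. unif)"

interpretation unif: prob_space unif by (rule prob_space_unif)
interpretation unifs: product_sigma_finite "\<lambda>_::nat. unif" by unfold_locales

lemma prob_space_cube: "prob_space (cube I)"
  unfolding cube_def by (intro prob_space_PiM prob_space_unif)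

lemma space_cube: "space (cube I) = I \<rightarrow>\<^sub>E {0..1}"
  by (simp add: cube_def space_PiM)

text \<open>An algebra of functions that are integrable because the cube is a probability space; its
  closure rules settle all integrability questions below.\<close>

definition bdd_meas :: "nat set \<Rightarrow> ((nat \<Rightarrow> real) \<Rightarrow> real) set" where
  "bdd_meas I = {g. g \<in> borel_measurable (cube I) \<and> (\<exists>C. \<forall>t\<in>space (cube I). \<bar>g t\<bar> \<le> C)}"

lemma bdd_meas_integrable: "g \<in> bdd_meas I \<Longrightarrow> integrable (cube I) g"
proof -
  assume g: "g \<in> bdd_meas I"
  interpret prob_space "cube I" by (rule prob_space_cube)
  from g obtain C where "\<forall>t\<in>space (cube I). \<bar>g t\<bar> \<le> C" by (auto simp: bdd_meas_def)
  then show ?thesis using g by (intro integrable_const_bound[of _ C]) (auto simp: bdd_meas_def)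
qed

lemma bdd_meas_const [intro!, simp]: "(\<lambda>_. c) \<in> bdd_meas I"
  by (auto simp: bdd_meas_def)

lemma bdd_meas_add [intro]: "f \<in> bdd_meas I \<Longrightarrow> g \<in> bdd_meas I \<Longrightarrow> (\<lambda>t. f t + g t) \<in> bdd_meas I"
  unfolding bdd_meas_def by (auto intro!: exI[of _ "_ + _"] order_trans[OF abs_triangle_ineq] add_mono)

lemma bdd_meas_mult [intro]:
  assumes "f \<in> bdd_meas I" "g \<in> bdd_meas I"
  shows "(\<lambda>t. f t * g t) \<in> bdd_meas I"
proof -
  from assms obtain C D where "\<And>t. t \<in> space (cube I) \<Longrightarrow> \<bar>f t\<bar> \<le> C" "\<And>t. t \<in> space (cube I) \<Longrightarrow> \<bar>g t\<bar> \<le> D"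
    by (auto simp: bdd_meas_def)
  then have "\<forall>t\<in>space (cube I). \<bar>f t * g t\<bar> \<le> C * D"
    unfolding abs_mult by (meson abs_ge_zero mult_mono order_trans)
  then show ?thesis using assms by (auto simp: bdd_meas_def)
qed

lemma bdd_meas_diff [intro]: "f \<in> bdd_meas I \<Longrightarrow> g \<in> bdd_meas I \<Longrightarrow> (\<lambda>t. f t - g t) \<in> bdd_meas I"
  using bdd_meas_add[of f I "\<lambda>t. (-1) * g t"] bdd_meas_mult[of "\<lambda>_. -1" I g] by simp

lemma bdd_meas_power [intro]: "f \<in> bdd_meas I \<Longrightarrow> (\<lambda>t. f t ^ n) \<in> bdd_meas I"
  by (induction n) auto

lemma bdd_meas_sum [intro]: "(\<And>a. a \<in> A \<Longrightarrow> f a \<in> bdd_meas I) \<Longrightarrow> (\<lambda>t. \<Sum>a\<in>A. f a t) \<in> bdd_meas I"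
  by (induction A rule: infinite_finite_induct) auto

lemma bdd_meas_prod [intro]: "(\<And>a. a \<in> A \<Longrightarrow> f a \<in> bdd_meas I) \<Longrightarrow> (\<lambda>t. \<Prod>a\<in>A. f a t) \<in> bdd_meas I"
  by (induction A rule: infinite_finite_induct) auto

lemma bdd_meas_poly [intro]: 
  assumes "i \<in> I"
  shows "(\<lambda>t. poly p (t i)) \<in> bdd_meas I"
proof -
  have "(\<lambda>t. t i) \<in> measurable (cube I) unif"
    unfolding cube_def using assms by (rule measurable_component_singleton)
  then have "(\<lambda>t. poly p (t i)) \<in> borel_measurable (cube I)"
    by (rule measurable_compose) (intro measurable_unif borel_measurable_poly)
  moreover obtain C where "\<forall>x\<in>{0..1}. \<bar>poly p x\<bar> \<le> C" using poly_bounded_unit by blast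
  ultimately show ?thesis using assms unfolding bdd_meas_def space_cube by (auto simp: PiE_iff)
qed

lemma bdd_meas_coord [intro]: "i \<in> I \<Longrightarrow> (\<lambda>t. t i) \<in> bdd_meas I"
  using bdd_meas_poly[of i I "[:0, 1:]"] by simp

lemma bdd_meas_vdm4 [intro]: "J \<subseteq> I \<Longrightarrow> (\<lambda>t. vdm4 J t) \<in> bdd_meas I"
  unfolding vdm4_def by (intro bdd_meas_prod bdd_meas_power bdd_meas_diff bdd_meas_coord) auto

lemma bdd_meas_coeff_sq_poly [intro]:
  assumes "J \<subseteq> I"
  shows "(\<lambda>t. coeff (sq_poly J t) k) \<in> bdd_meas I"
proof -
  have *: "(\<lambda>t. coeff (\<Prod>i\<in>J. P i t) k) \<in> bdd_meas I"
    if "\<And>i k. i \<in> J \<Longrightarrow> (\<lambda>t. coeff (P i t) k) \<in> bdd_meas I" for P :: "nat \<Rightarrow> (nat \<Rightarrow> real) \<Rightarrow> real poly" 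
    using that
  proof (induction J arbitrary: k rule: infinite_finite_induct)
    case (insert x F)
    then show ?case unfolding prod.insert[OF insert(1,2)] coeff_mult
      by (intro bdd_meas_sum bdd_meas_mult) auto
  qed auto
  have "(\<lambda>t. coeff ([:- t i, 1:] ^ 2) k) \<in> bdd_meas I" if "i \<in> J" for i k
  proof -
    have "(\<lambda>t. coeff [:- t i, 1:] k) \<in> bdd_meas I" for k
    proof -
      have "(\<lambda>t::nat \<Rightarrow> real. coeff [:- t i, 1:] k) = (\<lambda>t. (if k = 0 then 1 else 0) * (0 - t i) + (if k = 1 then 1 else 0))"
        by (rule ext) (auto simp: coeff_pCons split: nat.splits)
      also have "\<dots> \<in> bdd_meas I" using that assms by (intro bdd_meas_add bdd_meas_mult bdd_meas_diff bdd_meas_coord) auto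
      finally show ?thesis .
    qed
    then show ?thesis unfolding power2_eq_square coeff_mult by (intro bdd_meas_sum bdd_meas_mult) auto
  qed
  then show ?thesis unfolding sq_poly_def by (intro *[of "\<lambda>i t. [:- t i, 1:] ^ 2"]) auto
qed

definition cube_int :: "nat set \<Rightarrow> ((nat \<Rightarrow> real) \<Rightarrow> real) \<Rightarrow> real" where
  "cube_int I g = (\<integral>t. g t \<partial>cube I)"

lemma cube_int_add: "f \<in> bdd_meas I \<Longrightarrow> g \<in> bdd_meas I \<Longrightarrow> cube_int I (\<lambda>t. f t + g t) = cube_int I f + cube_int I g"
  by (simp add: cube_int_def bdd_meas_integrable)

lemma cube_int_cmult: "cube_int I (\<lambda>t. c * g t) = c * cube_int I g"
  by (simp add: cube_int_def)

lemma cube_int_sum: "(\<And>a. a \<in> A \<Longrightarrow> f a \<in> bdd_meas I) \<Longrightarrow> cube_int I (\<lambda>t. \<Sum>a\<in>A. f a t) = (\<Sum>a\<in>A. cube_int I (f a))"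
  by (simp add: cube_int_def bdd_meas_integrable)

lemma cube_int_remove:
  assumes "finite K" "i \<in> K" "g \<in> bdd_meas K"
  shows "cube_int K g = cube_int (K - {i}) (\<lambda>t. \<integral>y. g (t(i := y)) \<partial>unif)"
proof -
  have "insert i (K - {i}) = K" using assms by auto
  then show ?thesis
    using unifs.product_integral_insert[of "K - {i}" i g] assms bdd_meas_integrable[OF assms(3)]
    by (simp add: cube_int_def cube_def)
qed

text \<open>All coordinates carry the same measure, so relabelling them preserves the product
  measure. The bijection is only known to exist by cardinality, hence \<open>inv\<close> is asked of
  every bijection.\<close>

lemma cube_int_reindex:
  assumes "finite I" "finite J" "card I = card J"
    and g: "g \<in> bdd_meas I"
    and inv: "\<And>\<pi> t. bij_betw \<pi> I J \<Longrightarrow> g (\<lambda>i\<in>I. t (\<pi> i)) = h t"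
  shows "cube_int I g = cube_int J h"
proof -
  obtain \<pi> where \<pi>: "bij_betw \<pi> I J" using assms finite_same_card_bij by blast
  then have "distr (cube J) (cube I) (\<lambda>\<omega>. \<lambda>n\<in>I. \<omega> (\<pi> n)) = cube I"
    unfolding cube_def
    using distr_PiM_reindex[of J "\<lambda>_. unif" \<pi> I] prob_space_unif
    by (auto simp: bij_betw_def)
  then have "cube_int I g = (\<integral>t. g t \<partial>distr (cube J) (cube I) (\<lambda>\<omega>. \<lambda>n\<in>I. \<omega> (\<pi> n)))"
    by (simp add: cube_int_def)
  also have "\<dots> = (\<integral>t. g (\<lambda>i\<in>I. t (\<pi> i)) \<partial>cube J)"
  proof (rule integral_distr)
    show "(\<lambda>\<omega>. \<lambda>n\<in>I. \<omega> (\<pi> n)) \<in> cube J \<rightarrow>\<^sub>M cube I"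
      unfolding cube_def using \<pi> by (intro measurable_restrict measurable_component_singleton) (auto simp: bij_betw_def)
    show "g \<in> borel_measurable (cube I)" using g by (simp add: bdd_meas_def)
  qed
  finally show ?thesis using inv[OF \<pi>] by (simp add: cube_int_def)
qed

text \<open>Reflection preserves each factor measure and therefore the product; this is what makes
  odd integrands integrate to zero.\<close>

lemma cube_int_reflect:
  assumes "finite I" and g: "g \<in> bdd_meas I"
  shows "cube_int I g = cube_int I (\<lambda>t. g (\<lambda>i\<in>I. 1 - t i))"
proof -
  have m: "(\<lambda>x. 1 - x) \<in> unif \<rightarrow>\<^sub>M unif"
    unfolding unif_def by (intro measurable_restrict_space3) auto
  have "distr unif unif (\<lambda>x. 1 - x) = unif"
  proof (rule measure_eqI)
    fix A assume "A \<in> sets (distr unif unif (\<lambda>x. 1 - x))"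
    then have A: "A \<in> sets borel" "A \<subseteq> {0..1}" by (auto simp: unif_def sets_restrict_space)
    have "emeasure (distr unif unif (\<lambda>x. 1 - x)) A = emeasure unif ((\<lambda>x. 1 - x) -` A)"
    proof (subst emeasure_distr[OF m])
      show "A \<in> sets unif" using A by (auto simp: unif_def sets_restrict_space)
      have "(\<lambda>x. 1 - x) -` A \<inter> space unif = (\<lambda>x. 1 - x) -` A" using A by auto
      then show "emeasure unif ((\<lambda>x. 1 - x) -` A \<inter> space unif) = emeasure unif ((\<lambda>x. 1 - x) -` A)" by simp
    qed
    also have "\<dots> = emeasure lborel ((\<lambda>x. 1 - x) -` A)"
      using A unfolding unif_def by (subst emeasure_restrict_space) auto
    also have "\<dots> = emeasure (distr lborel borel (\<lambda>x. 1 + (-1) * x)) A"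
      using A by (subst emeasure_distr) auto
    also have "distr lborel borel (\<lambda>x. 1 + (-1) * x) = (lborel :: real measure)"
      using lborel_distr_uminus lborel_distr_plus by (subst lborel_real_affine[of "-1" 1]) (auto simp: density_1)
    also have "emeasure lborel A = emeasure unif A"
      using A unfolding unif_def by (subst emeasure_restrict_space) auto
    finally show "emeasure (distr unif unif (\<lambda>x. 1 - x)) A = emeasure unif A" .
  qed simp
  then have "distr (cube I) (cube I) (compose I (\<lambda>x. 1 - x)) = cube I"
    unfolding cube_def using distr_PiM_finite_prob_space'[of I "\<lambda>_. unif" "\<lambda>_. unif" "\<lambda>x. 1 - x"]
      assms(1) prob_space_unif m by simp
  moreover have "compose I (\<lambda>x. 1 - x) = (\<lambda>t. \<lambda>i\<in>I. 1 - t i :: real)"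
    by (auto simp: compose_def fun_eq_iff)
  ultimately have "cube_int I g = (\<integral>t. g t \<partial>distr (cube I) (cube I) (\<lambda>t. \<lambda>i\<in>I. 1 - t i))"
    by (simp add: cube_int_def)
  also have "\<dots> = (\<integral>t. g (\<lambda>i\<in>I. 1 - t i) \<partial>cube I)"
  proof (rule integral_distr)
    show "(\<lambda>t. \<lambda>i\<in>I. 1 - t i) \<in> cube I \<rightarrow>\<^sub>M cube I"
      unfolding cube_def using m by (intro measurable_restrict measurable_compose[OF measurable_component_singleton]) auto
    show "g \<in> borel_measurable (cube I)" using g by (simp add: bdd_meas_def)
  qed
  finally show ?thesis by (simp add: cube_int_def)
qed

text \<open>The polynomial-valued integral of \<open>sq_poly I t\<close> against the weight
  \<open>w\<close>, formed coefficient by coefficient.\<close>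

definition mean_poly :: "nat set \<Rightarrow> ((nat \<Rightarrow> real) \<Rightarrow> real) \<Rightarrow> real poly" where
  "mean_poly I w = (\<Sum>k\<le>2 * card I. monom (cube_int I (\<lambda>t. coeff (sq_poly I t) k * w t)) k)"

lemma degree_mean_poly: "degree (mean_poly I w) \<le> 2 * card I"
  unfolding mean_poly_def by (intro degree_sum_le) (auto intro: order_trans[OF degree_monom_le])

lemma coeff_mean_poly: "finite I \<Longrightarrow> coeff (mean_poly I w) (2 * card I) = cube_int I w"
  by (simp add: mean_poly_def coeff_sum lead_coeff_sq_poly if_distrib cong: if_cong)

text \<open>A linear functional sees only finitely many coefficients and therefore passes under the
  integral. It is applied to point evaluation, to the skew form and to the functional behind
  \<open>h_tilde\<close>.\<close>

lemma mean_poly_functional: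
  assumes "finite I" "w \<in> bdd_meas I"
    and add: "\<And>p q. L (p + q) = L p + (L q :: real)" and smult: "\<And>c p. L (smult c p) = c * L p"
  shows "L (mean_poly I w) = cube_int I (\<lambda>t. L (sq_poly I t) * w t)"
proof -
  have L0: "L 0 = 0" using smult[of 0 0] by simp
  have Lsum: "L (\<Sum>k\<in>A. f k) = (\<Sum>k\<in>A. L (f k))" for A :: "nat set" and f
    by (induction A rule: infinite_finite_induct) (simp_all add: L0 add)
  have Lm: "L (monom c k) = c * L (monom 1 k)" for c k
    using smult[of c "monom 1 k"] by (simp add: smult_monom)
  have "L (sq_poly I t) = (\<Sum>k\<le>2 * card I. coeff (sq_poly I t) k * L (monom 1 k))" for t
  proof -
    have "sq_poly I t = (\<Sum>k\<le>2 * card I. monom (coeff (sq_poly I t) k) k)"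
      using poly_as_sum_of_monoms[of "sq_poly I t"] degree_sq_poly[OF assms(1), of t] by simp
    then have "L (sq_poly I t) = (\<Sum>k\<le>2 * card I. L (monom (coeff (sq_poly I t) k) k))"
      by (metis Lsum)
    then show ?thesis by (subst (asm) Lm)
  qed
  then have "cube_int I (\<lambda>t. L (sq_poly I t) * w t) =
      cube_int I (\<lambda>t. \<Sum>k\<le>2 * card I. L (monom 1 k) * (coeff (sq_poly I t) k * w t))"
    by (simp add: sum_distrib_right sum_distrib_left mult_ac)
  also have "\<dots> = (\<Sum>k\<le>2 * card I. L (monom 1 k) * cube_int I (\<lambda>t. coeff (sq_poly I t) k * w t))"
    using assms(2) by (subst cube_int_sum) (auto simp: cube_int_cmult intro!: bdd_meas_mult bdd_meas_coeff_sq_poly)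
  also have "\<dots> = L (mean_poly I w)"
    unfolding mean_poly_def Lsum by (subst (2) Lm) (simp add: mult.commute)
  finally show ?thesis ..
qed

lemma poly_mean_poly: "finite I \<Longrightarrow> w \<in> bdd_meas I \<Longrightarrow> poly (mean_poly I w) x = cube_int I (\<lambda>t. poly (sq_poly I t) x * w t)"
  by (rule mean_poly_functional) auto

section \<open>The weights and the integrated skew relations\<close>

definition wt :: "nat set \<Rightarrow> (nat \<Rightarrow> real) \<Rightarrow> real" where
  "wt I t = vdm4 I t * (\<Prod>i\<in>I. (t i) ^ 2)"

definition qwt :: "real poly \<Rightarrow> nat set \<Rightarrow> (nat \<Rightarrow> real) \<Rightarrow> real" where
  "qwt q I t = wt I t * (\<Sum>i\<in>I. poly q (t i))"

lemma wt_cong: "(\<And>i. i \<in> I \<Longrightarrow> s i = t i) \<Longrightarrow> wt I s = wt I t"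
  unfolding wt_def by (metis (mono_tags, lifting) prod.cong vdm4_cong)

lemma qwt_cong: "(\<And>i. i \<in> I \<Longrightarrow> s i = t i) \<Longrightarrow> qwt q I s = qwt q I t"
  unfolding qwt_def by (metis (mono_tags, lifting) sum.cong wt_cong)

lemma bdd_meas_wt [intro]: "J \<subseteq> I \<Longrightarrow> (\<lambda>t. wt J t) \<in> bdd_meas I"
  unfolding wt_def by (intro bdd_meas_mult bdd_meas_vdm4 bdd_meas_prod bdd_meas_power bdd_meas_coord) auto

lemma bdd_meas_qwt [intro]: "J \<subseteq> I \<Longrightarrow> (\<lambda>t. qwt q J t) \<in> bdd_meas I"
  unfolding qwt_def by (intro bdd_meas_mult bdd_meas_wt bdd_meas_sum bdd_meas_poly) auto

lemma sq_poly_reindex: "bij_betw \<pi> I J \<Longrightarrow> sq_poly I (\<lambda>i\<in>I. t (\<pi> i)) = sq_poly J t"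
  unfolding sq_poly_def by (subst prod.reindex_bij_betw[symmetric]) (auto intro: prod.cong)

lemma vdm4_reindex:
  assumes "bij_betw \<pi> I J"
  shows "vdm4 I (\<lambda>i\<in>I. t (\<pi> i)) = vdm4 J t"
proof -
  have "vdm4 I (\<lambda>i\<in>I. t (\<pi> i)) = (\<Prod>i\<in>I. \<Prod>j\<in>I - {i}. (t (\<pi> i) - t (\<pi> j)) ^ 2)"
    unfolding vdm4_def by (intro prod.cong) auto
  also have "\<dots> = (\<Prod>i\<in>I. \<Prod>j\<in>J - {\<pi> i}. (t (\<pi> i) - t j) ^ 2)"
  proof (rule prod.cong)
    fix i assume "i \<in> I"
    then have "bij_betw \<pi> (I - {i}) (J - {\<pi> i})"
      using assms by (auto simp: bij_betw_def inj_on_def)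
    then show "(\<Prod>j\<in>I - {i}. (t (\<pi> i) - t (\<pi> j)) ^ 2) = (\<Prod>j\<in>J - {\<pi> i}. (t (\<pi> i) - t j) ^ 2)"
      by (rule prod.reindex_bij_betw)
  qed simp
  also have "\<dots> = vdm4 J t"
    unfolding vdm4_def by (rule prod.reindex_bij_betw[OF assms])
  finally show ?thesis .
qed

lemma wt_reindex:
  assumes "bij_betw \<pi> I J"
  shows "wt I (\<lambda>i\<in>I. t (\<pi> i)) = wt J t"
  using prod.reindex_bij_betw[OF assms, of "\<lambda>i. (t i) ^ 2"]
  by (simp add: wt_def vdm4_reindex[OF assms])

lemma qwt_reindex:
  assumes "bij_betw \<pi> I J"
  shows "qwt q I (\<lambda>i\<in>I. t (\<pi> i)) = qwt q J t"
  using sum.reindex_bij_betw[OF assms, of "\<lambda>i. poly q (t i)"]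
  by (simp add: qwt_def wt_reindex[OF assms])

lemma mean_poly_reindex:
  assumes "finite I" "finite J" "card I = card J" "w \<in> bdd_meas I"
    and "\<And>\<pi> t. bij_betw \<pi> I J \<Longrightarrow> w (\<lambda>i\<in>I. t (\<pi> i)) = w' t"
  shows "mean_poly I w = mean_poly J w'"
  unfolding mean_poly_def assms(3)
  by (intro sum.cong refl arg_cong2[where f = monom] cube_int_reindex assms bdd_meas_mult bdd_meas_coeff_sq_poly order_refl)
    (simp add: sq_poly_reindex assms(5))

lemma poly_pderiv_sq_poly:
  assumes "finite I"
  shows "poly (pderiv (sq_poly I t)) x = (\<Sum>k<2 * card I. (1 + real k) * coeff (sq_poly I t) (Suc k) * x ^ k)"
proof -
  have "degree (pderiv (sq_poly I t)) = 2 * card I - 1"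
    using assms by (simp add: degree_pderiv degree_sq_poly)
  moreover have "{..<2 * card I} = (if card I = 0 then {} else {..2 * card I - 1})" by auto
  ultimately show ?thesis
    using assms by (auto simp: poly_altdef coeff_pderiv sq_poly_def)
qed

text \<open>By \<open>cong\<close>, \<open>w\<close> is independent of coordinate \<open>i\<close>.
  Integrating over that coordinate first leaves a linear functional of
  \<open>sq_poly (K - {i})\<close>, which then passes through the average over the other
  nodes.\<close>

lemma cube_int_skew:
  fixes \<psi> \<rho> :: "real poly"
  assumes K: "finite K" "i \<in> K" and w: "w \<in> bdd_meas (K - {i})" "w \<in> bdd_meas K"
    and cong: "\<And>s t. (\<And>j. j \<in> K - {i} \<Longrightarrow> s j = t j) \<Longrightarrow> w s = w t"
  defines "H \<equiv> \<lambda>s. sq_poly (K - {i}) s" and "f \<equiv> mean_poly (K - {i}) w"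
  shows "(\<lambda>s. (poly (pderiv \<psi>) (s i) * poly (H s) (s i) - poly \<psi> (s i) * poly (pderiv (H s)) (s i)) *
            poly \<rho> (s i) * w s) \<in> bdd_meas K"
    and "cube_int K (\<lambda>s. (poly (pderiv \<psi>) (s i) * poly (H s) (s i) - poly \<psi> (s i) * poly (pderiv (H s)) (s i)) *
            poly \<rho> (s i) * w s) = pint (\<rho> * (pderiv \<psi> * f - \<psi> * pderiv f))"
proof -
  let ?L = "\<lambda>p. pint (\<rho> * (pderiv \<psi> * p - \<psi> * pderiv p))"
  have "(\<lambda>s. poly (pderiv (H s)) (s i)) \<in> bdd_meas K"
    unfolding H_def using K
    by (subst poly_pderiv_sq_poly) (auto intro!: bdd_meas_sum bdd_meas_mult bdd_meas_power bdd_meas_coeff_sq_poly)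
  moreover have "(\<lambda>s. poly (H s) (s i)) \<in> bdd_meas K"
    unfolding H_def poly_sq_poly using K by (intro bdd_meas_prod bdd_meas_power bdd_meas_diff bdd_meas_coord) auto
  ultimately show 1: "(\<lambda>s. (poly (pderiv \<psi>) (s i) * poly (H s) (s i) - poly \<psi> (s i) * poly (pderiv (H s)) (s i)) *
            poly \<rho> (s i) * w s) \<in> bdd_meas K"
    using K w by (intro bdd_meas_mult bdd_meas_diff bdd_meas_poly) auto
  have upd: "H (t(i := y)) = H t" "w (t(i := y)) = w t" for t y
    unfolding H_def by (auto intro!: sq_poly_cong cong split: if_splits)
  have "cube_int K (\<lambda>s. (poly (pderiv \<psi>) (s i) * poly (H s) (s i) - poly \<psi> (s i) * poly (pderiv (H s)) (s i)) *
            poly \<rho> (s i) * w s) = cube_int (K - {i}) (\<lambda>t. ?L (sq_poly (K - {i}) t) * w t)"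
    unfolding cube_int_remove[OF K 1] upd by (simp add: pint_def H_def mult_ac)
  also have "\<dots> = ?L f"
    unfolding f_def using K w
    by (intro mean_poly_functional[symmetric])
      (auto simp: algebra_simps pint_diff pint_add pint_smult pderiv_add pderiv_smult)
  finally show "cube_int K (\<lambda>s. (poly (pderiv \<psi>) (s i) * poly (H s) (s i) - poly \<psi> (s i) * poly (pderiv (H s)) (s i)) *
            poly \<rho> (s i) * w s) = ?L f" .
qed

text \<open>The factor \<open>x\<close> absorbs the weight \<open>x^2\<close> of the removed node
  into the two entries of the skew form. With \<open>q = Q_j\<close>, \<open>A_poly\<close> is the
  polynomial \<open>A\<close> of the introductory text.\<close>

definition a_poly :: "nat \<Rightarrow> real poly" where
  "a_poly N = [:0, 1:] * mean_poly {1..N} (wt {1..N})"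

definition A_poly :: "real poly \<Rightarrow> nat \<Rightarrow> real poly" where
  "A_poly q N = [:0, 1:] * mean_poly {1..N} (qwt q {1..N})"

text \<open>A Wronskian releases a factor common to both entries as its square.\<close>

lemma skew_mult_X:
  fixes f \<psi> :: "real poly"
  shows "[:0, 1:] ^ 2 * (pderiv \<psi> * f - \<psi> * pderiv f) =
    [:0, 1:] * f * pderiv ([:0, 1:] * \<psi>) - pderiv ([:0, 1:] * f) * ([:0, 1:] * \<psi>)"
  unfolding pderiv_mult by (simp add: pderiv_pCons algebra_simps power2_eq_square)

lemma mean_poly_wt:
  "finite I \<Longrightarrow> card I = N \<Longrightarrow> mean_poly I (wt I) = mean_poly {1..N} (wt {1..N})"
  by (intro mean_poly_reindex) (auto simp: wt_reindex)

lemma mean_poly_qwt: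
  "finite I \<Longrightarrow> card I = N \<Longrightarrow> mean_poly I (qwt q I) = mean_poly {1..N} (qwt q {1..N})"
  by (intro mean_poly_reindex) (auto simp: qwt_reindex)

text \<open>Integrate \<open>skew_pointwise\<close>, multiplied by all the squares of the nodes,
  over \<open>N + 1\<close> nodes. By symmetry the \<open>N + 1\<close> summands have equal
  integrals.\<close>

lemma skew_a_poly:
  assumes "poly b 0 = 0" "degree b \<le> 2 * N + 2"
  shows "real (Suc N) * pint (a_poly N * pderiv b - pderiv (a_poly N) * b) =
    coeff b (2 * N + 2) * cube_int {1..Suc N} (wt {1..Suc N})"
proof -
  obtain \<psi> where b: "b = [:0, 1:] * \<psi>" using assms(1) by (metis dvdE minus_zero poly_eq_0_iff_dvd)
  then have \<psi>: "degree \<psi> \<le> 2 * N + 1" "coeff \<psi> (2 * N + 1) = coeff b (2 * N + 2)"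
    using assms(2) by (cases "\<psi> = 0"; simp)+
  define K where "K = {1..Suc N}"
  have K: "finite K" "card K = Suc N" by (auto simp: K_def)
  let ?H = "\<lambda>i s. sq_poly (K - {i}) s"
  let ?f = "mean_poly {1..N} (wt {1..N})"
  let ?T = "\<lambda>i s. (poly (pderiv \<psi>) (s i) * poly (?H i s) (s i) - poly \<psi> (s i) * poly (pderiv (?H i s)) (s i)) *
            poly ([:0, 1:] ^ 2) (s i) * wt (K - {i}) s"
  have T: "?T i \<in> bdd_meas K" "cube_int K (?T i) = pint ([:0, 1:] ^ 2 * (pderiv \<psi> * ?f - \<psi> * pderiv ?f))" if "i \<in> K" for i
  proof -
    have f: "?f = mean_poly (K - {i}) (wt (K - {i}))"
      using K that by (intro mean_poly_wt[symmetric]) auto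
    show "?T i \<in> bdd_meas K" by (intro cube_int_skew K that) (auto intro: wt_cong)
    show "cube_int K (?T i) = pint ([:0, 1:] ^ 2 * (pderiv \<psi> * ?f - \<psi> * pderiv ?f))"
      unfolding f by (intro cube_int_skew K that) (auto intro: wt_cong)
  qed
  have "(\<Sum>i\<in>K. ?T i s) = coeff \<psi> (2 * N + 1) * wt K s" for s
  proof -
    have "?T i s = (poly (pderiv \<psi>) (s i) * poly (?H i s) (s i) - poly \<psi> (s i) * poly (pderiv (?H i s)) (s i)) *
       vdm4 (K - {i}) s * (\<Prod>i\<in>K. (s i) ^ 2)" if "i \<in> K" for i
      using that K by (simp add: wt_def prod.remove[of K i])
    then have "(\<Sum>i\<in>K. ?T i s) = (\<Sum>i\<in>K. (poly (pderiv \<psi>) (s i) * poly (?H i s) (s i) - poly \<psi> (s i) * poly (pderiv (?H i s)) (s i)) *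
       vdm4 (K - {i}) s) * (\<Prod>i\<in>K. (s i) ^ 2)"
      unfolding sum_distrib_right by (intro sum.cong) auto
    then show ?thesis unfolding skew_pointwise[OF K \<psi>(1)] by (simp add: wt_def)
  qed
  then have "coeff \<psi> (2 * N + 1) * cube_int K (wt K) = cube_int K (\<lambda>s. \<Sum>i\<in>K. ?T i s)"
    by (simp add: cube_int_cmult)
  also have "\<dots> = (\<Sum>i\<in>K. cube_int K (?T i))" by (rule cube_int_sum) (rule T(1))
  also have "\<dots> = real (Suc N) * pint ([:0, 1:] ^ 2 * (pderiv \<psi> * ?f - \<psi> * pderiv ?f))"
    unfolding K(2)[symmetric] sum_constant[symmetric] by (intro sum.cong T(2)) auto
  finally show ?thesis
    unfolding skew_mult_X a_poly_def b[symmetric] \<psi>(2) K_def ..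
qed

text \<open>As before, with the additional factor given by the sum of \<open>q\<close> over all
  nodes. It splits into the sum over the remaining nodes, which yields \<open>A_poly\<close>, and
  the value at the removed node, which stays inside the skew form of \<open>a_poly\<close>. The
  degree bound, one lower than in \<open>skew_a_poly\<close>, makes the right-hand side
  zero.\<close>

lemma skew_A_poly:
  assumes "poly b 0 = 0" "degree b \<le> 2 * N + 1"
  shows "pint (A_poly q N * pderiv b - pderiv (A_poly q N) * b) +
    pint (q * (a_poly N * pderiv b - pderiv (a_poly N) * b)) = 0"
proof -
  obtain \<psi> where b: "b = [:0, 1:] * \<psi>" using assms(1) by (metis dvdE minus_zero poly_eq_0_iff_dvd)
  then have \<psi>: "degree \<psi> \<le> 2 * N + 1" "coeff \<psi> (2 * N + 1) = 0"
    using assms(2) by (cases "\<psi> = 0"; simp add: coeff_eq_0)+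
  define K where "K = {1..Suc N}"
  have K: "finite K" "card K = Suc N" by (auto simp: K_def)
  let ?H = "\<lambda>i s. sq_poly (K - {i}) s"
  let ?f = "mean_poly {1..N} (wt {1..N})" and ?F = "mean_poly {1..N} (qwt q {1..N})"
  let ?S = "\<lambda>i s. (poly (pderiv \<psi>) (s i) * poly (?H i s) (s i) - poly \<psi> (s i) * poly (pderiv (?H i s)) (s i))"
  let ?T1 = "\<lambda>i s. ?S i s * poly ([:0, 1:] ^ 2) (s i) * qwt q (K - {i}) s"
  let ?T2 = "\<lambda>i s. ?S i s * poly (q * [:0, 1:] ^ 2) (s i) * wt (K - {i}) s"
  have T1: "?T1 i \<in> bdd_meas K" "cube_int K (?T1 i) = pint ([:0, 1:] ^ 2 * (pderiv \<psi> * ?F - \<psi> * pderiv ?F))" if "i \<in> K" for i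
  proof -
    have f: "?F = mean_poly (K - {i}) (qwt q (K - {i}))"
      using K that by (intro mean_poly_qwt[symmetric]) auto
    show "?T1 i \<in> bdd_meas K" by (intro cube_int_skew K that) (auto intro: qwt_cong)
    show "cube_int K (?T1 i) = pint ([:0, 1:] ^ 2 * (pderiv \<psi> * ?F - \<psi> * pderiv ?F))"
      unfolding f by (intro cube_int_skew K that) (auto intro: qwt_cong)
  qed
  have T2: "?T2 i \<in> bdd_meas K" "cube_int K (?T2 i) = pint (q * [:0, 1:] ^ 2 * (pderiv \<psi> * ?f - \<psi> * pderiv ?f))" if "i \<in> K" for i
  proof -
    have f: "?f = mean_poly (K - {i}) (wt (K - {i}))"
      using K that by (intro mean_poly_wt[symmetric]) auto
    show "?T2 i \<in> bdd_meas K" by (intro cube_int_skew K that) (auto intro: wt_cong)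
    show "cube_int K (?T2 i) = pint (q * [:0, 1:] ^ 2 * (pderiv \<psi> * ?f - \<psi> * pderiv ?f))"
      unfolding f by (intro cube_int_skew K that) (auto intro: wt_cong)
  qed
  have "(\<Sum>i\<in>K. ?T1 i s + ?T2 i s) = 0" for s
  proof -
    let ?P = "(\<Prod>i\<in>K. (s i) ^ 2) * (\<Sum>i\<in>K. poly q (s i))"
    have "?T1 i s + ?T2 i s = ?S i s * vdm4 (K - {i}) s * ?P" if "i \<in> K" for i
      using that K by (simp add: wt_def qwt_def prod.remove[of K i] sum.remove[of K i])
        (simp add: algebra_simps)
    then have "(\<Sum>i\<in>K. ?T1 i s + ?T2 i s) = (\<Sum>i\<in>K. ?S i s * vdm4 (K - {i}) s) * ?P"
      unfolding sum_distrib_right by (intro sum.cong) auto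
    then show ?thesis unfolding skew_pointwise[OF K \<psi>(1)] \<psi>(2) by (simp only: mult_zero_left)
  qed
  then have "0 = cube_int K (\<lambda>s. \<Sum>i\<in>K. ?T1 i s + ?T2 i s)"
    by (simp add: cube_int_def)
  also have "\<dots> = (\<Sum>i\<in>K. cube_int K (\<lambda>s. ?T1 i s + ?T2 i s))"
    by (rule cube_int_sum) (rule bdd_meas_add[OF T1(1) T2(1)])
  also have "\<dots> = (\<Sum>i\<in>K. cube_int K (?T1 i) + cube_int K (?T2 i))"
    by (intro sum.cong cube_int_add T1(1) T2(1)) auto
  also have "\<dots> = real (Suc N) * (pint ([:0, 1:] ^ 2 * (pderiv \<psi> * ?F - \<psi> * pderiv ?F)) +
      pint (q * [:0, 1:] ^ 2 * (pderiv \<psi> * ?f - \<psi> * pderiv ?f)))"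
    unfolding K(2)[symmetric] sum_constant[symmetric]
    by (intro sum.cong arg_cong2[where f = "(+)"] T1(2) T2(2)) auto
  finally have "pint ([:0, 1:] ^ 2 * (pderiv \<psi> * ?F - \<psi> * pderiv ?F)) +
      pint (q * ([:0, 1:] ^ 2 * (pderiv \<psi> * ?f - \<psi> * pderiv ?f))) = 0"
    by (simp add: mult.assoc del: of_nat_Suc)
  then show ?thesis
    unfolding skew_mult_X a_poly_def A_poly_def b[symmetric] .
qed

section \<open>The Selberg-type integral and the reduction to it\<close>

text \<open>The constant \<open>S\<close>, a Selberg integral: evaluation at 1 turns the averaged
  \<open>sq_poly\<close> into the factors \<open>(1 - t_i)^2\<close>.\<close>

definition selberg_int :: "nat \<Rightarrow> real" where
  "selberg_int N = poly (a_poly N) 1"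

lemma selberg_int_eq: "selberg_int N = cube_int {1..N} (\<lambda>t. (\<Prod>i=1..N. (1 - t i) ^ 2) * wt {1..N} t)"
  by (simp add: selberg_int_def a_poly_def poly_mean_poly bdd_meas_wt poly_sq_poly)

lemma degree_X_mult: "degree ([:0, 1:] * (p :: real poly)) \<le> Suc (degree p)"
  using degree_mult_le[of "[:0, 1:]" p] by simp

lemma degree_a_poly: "degree (a_poly N) \<le> 2 * N + 1"
  unfolding a_poly_def using degree_mean_poly[of "{1..N}" "wt {1..N}"]
  by (intro order_trans[OF degree_X_mult]) simp

lemma degree_A_poly: "degree (A_poly q N) \<le> 2 * N + 1"
  unfolding A_poly_def using degree_mean_poly[of "{1..N}" "qwt q {1..N}"]
  by (intro order_trans[OF degree_X_mult]) simp

lemma a_poly_0 [simp]: "poly (a_poly N) 0 = 0"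
  by (simp add: a_poly_def)

lemma A_poly_0 [simp]: "poly (A_poly q N) 0 = 0"
  by (simp add: A_poly_def)

text \<open>The difference lies in \<open>Pi0\<close>, so by nondegeneracy it is enough to test it
  there. Against such \<open>b\<close>, \<open>skew_a_poly\<close> has zero right-hand side, and the
  Legendre polynomial is orthogonal to the derivative of \<open>b\<close>. The summand 1 corrects
  the value at 0 and drops out under differentiation.\<close>

lemma a_poly_eq: "a_poly N = smult (selberg_int N / 2) (1 + shifted_legendre (2 * N + 1))"
proof -
  let ?n = "2 * N + 1"
  define e where "e = a_poly N - smult (selberg_int N / 2) (1 + shifted_legendre ?n)"
  have "e = 0"
  proof (rule Pi0_skew_nondegenerate)
    show "odd ?n" by simp
    have "degree (1 + shifted_legendre ?n) \<le> ?n"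
      by (intro degree_add_le) (auto simp: degree_shifted_legendre)
    then show "e \<in> Pi0 ?n"
      using degree_a_poly[of N] unfolding Pi0_def e_def mem_Collect_eq
      by (intro conjI degree_diff_le) (auto simp: selberg_int_def[symmetric] poly_shifted_legendre_0 poly_shifted_legendre_1)
    fix b assume "b \<in> Pi0 ?n"
    then have b: "degree b \<le> ?n" "poly b 0 = 0" "poly b 1 = 0" by (auto simp: Pi0_def)
    have "pint (a_poly N * pderiv b - pderiv (a_poly N) * b) = 0"
      using skew_a_poly[of b N] b by (simp add: coeff_eq_0)
    then have 1: "pint (pderiv (a_poly N) * b) = 0"
      using pint_by_parts[of "a_poly N" b] b by (simp add: pint_diff)
    have "degree (pderiv b) < ?n" using b by (simp add: degree_pderiv)
    then have "pint (pderiv (shifted_legendre ?n) * b) = 0"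
      using pint_by_parts[of "shifted_legendre ?n" b] b pint_mult_shifted_legendre_eq_0[of "pderiv b" ?n]
      by (simp add: mult.commute)
    then show "pint (pderiv e * b) = 0"
      using 1 by (simp add: e_def pderiv_diff pderiv_smult pderiv_add pderiv_1 left_diff_distrib pint_diff pint_smult)
  qed
  then show ?thesis by (simp add: e_def)
qed

text \<open>Leading coefficients in \<open>a_poly_eq\<close>: since \<open>sq_poly\<close> is monic,
  that of \<open>a_poly\<close> is the integral of the weight.\<close>

lemma cube_int_wt: "cube_int {1..N} (wt {1..N}) = selberg_int N / 2 * (fact (4 * N + 2) / (fact (2 * N + 1) * fact (2 * N + 1)))"
proof -
  have "cube_int {1..N} (wt {1..N}) = coeff (a_poly N) (Suc (2 * N))"
    using coeff_mean_poly[of "{1..N}" "wt {1..N}"] by (simp add: a_poly_def)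
  also have "\<dots> = selberg_int N / 2 * coeff (shifted_legendre (Suc (2 * N))) (Suc (2 * N))"
    by (subst a_poly_eq) (simp add: coeff_eq_0)
  finally show ?thesis by (simp add: coeff_shifted_legendre del: fact_Suc)
qed

text \<open>\<open>skew_a_poly\<close> tested with \<open>x^(2 * N + 2)\<close>, just outside the
  range where the right-hand side vanishes; the left-hand side is known from
  \<open>a_poly_eq\<close>.\<close>

lemma cube_int_wt_Suc:
  "cube_int {1..Suc N} (wt {1..Suc N}) =
     selberg_int N * real (Suc N) * real (2 * N + 2) * (fact (2 * N + 1) * fact (2 * N + 1) / fact (4 * N + 3))"
proof -
  let ?n = "2 * N + 1"
  let ?b = "monom 1 (2 * N + 2) :: real poly"
  let ?I = "fact ?n * fact ?n / fact (4 * N + 3) :: real"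
  have "cube_int {1..Suc N} (wt {1..Suc N}) = real (Suc N) * (pint (a_poly N * pderiv ?b) - pint (pderiv (a_poly N) * ?b))"
    using skew_a_poly[of ?b N] by (simp add: poly_monom degree_monom_eq pint_diff)
  also have "pint (pderiv (a_poly N) * ?b) = selberg_int N - pint (a_poly N * pderiv ?b)"
    using pint_by_parts[of "a_poly N" ?b] by (simp add: poly_monom selberg_int_def)
  also have "pint (a_poly N * pderiv ?b) = real (2 * N + 2) * pint (monom 1 ?n * a_poly N)"
  proof -
    have "pderiv ?b = smult (real (2 * N + 2)) (monom 1 ?n)" by (simp add: pderiv_monom smult_monom)
    then show ?thesis by (simp only: mult_smult_right pint_smult mult.commute)
  qed
  also have "pint (monom 1 ?n * a_poly N) = selberg_int N / 2 * (1 / real (2 * N + 2) + ?I)"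
  proof -
    have "pint (monom 1 ?n :: real poly) = 1 / real (2 * N + 2)"
      using pint_beta[of ?n 0] by (simp add: monom_altdef add_ac)
    moreover have "pint (monom 1 ?n * shifted_legendre ?n) = ?I"
      using pint_monom_shifted_legendre[of ?n ?n] by (simp del: fact_Suc add: numeral_eq_Suc add_ac)
    ultimately show ?thesis
      by (subst a_poly_eq) (simp only: mult_smult_right pint_smult distrib_left pint_add mult_1_right)
  qed
  also have "real (Suc N) * (M * (s / 2 * (1 / M + J)) - (s - M * (s / 2 * (1 / M + J)))) = s * real (Suc N) * M * J"
    if "M \<noteq> 0" for M s J :: real
    using that by (simp add: field_simps)
  finally show ?thesis by simp
qed

lemma selberg_int_0: "selberg_int 0 = 1"
proof -
  interpret prob_space "cube {}" by (rule prob_space_cube)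
  show ?thesis by (simp add: selberg_int_eq wt_def vdm4_def cube_int_def prob_space)
qed

text \<open>Equates the two evaluations of the weight integral over \<open>N + 1\<close> nodes, one
  through \<open>S\<close> at \<open>N + 1\<close> and one through \<open>S\<close> at
  \<open>N\<close>.\<close>

lemma selberg_int_Suc:
  "selberg_int (Suc N) = selberg_int N * 2 * real (Suc N) * real (2 * N + 2) * (fact (2 * N + 1) * fact (2 * N + 1) / fact (4 * N + 3)) *
     (fact (2 * N + 3) * fact (2 * N + 3) / fact (4 * N + 6))"
  using cube_int_wt[of "Suc N"] unfolding cube_int_wt_Suc
  by (simp add: field_simps numeral_eq_Suc del: fact_Suc of_nat_Suc)

section \<open>Reflection parity and the determination of \<open>A_poly\<close>\<close>

lemma pint_odd: "refl_poly p = - p \<Longrightarrow> pint p = 0"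
  using pint_refl_poly[of p] by (simp add: pint_uminus)

lemma pint_mult_refl_poly: "pint (p * refl_poly q) = pint (refl_poly p * q)"
  using pint_refl_poly[of "refl_poly p * q"] by (simp add: refl_poly_mult)

text \<open>Again the difference of both sides lies in \<open>Pi0\<close> and is tested there.
  \<open>skew_A_poly\<close> is applied to a test polynomial of parity opposite to \<open>q\<close>,
  so that the terms containing the Legendre polynomial are odd and drop out, leaving a multiple of
  the integral of \<open>q' b\<close>.\<close>

lemma A_poly_reflect:
  assumes q: "q \<in> Pi0 (2 * N + 1)" "refl_poly q = smult \<sigma> q" and \<sigma>: "\<sigma> = 1 \<or> \<sigma> = -1"
    and A1: "\<sigma> = -1 \<Longrightarrow> poly (A_poly q N) 1 = 0"
  shows "A_poly q N + smult \<sigma> (refl_poly (A_poly q N)) =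
    smult (poly (A_poly q N) 1) ([:0, 1:] + smult \<sigma> [:1, -1:]) - smult (selberg_int N / 2) q"
proof -
  let ?n = "2 * N + 1"
  let ?A = "A_poly q N"
  let ?c = "poly ?A 1"
  define P where "P = shifted_legendre ?n"
  have aP: "a_poly N = smult (selberg_int N / 2) (1 + P)" unfolding P_def by (rule a_poly_eq)
  define e where "e = ?A + smult \<sigma> (refl_poly ?A) + smult (selberg_int N / 2) q - smult ?c ([:0, 1:] + smult \<sigma> [:1, -1:])"
  have \<sigma>2: "\<sigma> * \<sigma> = 1" using \<sigma> by auto
  have q': "degree q \<le> ?n" "poly q 0 = 0" "poly q 1 = 0" using q by (auto simp: Pi0_def)
  have "e = 0"
  proof (rule Pi0_skew_nondegenerate)
    show "odd ?n" by simp
    have "degree e \<le> ?n"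
      unfolding e_def using q' degree_A_poly[of q N]
      by (intro degree_diff_le degree_add_le order_trans[OF degree_smult_le]) auto
    then show "e \<in> Pi0 ?n"
      by (simp add: Pi0_def e_def q' algebra_simps)
    fix b assume "b \<in> Pi0 ?n"
    then have b: "degree b \<le> ?n" "poly b 0 = 0" "poly b 1 = 0" by (auto simp: Pi0_def)
    \<comment> \<open>Twice the part of \<open>b\<close> with parity \<open>- \<sigma>\<close>.
      Pairing with it symmetrizes \<open>A_poly\<close>, and the integrands in \<open>z1\<close> and
      \<open>z2\<close> become odd.\<close>
    define \<beta> where "\<beta> = b - smult \<sigma> (refl_poly b)"
    have refl_diff: "refl_poly (p - r) = refl_poly p - refl_poly r" for p r
      by (simp add: refl_poly_def pcompose_diff)
    have \<beta>: "degree \<beta> \<le> ?n" "poly \<beta> 0 = 0" "poly \<beta> 1 = 0" "refl_poly \<beta> = smult (- \<sigma>) \<beta>"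
      unfolding \<beta>_def using b \<sigma>2
      by (auto intro!: degree_diff_le order_trans[OF degree_smult_le]
          simp: refl_diff refl_poly_smult smult_diff_right)
    have rq: "refl_poly (pderiv q) = smult (- \<sigma>) (pderiv q)"
      using arg_cong[OF q(2), of pderiv] by (simp add: pderiv_refl_poly pderiv_smult minus_equation_iff)
    have rP: "refl_poly P = - P"
      unfolding P_def by (subst refl_poly_shifted_legendre) simp
    have rP': "refl_poly (pderiv P) = pderiv P"
      using arg_cong[OF rP, of pderiv] unfolding pderiv_refl_poly pderiv_minus by simp
    have a': "pderiv (a_poly N) = smult (selberg_int N / 2) (pderiv P)"
      by (subst aP) (simp add: pderiv_smult pderiv_add pderiv_1)
    have z1: "pint (q * pderiv (a_poly N) * \<beta>) = 0"
      by (rule pint_odd) (use \<sigma>2 in \<open>simp add: a' refl_poly_mult refl_poly_smult q(2) rP' \<beta>(4) mult_ac\<close>)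
    have z2: "pint (pderiv q * P * \<beta>) = 0"
      by (rule pint_odd) (use \<sigma>2 in \<open>simp add: refl_poly_mult rq rP \<beta>(4) mult_ac\<close>)
    have qb: "pint (pderiv q * \<beta>) = 2 * pint (pderiv q * b)"
      unfolding \<beta>_def using \<sigma>2
      by (simp add: right_diff_distrib pint_diff pint_smult pint_mult_refl_poly rq pint_uminus flip: mult.assoc)
    have "pint (pderiv q * a_poly N * \<beta>) = selberg_int N / 2 * (pint (pderiv q * \<beta>) + pint (pderiv q * P * \<beta>))"
      by (subst aP) (simp add: distrib_left distrib_right pint_add pint_smult)
    then have z3: "pint (pderiv q * a_poly N * \<beta>) = selberg_int N * pint (pderiv q * b)"
      using z2 qb by simp
    have p1: "pint (?A * pderiv \<beta>) = - pint (pderiv ?A * \<beta>)"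
      using pint_by_parts[of ?A \<beta>] \<beta> by simp
    have p2: "pint (q * a_poly N * pderiv \<beta>) = - pint (pderiv q * a_poly N * \<beta>) - pint (q * pderiv (a_poly N) * \<beta>)"
      using pint_by_parts[of "q * a_poly N" \<beta>] \<beta>
      by (simp only: pderiv_mult distrib_right distrib_left pint_add mult_ac)
    have "pint (?A * pderiv \<beta> - pderiv ?A * \<beta>) +
        pint (q * (a_poly N * pderiv \<beta> - pderiv (a_poly N) * \<beta>)) = 0"
      using \<beta> by (intro skew_A_poly) auto
    then have "- 2 * pint (pderiv ?A * \<beta>) - pint (pderiv q * a_poly N * \<beta>) - 2 * pint (q * pderiv (a_poly N) * \<beta>) = 0"
      using p1 p2 by (simp add: pint_diff right_diff_distrib mult.assoc)
    then have A\<beta>: "pint (pderiv ?A * \<beta>) = - (selberg_int N / 2 * pint (pderiv q * b))"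
      using z1 z3 by simp
    have "pint (pderiv ?A * \<beta>) = pint (pderiv ?A * b) - \<sigma> * pint (refl_poly (pderiv ?A) * b)"
      by (simp add: \<beta>_def right_diff_distrib pint_diff pint_smult pint_mult_refl_poly)
    moreover have "pderiv e = pderiv ?A - smult \<sigma> (refl_poly (pderiv ?A)) + smult (selberg_int N / 2) (pderiv q)"
    proof -
      \<comment> \<open>The slope of the affine part vanishes: for \<open>\<sigma> = 1\<close> the
        part is constant, and for \<open>\<sigma> = -1\<close> its factor is zero by
        \<open>A1\<close>.\<close>
      have "smult ?c (1 - smult \<sigma> 1) = 0" using \<sigma> A1 by auto
      then show ?thesis
        by (simp add: e_def pderiv_diff pderiv_add pderiv_smult pderiv_refl_poly pderiv_pCons one_pCons)
    qed
    ultimately show "pint (pderiv e * b) = 0"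
      using A\<beta> by (simp add: distrib_right left_diff_distrib pint_add pint_diff pint_smult)
  qed
  then show ?thesis by (simp add: e_def algebra_simps)
qed

text \<open>At 1 the squares \<open>(1 - t_i)^2\<close> complete the weight to one invariant under
  reflecting all nodes, while the sum of \<open>q\<close> changes sign.\<close>

lemma A_poly_1_odd:
  assumes "refl_poly q = - q"
  shows "poly (A_poly q N) 1 = 0"
proof -
  let ?I = "{1..N}"
  let ?g = "\<lambda>t. poly (sq_poly ?I t) 1 * qwt q ?I t"
  have q: "poly q (1 - x) = - poly q x" for x
    using arg_cong[OF assms, of "\<lambda>p. poly p x"] by simp
  have v: "vdm4 ?I (\<lambda>i\<in>?I. 1 - t i) = vdm4 ?I t" for t
    unfolding vdm4_def by (intro prod.cong) (auto simp: power2_commute)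
  have "?g (\<lambda>i\<in>?I. 1 - t i) = - ?g t" for t
    by (simp add: poly_sq_poly qwt_def wt_def v[unfolded One_nat_def] q sum_negf)
  moreover have g: "?g \<in> bdd_meas ?I"
    unfolding poly_sq_poly by (intro bdd_meas_mult bdd_meas_prod bdd_meas_power bdd_meas_diff bdd_meas_coord bdd_meas_qwt bdd_meas_const) auto
  ultimately have "cube_int ?I ?g = - cube_int ?I ?g"
    using cube_int_reflect[OF _ g] by (simp add: cube_int_def)
  then show ?thesis by (simp add: A_poly_def poly_mean_poly bdd_meas_qwt)
qed

text \<open>Pair \<open>A_poly_reflect\<close> with \<open>Q_k\<close>. As \<open>Q_k\<close> has
  the same parity, \<open>A\<close> and its reflection contribute equally, and likewise the two
  affine terms, for which the integral of \<open>x Q_k\<close> is 1.\<close>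

lemma pint_A_poly_assoc_legendre2:
  assumes "2 \<le> j" "j \<le> 2 * N + 1" "2 \<le> k" "even (j + k)"
  defines "A \<equiv> A_poly (assoc_legendre2 j) N"
  shows "poly A 1 - pint (A * assoc_legendre2 k) = selberg_int N / 4 * pint (assoc_legendre2 j * assoc_legendre2 k)"
proof -
  define \<sigma> :: real where "\<sigma> = (-1) ^ j"
  have \<sigma>: "\<sigma> = 1 \<or> \<sigma> = -1" "\<sigma> * \<sigma> = 1" by (auto simp: \<sigma>_def minus_one_power_iff)
  have rj: "refl_poly (assoc_legendre2 j) = smult \<sigma> (assoc_legendre2 j)"
    by (simp add: \<sigma>_def refl_poly_assoc_legendre2)
  have rk: "refl_poly (assoc_legendre2 k) = smult \<sigma> (assoc_legendre2 k)"
    using assms(4) by (auto simp: \<sigma>_def refl_poly_assoc_legendre2 minus_one_power_iff)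
  let ?Q = "assoc_legendre2 k"
  have X: "pint ([:0, 1:] * ?Q) = 1"
    using pint_monom_assoc_legendre2[of 1 k] assms(3) by (simp add: monom_altdef)
  have refl1: "pint (refl_poly p * ?Q) = \<sigma> * pint (p * ?Q)" for p
    using pint_mult_refl_poly[of p ?Q] by (simp add: rk pint_smult)
  have X': "refl_poly [:0, 1:] = [:1, -1:]" by (simp add: refl_poly_def pcompose_pCons)
  have "A + smult \<sigma> (refl_poly A) =
      smult (poly A 1) ([:0, 1:] + smult \<sigma> (refl_poly [:0, 1:])) - smult (selberg_int N / 2) (assoc_legendre2 j)"
    unfolding A_def X' using rj \<sigma>
    by (intro A_poly_reflect assoc_legendre2_in_Pi0 assms A_poly_1_odd) auto
  then have "pint ((A + smult \<sigma> (refl_poly A)) * ?Q) =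
      pint ((smult (poly A 1) ([:0, 1:] + smult \<sigma> (refl_poly [:0, 1:])) - smult (selberg_int N / 2) (assoc_legendre2 j)) * ?Q)"
    by simp
  then have "pint (A * ?Q) + (\<sigma> * \<sigma>) * pint (A * ?Q) = poly A 1 * (pint ([:0, 1:] * ?Q) + (\<sigma> * \<sigma>) * pint ([:0, 1:] * ?Q)) -
      selberg_int N / 2 * pint (assoc_legendre2 j * ?Q)"
    unfolding distrib_right left_diff_distrib pint_add pint_diff mult_smult_left pint_smult refl1 smult_add_right
    by (simp add: algebra_simps)
  moreover have "pint (pCons 0 ?Q) = 1" using X by simp
  ultimately show ?thesis by (simp add: \<sigma>)
qed

section \<open>Translation of \<open>h_tilde\<close> and of the integral over the unit cube\<close>

lemma vandermonde_power4: "vandermonde N t ^ 4 = vdm4 {1..N} t"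
proof -
  let ?U = "{(j, k). 1 \<le> j \<and> j < k \<and> k \<le> N}"
  let ?f = "\<lambda>(i, j). (t i - t j) ^ 2 :: real"
  have *: "(x - y) ^ 2 * (y - x) ^ 2 = (y - x) ^ 4" for x y :: real
    by (simp add: power2_commute[of x y] flip: power_add)
  have fin: "finite ?U" by (rule finite_subset[of _ "{..N} \<times> {..N}"]) auto
  have "vdm4 {1..N} t = (\<Prod>p\<in>Sigma {1..N} (\<lambda>i. {1..N} - {i}). ?f p)"
    unfolding vdm4_def by (subst prod.Sigma) auto
  also have "Sigma {1..N} (\<lambda>i. {1..N} - {i}) = ?U \<union> prod.swap ` ?U"
    by (auto simp: image_iff)
  also have "(\<Prod>p\<in>?U \<union> prod.swap ` ?U. ?f p) = (\<Prod>p\<in>?U. ?f p) * (\<Prod>p\<in>prod.swap ` ?U. ?f p)"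
    using fin by (intro prod.union_disjoint) auto
  also have "(\<Prod>p\<in>prod.swap ` ?U. ?f p) = (\<Prod>p\<in>?U. ?f (prod.swap p))"
    by (subst prod.reindex) auto
  also have "(\<Prod>p\<in>?U. ?f p) * (\<Prod>p\<in>?U. ?f (prod.swap p)) = (\<Prod>p\<in>?U. (case p of (j, k) \<Rightarrow> t k - t j) ^ 4)"
    unfolding prod.distrib[symmetric] by (intro prod.cong) (auto simp: *)
  also have "\<dots> = vandermonde N t ^ 4"
    by (simp add: vandermonde_def prod_power_distrib)
  finally show ?thesis ..
qed

lemma coeff_prod_linear_factors:
  "coeff (\<Prod>i\<in>{1..N}. [:1, - t i:]) d = (-1) ^ d * elem_sym N d t"
proof -
  have "(\<Prod>i\<in>{1..N}. [:1, - t i:]) = (\<Prod>i\<in>{1..N}. monom (- t i) 1 + 1)"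
    by (intro prod.cong) (auto simp: monom_altdef one_pCons)
  also have "\<dots> = (\<Sum>S\<in>Pow {1..N}. (\<Prod>i\<in>S. monom (- t i) 1) * (\<Prod>i\<in>{1..N} - S. 1))"
    by (rule prod_add) simp
  also have "\<dots> = (\<Sum>S\<in>Pow {1..N}. monom ((-1) ^ card S * (\<Prod>i\<in>S. t i)) (card S))"
  proof (intro sum.cong refl)
    fix S assume "S \<in> Pow {1..N}"
    then have "finite S" by (auto intro: finite_subset)
    then have "(\<Prod>i\<in>S. monom (- t i) 1) = monom ((-1) ^ card S * (\<Prod>i\<in>S. t i)) (card S)"
      by (induction S rule: finite_induct) (simp_all add: mult_monom algebra_simps)
    then show "(\<Prod>i\<in>S. monom (- t i) 1) * (\<Prod>i\<in>{1..N} - S. 1) = monom ((-1) ^ card S * (\<Prod>i\<in>S. t i)) (card S)"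
      by simp
  qed
  finally have "coeff (\<Prod>i\<in>{1..N}. [:1, - t i:]) d =
      (\<Sum>S\<in>Pow {1..N}. if card S = d then (-1) ^ d * (\<Prod>i\<in>S. t i) else 0)"
    by (simp add: coeff_sum) (intro sum.cong, auto)
  also have "\<dots> = (\<Sum>S | S \<in> Pow {1..N} \<and> card S = d. (-1) ^ d * (\<Prod>i\<in>S. t i))"
    by (intro sum.inter_filter[symmetric]) simp
  finally show ?thesis by (simp add: elem_sym_def sum_distrib_left)
qed

text \<open>The reversed polynomial of \<open>sq_poly\<close> is the square of the product of the
  \<open>1 - t_i x\<close>, whose coefficients are the signed elementary symmetric
  functions.\<close>

lemma elem_sym2_eq_coeff:
  assumes "d \<le> 2 * N"
  shows "elem_sym2 N d t = (-1) ^ d * coeff (sq_poly {1..N} t) (2 * N - d)"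
proof -
  let ?R = "\<Prod>i\<in>{1..N}. [:1, - t i:]"
  have r: "reflect_poly [:- a, 1:] = [:1, - a:]" for a :: real by (simp add: reflect_poly_def)
  have "reflect_poly (sq_poly {1..N} t) = ?R * ?R"
    unfolding sq_poly_def reflect_poly_prod reflect_poly_power
    by (simp only: r power2_eq_square prod.distrib)
  then have "coeff (sq_poly {1..N} t) (2 * N - d) = coeff (?R * ?R) d"
    using assms coeff_reflect_poly[of "sq_poly {1..N} t" d] by (simp add: degree_sq_poly)
  also have "\<dots> = (\<Sum>i\<le>d. ((-1) ^ i * elem_sym N i t) * ((-1) ^ (d - i) * elem_sym N (d - i) t))"
    unfolding coeff_mult coeff_prod_linear_factors ..
  also have "\<dots> = (\<Sum>i\<le>d. (-1) ^ d * (elem_sym N i t * elem_sym N (d - i) t))"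
    by (intro sum.cong) (auto simp: power_add[symmetric] mult_ac simp flip: power_add)
  also have "\<dots> = (-1) ^ d * (\<Sum>i\<le>d. elem_sym N i t * elem_sym N (d - i) t)"
    by (simp add: sum_distrib_left)
  also have "(\<Sum>i\<le>d. elem_sym N i t * elem_sym N (d - i) t) = elem_sym2 N d t"
    unfolding elem_sym2_def
    by (rule sum.reindex_bij_witness[where i = fst and j = "\<lambda>i. (i, d - i)"]) auto
  finally show ?thesis by (simp flip: mult.assoc power_mult_distrib)
qed

text \<open>The signs of \<open>h_tilde\<close> cancel those of \<open>elem_sym2\<close>, which
  leaves the coefficients of \<open>x * sq_poly\<close> weighted by \<open>a_coeff\<close>, that is,
  by 1 minus a moment of \<open>Q_k\<close>. The lower limit \<open>k\<close> of the sum is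
  harmless, since below it these weights are zero.\<close>

lemma h_tilde_eq:
  assumes "2 \<le> k" "k \<le> 2 * N + 1"
  shows "h_tilde (Suc N) k t =
    poly (sq_poly {1..N} t) 1 - pint ([:0, 1:] * sq_poly {1..N} t * assoc_legendre2 k)"
proof -
  let ?p = "sq_poly {1..N} t"
  let ?a = "\<lambda>j. if k \<le> j then a_coeff j k else 0"
  have p: "?p = (\<Sum>i\<le>2 * N. monom (coeff ?p i) i)"
    using poly_as_sum_of_monoms[of ?p] degree_sq_poly[of "{1..N}" t] by simp
  have "h_tilde (Suc N) k t = (\<Sum>j = k..2 * N + 1. ?a j * coeff ?p (j - 1))"
    unfolding h_tilde_def
  proof (rule sum.cong)
    fix j assume j: "j \<in> {k..2 * N + 1}"
    define i where "i = 2 * N + 1 - j"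
    have ij: "j = 2 * N + 1 - i" "i \<le> 2 * N" using j assms by (auto simp: i_def)
    \<comment> \<open>The exponents add up to an even number because
      \<open>i + j = 2 * N + 1\<close>.\<close>
    have "(-1) ^ (j + 1) * (-1) ^ i = ((-1) ^ (2 * N + 2) :: real)"
      unfolding power_add[symmetric] using j by (simp add: i_def)
    then have "(-1) ^ (j + 1) * (-1) ^ i = (1 :: real)" by simp
    moreover have "elem_sym2 N i t = (-1) ^ i * coeff ?p (j - 1)"
      using elem_sym2_eq_coeff[OF ij(2), of t] ij by simp
    moreover have "2 * Suc N - 1 - j = i" by (simp add: i_def)
    moreover have "(-1) ^ (j + 1) * a_coeff j k * ((-1) ^ i * c) = ((-1) ^ (j + 1) * (-1) ^ i) * (a_coeff j k * c)" for c
      by (simp only: mult_ac)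
    ultimately show "(-1) ^ (j + 1) * a_coeff j k * elem_sym2 (Suc N - 1) (2 * Suc N - 1 - j) t = ?a j * coeff ?p (j - 1)"
      using j by (simp only: diff_Suc_1) simp
  qed simp
  also have "\<dots> = (\<Sum>j = 1..2 * N + 1. ?a j * coeff ?p (j - 1))"
    using assms by (intro sum.mono_neutral_left) auto
  also have "\<dots> = (\<Sum>i\<le>2 * N. coeff ?p i * ?a (Suc i))"
    by (rule sum.reindex_bij_witness[where i = Suc and j = "\<lambda>j. j - 1"]) auto
  also have "\<dots> = (\<Sum>i\<le>2 * N. coeff ?p i - coeff ?p i * pint (monom 1 (Suc i) * assoc_legendre2 k))"
    using assms by (intro sum.cong) (auto simp: pint_monom_assoc_legendre2 right_diff_distrib)
  also have "\<dots> = (\<Sum>i\<le>2 * N. coeff ?p i) - pint ([:0, 1:] * ?p * assoc_legendre2 k)"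
  proof -
    have "[:0, 1:] * ?p * assoc_legendre2 k = (\<Sum>i\<le>2 * N. smult (coeff ?p i) (monom 1 (Suc i) * assoc_legendre2 k))"
    proof -
      have "[:0, 1:] * (\<Sum>i\<le>2 * N. monom (coeff ?p i) i) * assoc_legendre2 k =
          (\<Sum>i\<le>2 * N. smult (coeff ?p i) (monom 1 (Suc i) * assoc_legendre2 k))"
        unfolding mult_smult_left[symmetric] smult_monom sum_distrib_right sum_distrib_left
        by (simp add: monom_Suc)
      from trans[OF arg_cong[OF p, of "\<lambda>x. [:0, 1:] * x * assoc_legendre2 k"] this] show ?thesis .
    qed
    then show ?thesis by (simp add: sum_subtractf pint_sum pint_smult)
  qed
  also have "(\<Sum>i\<le>2 * N. coeff ?p i) = poly ?p 1"
    using degree_sq_poly[of "{1..N}" t] by (simp add: poly_altdef)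
  finally show ?thesis .
qed

lemma cube_int_h_tilde:
  assumes "2 \<le> k" "k \<le> 2 * N + 1"
  shows "cube_int {1..N} (\<lambda>t. h_tilde (Suc N) k t * qwt q {1..N} t) =
    poly (A_poly q N) 1 - pint (A_poly q N * assoc_legendre2 k)"
proof -
  let ?L = "\<lambda>p. poly p 1 - pint ([:0, 1:] * p * assoc_legendre2 k)"
  have "?L (mean_poly {1..N} (qwt q {1..N})) = cube_int {1..N} (\<lambda>t. ?L (sq_poly {1..N} t) * qwt q {1..N} t)"
  proof (rule mean_poly_functional)
    show "?L (p + r) = ?L p + ?L r" for p r
      unfolding distrib_left distrib_right poly_add pint_add by linarith
    show "?L (smult c p) = c * ?L p" for c p
      unfolding mult_smult_right mult_smult_left poly_smult pint_smult by (simp only: right_diff_distrib)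
  qed (auto intro: bdd_meas_qwt)
  then show ?thesis unfolding h_tilde_eq[OF assms] by (simp add: A_poly_def)
qed

interpretation lborels: product_sigma_finite "\<lambda>_::nat. lborel :: real measure" by unfold_locales

text \<open>Bridge from the product of restricted spaces to the set integral of the theorem: both
  sides are the product of one measure on the line, Lebesgue measure with the indicator of the unit
  interval as density.\<close>

lemma distr_cube: "distr (cube {1..N}) (Leb N) (\<lambda>t. t) = density (Leb N) (indicator (unit_cube N))"
proof -
  let ?I = "{1..N}"
  define \<mu> :: "real measure" where "\<mu> = density lborel (indicator {0..1})"
  have unif_m: "(\<lambda>x. x) \<in> unif \<rightarrow>\<^sub>M lborel"
    unfolding unif_def by (intro measurable_restrict_space1) simp
  have d: "distr unif lborel (\<lambda>x. x) = \<mu>"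
  proof (rule measure_eqI)
    fix A :: "real set" assume A: "A \<in> sets (distr unif lborel (\<lambda>x. x))"
    then have "emeasure (distr unif lborel (\<lambda>x. x)) A = emeasure unif (A \<inter> {0..1})"
      using unif_m by (subst emeasure_distr) auto
    also have "\<dots> = emeasure lborel (A \<inter> {0..1})"
      using A unfolding unif_def by (subst emeasure_restrict_space) auto
    also have "\<dots> = emeasure \<mu> A"
      using A unfolding \<mu>_def by (subst emeasure_density) (auto simp: nn_integral_indicator[symmetric] indicator_inter_arith mult.commute simp del: nn_integral_indicator)
    finally show "emeasure (distr unif lborel (\<lambda>x. x)) A = emeasure \<mu> A" .
  qed (simp add: \<mu>_def)
  have "prob_space \<mu>" unfolding d[symmetric] by (rule unif.prob_space_distr) (rule unif_m)
  then interpret \<mu>s: product_sigma_finite "\<lambda>_::nat. \<mu>"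
    by (intro product_sigma_finite.intro) (simp add: prob_space_imp_sigma_finite)
  have "distr (cube ?I) (Leb N) (compose ?I (\<lambda>x. x)) = Pi\<^sub>M ?I (\<lambda>_. \<mu>)"
  proof -
    have "distr (Pi\<^sub>M ?I (\<lambda>_. unif)) (Pi\<^sub>M ?I (\<lambda>_. \<mu>)) (compose ?I (\<lambda>x. x)) = Pi\<^sub>M ?I (\<lambda>_. distr unif \<mu> (\<lambda>x. x))"
      using unif_m \<open>prob_space \<mu>\<close> prob_space_unif
      by (intro distr_PiM_finite_prob_space') (auto simp: \<mu>_def cong: measurable_cong_sets)
    also have "distr unif \<mu> (\<lambda>x. x) = \<mu>" using d by (metis \<mu>_def distr_cong sets_density)
    also have "distr (Pi\<^sub>M ?I (\<lambda>_. unif)) (Pi\<^sub>M ?I (\<lambda>_. \<mu>)) (compose ?I (\<lambda>x. x)) =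
        distr (cube ?I) (Leb N) (compose ?I (\<lambda>x. x))"
      unfolding cube_def Leb_def by (intro distr_cong sets_PiM_cong) (auto simp: \<mu>_def)
    finally show ?thesis .
  qed
  moreover have "distr (cube ?I) (Leb N) (compose ?I (\<lambda>x. x)) = distr (cube ?I) (Leb N) (\<lambda>t. t)"
    by (intro distr_cong) (auto simp: space_cube compose_def fun_eq_iff PiE_iff extensional_def)
  moreover have "density (Leb N) (indicator (unit_cube N)) = Pi\<^sub>M ?I (\<lambda>_. \<mu>)"
  proof (rule \<mu>s.PiM_eqI)
    have sets: "sets (Leb N) = sets (Pi\<^sub>M ?I (\<lambda>_. \<mu>))"
      unfolding Leb_def by (intro sets_PiM_cong) (auto simp: \<mu>_def)
    then show "sets (density (Leb N) (indicator (unit_cube N))) = sets (Pi\<^sub>M ?I (\<lambda>_. \<mu>))" by simp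
    fix A assume "\<And>i. i \<in> ?I \<Longrightarrow> A i \<in> sets \<mu>"
    then have A: "\<And>i. i \<in> ?I \<Longrightarrow> A i \<in> sets lborel" by (simp add: \<mu>_def)
    have c: "unit_cube N \<in> sets (Leb N)"
      unfolding unit_cube_def Leb_def by (intro sets_PiM_I_finite) auto
    have AA: "Pi\<^sub>E ?I A \<in> sets (Leb N)" unfolding Leb_def using A by (intro sets_PiM_I_finite) auto
    have "emeasure (density (Leb N) (indicator (unit_cube N))) (Pi\<^sub>E ?I A) = emeasure (Leb N) (unit_cube N \<inter> Pi\<^sub>E ?I A)"
      using c AA by (subst emeasure_density) (auto simp: nn_integral_indicator[symmetric] indicator_inter_arith simp del: nn_integral_indicator)
    also have "unit_cube N \<inter> Pi\<^sub>E ?I A = Pi\<^sub>E ?I (\<lambda>i. {0..1} \<inter> A i)"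
      unfolding unit_cube_def PiE_Int ..
    also have "emeasure (Leb N) \<dots> = (\<Prod>i\<in>?I. emeasure lborel ({0..1} \<inter> A i))"
      unfolding Leb_def using A by (intro lborels.emeasure_PiM) auto
    also have "\<dots> = (\<Prod>i\<in>?I. emeasure \<mu> (A i))"
    proof (rule prod.cong)
      fix i assume "i \<in> ?I"
      then show "emeasure lborel ({0..1} \<inter> A i) = emeasure \<mu> (A i)"
        using A[of i] unfolding \<mu>_def by (subst emeasure_density) (auto simp: nn_integral_indicator[symmetric] indicator_inter_arith simp del: nn_integral_indicator)
    qed simp
    finally show "emeasure (density (Leb N) (indicator (unit_cube N))) (Pi\<^sub>E ?I A) = (\<Prod>i\<in>?I. emeasure \<mu> (A i))" .
  qed simp
  ultimately show ?thesis by simp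
qed

lemma set_integral_unit_cube:
  assumes g: "g \<in> borel_measurable (Leb N)"
  shows "(LINT t : unit_cube N | Leb N. g t) = cube_int {1..N} g"
proof -
  have c: "unit_cube N \<in> sets (Leb N)"
    unfolding unit_cube_def Leb_def by (intro sets_PiM_I_finite) auto
  have m: "(\<lambda>t. t) \<in> cube {1..N} \<rightarrow>\<^sub>M Leb N"
    unfolding cube_def Leb_def
  proof (rule measurable_PiM_single')
    fix i assume "i \<in> {1..N}"
    then show "(\<lambda>t. t i) \<in> Pi\<^sub>M {1..N} (\<lambda>_. unif) \<rightarrow>\<^sub>M lborel"
      by (intro measurable_compose[OF measurable_component_singleton[of i "{1..N}" "\<lambda>_. unif"]])
        (auto simp: unif_def intro: measurable_restrict_space1)
  qed (auto simp: space_PiM PiE_iff)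
  have "(LINT t : unit_cube N | Leb N. g t) = (\<integral>t. g t \<partial>density (Leb N) (indicator (unit_cube N)))"
    unfolding set_lebesgue_integral_def using g c
    by (subst integral_density[where g = "indicator (unit_cube N)", symmetric]) (auto simp: ennreal_indicator)
  also have "\<dots> = cube_int {1..N} g"
    unfolding distr_cube[symmetric] cube_int_def by (rule integral_distr) (use m g in auto)
  finally show ?thesis .
qed

lemma lint_eq_selberg_int:
  assumes "2 \<le> j" "j \<le> 2 * N + 1" "2 \<le> k" "k \<le> 2 * N + 1" "even (j + k)"
  shows "(LINT t : unit_cube N | Leb N.
            h_tilde (Suc N) k t * SigmaQ N j t * (\<Prod>i = 1..N. (t i)\<^sup>2) * vandermonde N t ^ 4) =
    selberg_int N / 4 * pint (assoc_legendre2 j * assoc_legendre2 k)"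
proof -
  have eq: "h_tilde (Suc N) k t * SigmaQ N j t * (\<Prod>i = 1..N. (t i)\<^sup>2) * vandermonde N t ^ 4 =
      h_tilde (Suc N) k t * qwt (assoc_legendre2 j) {1..N} t" for t
    by (simp add: qwt_def wt_def vandermonde_power4 SigmaQ_def mult_ac)
  have coord: "(\<lambda>t. t i) \<in> borel_measurable (Leb N)" if "i \<in> {1..N}" for i
    using measurable_component_singleton[OF that, of "\<lambda>_. lborel"] by (simp add: Leb_def)
  have e: "(\<lambda>t. elem_sym N d t) \<in> borel_measurable (Leb N)" for d
    unfolding elem_sym_def by (intro borel_measurable_sum borel_measurable_prod coord) auto
  have "(\<lambda>t. h_tilde (Suc N) k t) \<in> borel_measurable (Leb N)"
    unfolding h_tilde_def elem_sym2_def case_prod_unfold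
    by (intro borel_measurable_sum borel_measurable_times borel_measurable_const) (simp_all add: e)
  moreover have "(\<lambda>t. qwt (assoc_legendre2 j) {1..N} t) \<in> borel_measurable (Leb N)"
    unfolding qwt_def wt_def vdm4_def
    by (intro borel_measurable_sum borel_measurable_prod borel_measurable_times borel_measurable_power
      borel_measurable_diff measurable_compose[OF coord borel_measurable_poly] coord) auto
  ultimately show ?thesis
    unfolding eq
    by (subst set_integral_unit_cube)
      (auto simp only: cube_int_h_tilde[OF assms(3,4)] pint_A_poly_assoc_legendre2[OF assms(1-3,5)]
        intro: borel_measurable_times)
qed

section \<open>Canonical moments\<close>

text \<open>The Riesz functional of the sequence: \<open>x^i\<close> is sent to \<open>z i\<close>,
  so for a moment sequence it is integration of \<open>p\<close>.\<close>

definition mfun :: "(nat \<Rightarrow> real) \<Rightarrow> real poly \<Rightarrow> real" where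
  "mfun z p = (\<Sum>i\<le>degree p. coeff p i * z i)"

lemma mfun_eq: "degree p \<le> n \<Longrightarrow> mfun z p = (\<Sum>i\<le>n. coeff p i * z i)"
  unfolding mfun_def by (intro sum.mono_neutral_left) (auto simp: coeff_eq_0)

lemma mfun_0 [simp]: "mfun z 0 = 0"
  by (simp add: mfun_def)

lemma mfun_add: "mfun z (p + q) = mfun z p + mfun z q"
proof -
  let ?n = "max (degree p) (degree q)"
  have "degree (p + q) \<le> ?n" by (rule degree_add_le) auto
  then show ?thesis
    using mfun_eq[of "p + q" ?n z] mfun_eq[of p ?n z] mfun_eq[of q ?n z] by (simp add: algebra_simps sum.distrib)
qed

lemma mfun_smult: "mfun z (smult c p) = c * mfun z p"
  using mfun_eq[of "smult c p" "degree p" z] by (simp add: mfun_def sum_distrib_left mult_ac)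

lemma mfun_diff: "mfun z (p - q) = mfun z p - mfun z q"
  using mfun_add[of z "p - q" q] by simp

lemma mfun_sum: "mfun z (\<Sum>i\<in>A. f i) = (\<Sum>i\<in>A. mfun z (f i))"
  by (induction A rule: infinite_finite_induct) (simp_all add: mfun_add)

lemma mfun_const: "mfun z [:c:] = c * z 0"
  by (simp add: mfun_def)

definition seq_shift :: "(nat \<Rightarrow> real) \<Rightarrow> nat \<Rightarrow> real" where
  "seq_shift z k = z (Suc k)"

definition ndiff :: "(nat \<Rightarrow> real) \<Rightarrow> nat \<Rightarrow> real" where
  "ndiff z k = z k - z (Suc k)"

lemma mfun_X: "mfun z ([:0, 1:] * p) = mfun (seq_shift z) p"
proof -
  have "mfun z (pCons 0 p) = (\<Sum>i\<le>Suc (degree p). coeff (pCons 0 p) i * z i)"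
    by (rule mfun_eq) (simp add: degree_pCons_le)
  also have "\<dots> = (\<Sum>i\<le>degree p. coeff p i * z (Suc i))"
    by (subst sum.atMost_Suc_shift) simp
  finally show ?thesis by (simp add: mfun_def seq_shift_def)
qed

lemma mfun_1X: "mfun z ([:1, -1:] * p) = mfun (ndiff z) p"
proof -
  have "[:1, -1:] * p = p - [:0, 1:] * p" by simp
  then have "mfun z ([:1, -1:] * p) = mfun z p - mfun (seq_shift z) p" by (simp only: mfun_diff mfun_X)
  then show ?thesis by (simp add: mfun_def ndiff_def seq_shift_def algebra_simps sum_subtractf)
qed

lemma mfun_pCons: "mfun z (pCons c p) = c * z 0 + mfun (seq_shift z) p"
proof -
  have "pCons c p = [:c:] + [:0, 1:] * p" by simp
  then show ?thesis by (simp only: mfun_add mfun_X mfun_const)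
qed

lemma shift_ndiff: "seq_shift (ndiff z) = ndiff (seq_shift z)"
  by (simp add: seq_shift_def ndiff_def fun_eq_iff)

definition pos_seq :: "(nat \<Rightarrow> real) \<Rightarrow> bool" where
  "pos_seq z \<longleftrightarrow> (\<forall>p. 0 \<le> mfun z (p * p))"

lemma pos_seq_0: "pos_seq z \<Longrightarrow> 0 \<le> z 0"
  using mfun_const[of z 1] by (metis mult_1 pos_seq_def one_pCons mult.left_neutral)

lemma pos_seq_shift2: "pos_seq z \<Longrightarrow> pos_seq (seq_shift (seq_shift z))"
  unfolding pos_seq_def
proof
  fix p assume "\<forall>p. 0 \<le> mfun z (p * p)"
  then have "0 \<le> mfun z (([:0, 1:] * p) * ([:0, 1:] * p))" by blast
  also have "([:0, 1:] * p) * ([:0, 1:] * p) = [:0, 1:] * ([:0, 1:] * (p * p))" by (simp only: mult_ac)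
  finally show "0 \<le> mfun (seq_shift (seq_shift z)) (p * p)" by (simp only: mfun_X)
qed

lemma pos_seq_ndiff2: "pos_seq z \<Longrightarrow> pos_seq (ndiff (ndiff z))"
  unfolding pos_seq_def
proof
  fix p assume "\<forall>p. 0 \<le> mfun z (p * p)"
  then have "0 \<le> mfun z (([:1, -1:] * p) * ([:1, -1:] * p))" by blast
  also have "([:1, -1:] * p) * ([:1, -1:] * p) = [:1, -1:] * ([:1, -1:] * (p * p))" by (simp only: mult_ac)
  finally show "0 \<le> mfun (ndiff (ndiff z)) (p * p)" by (simp only: mfun_1X)
qed

text \<open>\<open>seq_shift\<close> and \<open>ndiff\<close> are multiplication by \<open>t\<close> and \<open>1 - t\<close>, so this is positivity of the moment
  functional on all \<open>p\<^sup>2\<close>, \<open>t p\<^sup>2\<close>, \<open>(1 - t) p\<^sup>2\<close> and \<open>t (1 - t) p\<^sup>2\<close>.\<close>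

definition hausdorff_pos :: "(nat \<Rightarrow> real) \<Rightarrow> bool" where
  "hausdorff_pos z \<longleftrightarrow> pos_seq z \<and> pos_seq (seq_shift z) \<and> pos_seq (ndiff z) \<and> pos_seq (seq_shift (ndiff z))"

text \<open>Multiplication by \<open>t\<close> permutes the four multipliers 1, \<open>t\<close>,
  \<open>1 - t\<close>, \<open>t (1 - t)\<close> up to a factor \<open>t^2\<close>, which the square
  absorbs.\<close>

lemma hausdorff_pos_shift: "hausdorff_pos z \<Longrightarrow> hausdorff_pos (seq_shift z)"
  unfolding hausdorff_pos_def by (metis pos_seq_shift2 shift_ndiff)

lemma hausdorff_pos_ndiff: "hausdorff_pos z \<Longrightarrow> hausdorff_pos (ndiff z)"
  unfolding hausdorff_pos_def by (metis pos_seq_ndiff2 shift_ndiff)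

text \<open>Each factor is traded for a shift or a difference of the sequence, under which the
  hypothesis is stable; in the end only an initial entry is left.\<close>

lemma hausdorff_pos_bernstein:
  assumes "hausdorff_pos z"
  shows "0 \<le> mfun z ([:0, 1:] ^ i * [:1, -1:] ^ j)"
  using assms
proof (induction i arbitrary: z)
  case 0
  then show ?case
  proof (induction j arbitrary: z)
    case 0
    then show ?case using mfun_const[of z 1] by (simp add: hausdorff_pos_def pos_seq_0 one_pCons)
  next
    case (Suc j)
    have "mfun z ([:0, 1:] ^ 0 * [:1, -1:] ^ Suc j) = mfun (ndiff z) ([:0, 1:] ^ 0 * [:1, -1:] ^ j)"
      using mfun_1X[of z "[:1, -1:] ^ j"] by simp
    then show ?case using Suc.IH[OF hausdorff_pos_ndiff[OF Suc.prems]] by simp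
  qed
next
  case (Suc i)
  have "mfun z ([:0, 1:] ^ Suc i * [:1, -1:] ^ j) = mfun (seq_shift z) ([:0, 1:] ^ i * [:1, -1:] ^ j)"
    using mfun_X[of z "[:0, 1:] ^ i * [:1, -1:] ^ j"] by (simp add: mult.assoc)
  then show ?case using Suc.IH[OF hausdorff_pos_shift[OF Suc.prems]] by simp
qed

text \<open>Every entry is the initial entry of an iterated shift; the differences are entries of
  \<open>ndiff z\<close> and \<open>ndiff (ndiff z)\<close>.\<close>

lemma hausdorff_pos_antimono:
  assumes "hausdorff_pos z"
  shows "0 \<le> z k" "z (Suc k) \<le> z k" "z (Suc k) - z (Suc (Suc k)) \<le> z k - z (Suc k)"
proof -
  have *: "hausdorff_pos z \<Longrightarrow> 0 \<le> z k" for z k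
  proof (induction k arbitrary: z)
    case 0 then show ?case by (simp add: hausdorff_pos_def pos_seq_0)
  next
    case (Suc k) then show ?case using Suc.IH[OF hausdorff_pos_shift] by (simp add: seq_shift_def)
  qed
  show "0 \<le> z k" by (rule *) fact
  show "z (Suc k) \<le> z k" using *[OF hausdorff_pos_ndiff[OF assms], of k] by (simp add: ndiff_def)
  show "z (Suc k) - z (Suc (Suc k)) \<le> z k - z (Suc k)"
    using *[OF hausdorff_pos_ndiff[OF hausdorff_pos_ndiff[OF assms]], of k] by (simp add: ndiff_def)
qed

text \<open>Schur complement of the corner entry of the Hankel form: write the argument as a
  constant plus a multiple of \<open>x\<close> and complete the square in the constant.\<close>

lemma pos_seq_schur:
  assumes "z 0 > 0"
  shows "pos_seq z \<longleftrightarrow> (\<forall>p. (mfun (seq_shift z) p)\<^sup>2 / z 0 \<le> mfun (seq_shift (seq_shift z)) (p * p))"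
proof -
  have split: "mfun z (([:c:] + [:0, 1:] * p) * ([:c:] + [:0, 1:] * p)) =
      c\<^sup>2 * z 0 + 2 * c * mfun (seq_shift z) p + mfun (seq_shift (seq_shift z)) (p * p)" for c p
  proof -
    have "([:c:] + [:0, 1:] * p) * ([:c:] + [:0, 1:] * p) =
       [:c\<^sup>2:] + smult (2 * c) ([:0, 1:] * p) + [:0, 1:] * ([:0, 1:] * (p * p))"
      by (simp add: poly_eq_poly_eq_iff[symmetric] fun_eq_iff power2_eq_square algebra_simps)
    then show ?thesis by (simp only: mfun_add mfun_smult mfun_X mfun_const)
  qed
  have sq: "c\<^sup>2 * z 0 + 2 * c * s + t = z 0 * (c + s / z 0)\<^sup>2 + (t - s\<^sup>2 / z 0)" for c s t
    using assms by (simp add: field_simps power2_eq_square)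
  show ?thesis
  proof
    assume pos: "pos_seq z"
    show "\<forall>p. (mfun (seq_shift z) p)\<^sup>2 / z 0 \<le> mfun (seq_shift (seq_shift z)) (p * p)"
    proof
      fix p
      let ?s = "mfun (seq_shift z) p"
      have "0 \<le> z 0 * (- (?s / z 0) + ?s / z 0)\<^sup>2 + (mfun (seq_shift (seq_shift z)) (p * p) - ?s\<^sup>2 / z 0)"
        unfolding sq[symmetric] split[symmetric] using pos unfolding pos_seq_def by blast
      then show "?s\<^sup>2 / z 0 \<le> mfun (seq_shift (seq_shift z)) (p * p)" by simp
    qed
  next
    assume *: "\<forall>p. (mfun (seq_shift z) p)\<^sup>2 / z 0 \<le> mfun (seq_shift (seq_shift z)) (p * p)"
    show "pos_seq z" unfolding pos_seq_def
    proof
      fix p :: "real poly"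
      obtain c d where p: "p = [:c:] + [:0, 1:] * d" by (cases p) auto
      show "0 \<le> mfun z (p * p)" unfolding p split sq using * assms by (intro add_nonneg_nonneg) auto
    qed
  qed
qed

text \<open>\<open>y\<close> and \<open>v\<close> are the moments of two measures whose canonical moments are \<open>p, p\<^sub>2, p\<^sub>3, \<dots>\<close>
  and \<open>p\<^sub>2, p\<^sub>3, \<dots>\<close>: the generating function of \<open>v\<close> is the quotient of those of the normalised
  moments of \<open>t d\<mu>\<close> and of \<open>(1 - t) d\<mu>\<close>, where \<open>y\<close> are the moments of \<open>\<mu>\<close>.\<close>

locale canonical_step =
  fixes y v :: "nat \<Rightarrow> real"
  assumes y0: "y 0 = 1" and v0: "v 0 = 1" and y1: "0 < y 1" "y 1 < 1"
    and conv: "\<And>k. (1 - y 1) * y (Suc k) = y 1 * (\<Sum>i\<le>k. v i * ndiff y (k - i))"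
begin

text \<open>If \<open>y\<close> are the moments of \<open>\<mu>\<close>, then
  \<open>\<Phi> p\<close> at \<open>x\<close> is the integral of
  \<open>(x p(x) - t p(t)) / (x - t)\<close> against \<open>(1 - t) d\<mu>(t)\<close>, a polynomial
  of the second kind.\<close>

definition \<Phi> :: "real poly \<Rightarrow> real poly" where
  "\<Phi> p = (\<Sum>i\<le>degree p. smult (coeff p i) (\<Sum>a\<le>i. monom (ndiff y (i - a)) a))"

abbreviation "q \<equiv> 1 - y 1"
abbreviation "s \<equiv> mfun (seq_shift y)"
abbreviation "b \<equiv> mfun (seq_shift (ndiff y))"

lemma b_eq: "b p = s p - s ([:0, 1:] * p)"
  by (simp only: mfun_X) (simp add: mfun_def ndiff_def seq_shift_def algebra_simps sum_subtractf)

lemma \<Phi>_pCons: "\<Phi> (pCons c p) = [:c * q + b p:] + [:0, 1:] * \<Phi> p"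
proof (cases "p = 0")
  case True
  then show ?thesis by (simp add: \<Phi>_def ndiff_def y0 mfun_def monom_0)
next
  case False
  let ?M = "\<lambda>i. \<Sum>a\<le>i. monom (ndiff y (i - a)) a"
  have M: "?M (Suc i) = [:ndiff y (Suc i):] + [:0, 1:] * ?M i" for i
    by (subst sum.atMost_Suc_shift) (simp add: monom_0 monom_Suc sum_distrib_left del: mult_pCons_left, simp)
  have "\<Phi> (pCons c p) = (\<Sum>i\<le>Suc (degree p). smult (coeff (pCons c p) i) (?M i))"
    using False by (simp add: \<Phi>_def)
  also have "\<dots> = smult c (?M 0) + (\<Sum>i\<le>degree p. smult (coeff p i) (?M (Suc i)))"
    by (subst sum.atMost_Suc_shift) simp
  also have "smult c (?M 0) = [:c * q:]" by (simp add: monom_0 ndiff_def y0)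
  also have "(\<Sum>i\<le>degree p. smult (coeff p i) (?M (Suc i))) = [:b p:] + [:0, 1:] * \<Phi> p"
  proof -
    have "(\<Sum>i\<le>degree p. smult (coeff p i) [:ndiff y (Suc i):]) = [:b p:]"
    proof -
      have "(\<Sum>i\<in>A. [:f i:]) = [:\<Sum>i\<in>A. f i:]" for A :: "nat set" and f :: "nat \<Rightarrow> real"
        by (induction A rule: infinite_finite_induct) simp_all
      then show ?thesis by (simp add: mfun_def seq_shift_def)
    qed
    moreover have "(\<Sum>i\<le>degree p. smult (coeff p i) ([:0, 1:] * ?M i)) = [:0, 1:] * \<Phi> p"
      unfolding \<Phi>_def sum_distrib_left by (simp only: mult_smult_right sum_distrib_left)
    ultimately show ?thesis unfolding M smult_add_right sum.distrib by (simp only:)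
  qed
  finally show ?thesis by simp
qed

lemma \<Phi>_0 [simp]: "\<Phi> 0 = 0"
  by (simp add: \<Phi>_def)

lemma \<Phi>_X: "\<Phi> ([:0, 1:] * p) = [:b p:] + [:0, 1:] * \<Phi> p"
  using \<Phi>_pCons[of 0 p] by simp

text \<open>\<open>\<Phi>\<close> is triangular with diagonal entry \<open>q\<close>, which is
  nonzero. Hence positivity of \<open>v\<close> need only be tested on images of
  \<open>\<Phi>\<close>.\<close>

lemma \<Phi>_surj: "\<exists>p. \<Phi> p = r"
proof (induction r rule: pCons_induct)
  case (pCons c r)
  then obtain p where "\<Phi> p = r" by blast
  then have "\<Phi> (pCons ((c - b p) / q) p) = pCons c r"
    using y1 by (simp add: \<Phi>_pCons)
  then show ?case by blast
qed (use \<Phi>_0 in blast)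

text \<open>By linearity this reduces to monomials, where it is the relation
  \<open>conv\<close>.\<close>

lemma mfun_\<Phi>: "y 1 * mfun v (\<Phi> p) = q * s p"
proof -
  have "y 1 * mfun v (\<Sum>a\<le>i. monom (ndiff y (i - a)) a) = q * y (Suc i)" for i
  proof -
    have "mfun v (monom c a) = c * v a" for c a
      using mfun_eq[of "monom c a" a v] by (simp add: degree_monom_le if_distrib[where f = "\<lambda>x. x * _"] cong: if_cong)
    then show ?thesis unfolding conv mfun_sum by (simp add: mult.commute)
  qed
  then have "y 1 * mfun v (smult c (\<Sum>a\<le>i. monom (ndiff y (i - a)) a)) = q * (c * y (Suc i))" for c i
    by (simp only: mfun_smult mult.left_commute[of "y 1"]) (simp only: mult_ac)
  then show ?thesis
    unfolding \<Phi>_def mfun_sum sum_distrib_left by (simp add: mfun_def seq_shift_def sum_distrib_left)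
qed

lemma mfun_X\<Phi>\<Phi>': "mfun v ([:0, 1:] * (\<Phi> f * \<Phi> g)) = mfun v (\<Phi> f * \<Phi> ([:0, 1:] * g)) - b g * mfun v (\<Phi> f)"
proof -
  have "\<Phi> f * \<Phi> ([:0, 1:] * g) = smult (b g) (\<Phi> f) + [:0, 1:] * (\<Phi> f * \<Phi> g)"
    unfolding \<Phi>_X by (simp add: algebra_simps)
  then show ?thesis by (simp only: mfun_add mfun_smult)
qed

text \<open>Induction on \<open>f\<close>: split off the constant coefficient and move the factor
  \<open>x\<close> from \<open>f\<close> to \<open>g\<close> by \<open>mfun_X\<Phi>\<Phi>'\<close>,
  which is why \<open>g\<close> is arbitrary. The right-hand side has the shape of a
  covariance.\<close>

lemma mfun_\<Phi>\<Phi>: "y 1 * mfun v (\<Phi> f * \<Phi> g) = q * (s (f * g) - s f * s g)"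
proof (induction f arbitrary: g rule: pCons_induct)
  case (pCons c d)
  have 1: "\<Phi> (pCons c d) * \<Phi> g = smult (c * q + b d) (\<Phi> g) + [:0, 1:] * (\<Phi> d * \<Phi> g)"
    unfolding \<Phi>_pCons by (simp add: algebra_simps)
  have "y 1 * mfun v (\<Phi> (pCons c d) * \<Phi> g) = (c * q + b d) * (y 1 * mfun v (\<Phi> g)) +
      (y 1 * mfun v (\<Phi> d * \<Phi> ([:0, 1:] * g)) - b g * (y 1 * mfun v (\<Phi> d)))"
    unfolding 1 mfun_add mfun_smult mfun_X\<Phi>\<Phi>' by (simp only: algebra_simps)
  also have "\<dots> = (c * q + b d) * (q * s g) +
      (q * (s (d * ([:0, 1:] * g)) - s d * s ([:0, 1:] * g)) - b g * (q * s d))"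
    unfolding mfun_\<Phi> pCons.IH ..
  also have "s (pCons c d * g) = c * s g + s (d * ([:0, 1:] * g))"
  proof -
    have "pCons c d * g = smult c g + d * ([:0, 1:] * g)" by simp
    then show ?thesis by (simp only: mfun_add mfun_smult)
  qed
  moreover have "s (pCons c d) = c * y 1 + s ([:0, 1:] * d)"
    unfolding mfun_pCons mfun_X by (simp add: seq_shift_def)
  ultimately show ?case
    unfolding b_eq by (simp only: algebra_simps)
qed simp

text \<open>This and the next two identities carry the multipliers \<open>x\<close>,
  \<open>1 - x\<close> and \<open>x (1 - x)\<close> from \<open>v\<close> over to \<open>y\<close>.
  The subtracted squares are the Schur terms of \<open>pos_seq_schur\<close>.\<close>

lemma mfun_X\<Phi>\<Phi>: "y 1 * mfun v ([:0, 1:] * (\<Phi> f * \<Phi> g)) = q * (s ([:0, 1:] * (f * g)) - s f * s g)"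
proof -
  have "f * ([:0, 1:] * g) = [:0, 1:] * (f * g)" by (simp only: mult_ac)
  moreover have "y 1 * mfun v ([:0, 1:] * (\<Phi> f * \<Phi> g)) =
      y 1 * mfun v (\<Phi> f * \<Phi> ([:0, 1:] * g)) - b g * (y 1 * mfun v (\<Phi> f))"
    unfolding mfun_X\<Phi>\<Phi>' by (simp only: algebra_simps)
  ultimately show ?thesis unfolding mfun_\<Phi> mfun_\<Phi>\<Phi> b_eq by (simp only: algebra_simps)
qed

lemma mfun_1X\<Phi>\<Phi>: "y 1 * mfun v ([:1, -1:] * (\<Phi> f * \<Phi> g)) = q * s ([:1, -1:] * (f * g))"
proof -
  have 1: "[:1, -1:] * p = p - [:0, 1:] * p" for p :: "real poly" by simp
  have "y 1 * mfun v ([:1, -1:] * (\<Phi> f * \<Phi> g)) = y 1 * mfun v (\<Phi> f * \<Phi> g) - y 1 * mfun v ([:0, 1:] * (\<Phi> f * \<Phi> g))"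
    unfolding 1 mfun_diff by (simp only: right_diff_distrib)
  then show ?thesis unfolding mfun_\<Phi>\<Phi> mfun_X\<Phi>\<Phi> 1 mfun_diff by (simp only: algebra_simps)
qed

lemma mfun_X1X\<Phi>\<Phi>: "y 1 * mfun v ([:0, 1:] * ([:1, -1:] * (\<Phi> f * \<Phi> f))) = q * s ([:0, 1:] * ([:1, -1:] * (f * f))) - (b f)\<^sup>2"
proof -
  have 1: "[:1, -1:] * (\<Phi> f * \<Phi> f) = \<Phi> f * \<Phi> f - \<Phi> f * \<Phi> ([:0, 1:] * f) + smult (b f) (\<Phi> f)"
    unfolding \<Phi>_X by (simp add: algebra_simps)
  have 2: "y 1 * mfun v ([:0, 1:] * \<Phi> f) = q * s ([:0, 1:] * f) - y 1 * b f"
  proof -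
    have "[:0, 1:] * \<Phi> f = \<Phi> ([:0, 1:] * f) - [:b f:]" unfolding \<Phi>_X by simp
    then have "y 1 * mfun v ([:0, 1:] * \<Phi> f) = y 1 * mfun v (\<Phi> ([:0, 1:] * f)) - y 1 * b f"
      by (simp only: mfun_diff mfun_const v0) (simp only: algebra_simps)
    then show ?thesis unfolding mfun_\<Phi> .
  qed
  have "y 1 * mfun v ([:0, 1:] * ([:1, -1:] * (\<Phi> f * \<Phi> f))) =
      y 1 * mfun v ([:0, 1:] * (\<Phi> f * \<Phi> f)) - y 1 * mfun v ([:0, 1:] * (\<Phi> f * \<Phi> ([:0, 1:] * f))) +
      b f * (y 1 * mfun v ([:0, 1:] * \<Phi> f))"
    unfolding 1 distrib_left right_diff_distrib mult_smult_right mfun_add mfun_diff mfun_smult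
    by (simp only: algebra_simps)
  also have "\<dots> = q * (s ([:0, 1:] * (f * f)) - s ([:0, 1:] * (f * ([:0, 1:] * f)))) - q * (s f * b f) +
      b f * (q * s ([:0, 1:] * f) - y 1 * b f)"
    unfolding mfun_X\<Phi>\<Phi> 2 b_eq[of f] by (simp only: algebra_simps)
  also have "s ([:0, 1:] * (f * f)) - s ([:0, 1:] * (f * ([:0, 1:] * f))) = s ([:0, 1:] * ([:1, -1:] * (f * f)))"
  proof -
    have "[:0, 1:] * ([:1, -1:] * (f * f)) = [:0, 1:] * (f * f) - [:0, 1:] * (f * ([:0, 1:] * f))"
      by (simp add: algebra_simps)
    then show ?thesis by (simp only: mfun_diff)
  qed
  also have "s ([:0, 1:] * f) = s f - b f" by (simp add: b_eq)
  finally show ?thesis by (simp only: algebra_simps power2_eq_square)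
qed

lemma pos_seq_v: "pos_seq (seq_shift v) \<longleftrightarrow> pos_seq y"
proof -
  have "pos_seq (seq_shift v) \<longleftrightarrow> (\<forall>f. 0 \<le> y 1 * mfun v ([:0, 1:] * (\<Phi> f * \<Phi> f)))"
    unfolding pos_seq_def mfun_X using \<Phi>_surj y1 by (metis zero_le_mult_iff order.strict_implies_order linorder_not_le)
  also have "\<dots> \<longleftrightarrow> (\<forall>f. (s f)\<^sup>2 \<le> s ([:0, 1:] * (f * f)))"
    unfolding mfun_X\<Phi>\<Phi> using y1 by (simp add: zero_le_mult_iff power2_eq_square)
  also have "\<dots> \<longleftrightarrow> pos_seq y"
    using pos_seq_schur[of y] unfolding mfun_X by (simp add: y0)
  finally show ?thesis .
qed

lemma pos_seq_ndiff_v: "pos_seq (ndiff v) \<longleftrightarrow> pos_seq (seq_shift (ndiff y))"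
proof -
  have "pos_seq (ndiff v) \<longleftrightarrow> (\<forall>f. 0 \<le> y 1 * mfun v ([:1, -1:] * (\<Phi> f * \<Phi> f)))"
    unfolding pos_seq_def mfun_1X using \<Phi>_surj y1 by (metis zero_le_mult_iff order.strict_implies_order linorder_not_le)
  also have "\<dots> \<longleftrightarrow> (\<forall>f. 0 \<le> s ([:1, -1:] * (f * f)))"
    unfolding mfun_1X\<Phi>\<Phi> using y1 by (simp add: zero_le_mult_iff)
  finally show ?thesis unfolding mfun_1X pos_seq_def shift_ndiff .
qed

lemma pos_seq_shift_ndiff_v: "pos_seq (seq_shift (ndiff v)) \<longleftrightarrow> pos_seq (ndiff y)"
proof -
  have "pos_seq (seq_shift (ndiff v)) \<longleftrightarrow> (\<forall>f. 0 \<le> y 1 * mfun v ([:0, 1:] * ([:1, -1:] * (\<Phi> f * \<Phi> f))))"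
    unfolding pos_seq_def mfun_X mfun_1X shift_ndiff using \<Phi>_surj y1
    by (metis zero_le_mult_iff order.strict_implies_order linorder_not_le)
  also have "\<dots> \<longleftrightarrow> (\<forall>f. (b f)\<^sup>2 / q \<le> s ([:0, 1:] * ([:1, -1:] * (f * f))))"
    unfolding mfun_X1X\<Phi>\<Phi> using y1 by (simp add: field_simps)
  also have "\<dots> \<longleftrightarrow> pos_seq (ndiff y)"
    using pos_seq_schur[of "ndiff y"] y1 unfolding mfun_X mfun_1X shift_ndiff by (simp add: y0 ndiff_def)
  finally show ?thesis .
qed

text \<open>Three of the four conditions correspond by the preceding lemmas. What remains is
  positivity of \<open>v\<close> against that of \<open>seq_shift y\<close>: one direction drops the
  square in \<open>mfun_\<Phi>\<Phi>\<close>, the other is the Cauchy-Schwarz inequality.\<close>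

lemma hausdorff_pos_iff: "hausdorff_pos v \<longleftrightarrow> hausdorff_pos y"
proof
  assume v: "hausdorff_pos v"
  have "0 \<le> s (f * f)" for f
  proof -
    have "0 \<le> y 1 * mfun v (\<Phi> f * \<Phi> f)" using v y1 by (simp add: hausdorff_pos_def pos_seq_def)
    then have "s f * s f \<le> s (f * f)" unfolding mfun_\<Phi>\<Phi> using y1 by (simp add: zero_le_mult_iff)
    then show ?thesis using zero_le_square[of "s f"] by linarith
  qed
  then show "hausdorff_pos y"
    using v pos_seq_v pos_seq_ndiff_v pos_seq_shift_ndiff_v by (simp add: hausdorff_pos_def pos_seq_def)
next
  assume y: "hausdorff_pos y"
  have "0 \<le> mfun v (\<Phi> f * \<Phi> f)" for f
  proof -
    \<comment> \<open>Subtracting the mean of \<open>f\<close> with respect to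
      \<open>t d\<mu>\<close>, whose mass is \<open>y 1\<close>, gives the Cauchy-Schwarz
      inequality; \<open>y 1 < 1\<close> then removes the denominator.\<close>
    have "0 \<le> s ((f - [:s f / y 1:]) * (f - [:s f / y 1:]))"
      using y by (simp add: hausdorff_pos_def pos_seq_def)
    also have "(f - [:s f / y 1:]) * (f - [:s f / y 1:]) = f * f - smult (2 * (s f / y 1)) f + [:(s f / y 1)\<^sup>2:]"
      by (simp add: poly_eq_poly_eq_iff[symmetric] fun_eq_iff power2_eq_square algebra_simps)
    also have "s \<dots> = s (f * f) - (s f)\<^sup>2 / y 1"
      unfolding mfun_add mfun_diff mfun_smult mfun_const using y1 by (simp add: seq_shift_def field_simps power2_eq_square)
    finally have "(s f)\<^sup>2 / y 1 \<le> s (f * f)" by simp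
    moreover have "(s f)\<^sup>2 \<le> (s f)\<^sup>2 / y 1" using y1 by (simp add: field_simps mult_left_le_one_le)
    ultimately have "0 \<le> y 1 * mfun v (\<Phi> f * \<Phi> f)"
      unfolding mfun_\<Phi>\<Phi> using y1 by (simp add: power2_eq_square)
    then show ?thesis using y1 by (simp add: zero_le_mult_iff)
  qed
  then have "pos_seq v" unfolding pos_seq_def using \<Phi>_surj by metis
  then show "hausdorff_pos v"
    using y pos_seq_v pos_seq_ndiff_v pos_seq_shift_ndiff_v by (simp add: hausdorff_pos_def)
qed

end

section \<open>Solution of the Hausdorff moment problem\<close>

lemma bernstein_factorial_moment:
  "(\<Sum>i\<le>N. smult (real (N choose i) * real (i choose k)) ([:0, 1:] ^ i * [:1, -1:] ^ (N - i))) =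
    smult (real (N choose k)) (monom (1::real) k)"
proof (cases "k \<le> N")
  case False
  then have "smult (real (N choose i) * real (i choose k)) ([:0, 1:] ^ i * [:1, -1:] ^ (N - i)) = (0 :: real poly)"
    if "i \<in> {..N}" for i using that by simp
  then have "(\<Sum>i\<le>N. smult (real (N choose i) * real (i choose k)) ([:0, 1:] ^ i * [:1, -1:] ^ (N - i))) = (0 :: real poly)"
    by (rule sum.neutral[OF ballI])
  moreover have "N choose k = 0" using False by simp
  ultimately show ?thesis by (simp only: of_nat_0 smult_0_left)
next
  case True
  have one: "[:0, 1:] + [:1, -1:] = (1 :: real poly)" by (simp add: one_pCons)
  have "(\<Sum>i\<le>N. smult (real (N choose i) * real (i choose k)) ([:0, 1:] ^ i * [:1, -1:] ^ (N - i))) =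
      (\<Sum>i\<in>{k..N}. smult (real (N choose i) * real (i choose k)) ([:0, 1:] ^ i * [:1, -1:] ^ (N - i)))"
    by (intro sum.mono_neutral_right) (auto simp: binomial_eq_0)
  also have "\<dots> = (\<Sum>j\<le>N - k. smult (real (N choose k))
      ([:0, 1:] ^ k * (of_nat ((N - k) choose j) * [:0, 1:] ^ j * [:1, -1:] ^ (N - k - j))))"
  proof (rule sum.reindex_bij_witness[where i = "\<lambda>j. j + k" and j = "\<lambda>i. i - k"])
    fix i assume i: "i \<in> {k..N}"
    \<comment> \<open>This identity reduces the \<open>k\<close>-th factorial moment of a binomial
      distribution to the binomial theorem with exponent \<open>N - k\<close>.\<close>
    have "(N choose i) * (i choose k) = (N choose k) * ((N - k) choose (i - k))"
      using i by (intro choose_mult) auto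
    then have c: "real (N choose i) * real (i choose k) = real (N choose k) * real ((N - k) choose (i - k))"
      by (metis of_nat_mult)
    have p: "[:0, 1:] ^ i = [:0, 1::real:] ^ k * [:0, 1:] ^ (i - k)"
      using i by (simp flip: power_add)
    have "N - k - (i - k) = N - i" using i by simp
    then show "smult (real (N choose k)) ([:0, 1:] ^ k *
        (of_nat ((N - k) choose (i - k)) * [:0, 1:] ^ (i - k) * [:1, -1:] ^ (N - k - (i - k)))) =
       smult (real (N choose i) * real (i choose k)) ([:0, 1:] ^ i * [:1, -1:] ^ (N - i))"
      unfolding c p by (simp add: of_nat_poly mult_ac)
  qed (use True in auto)
  also have "\<dots> = smult (real (N choose k)) ([:0, 1:] ^ k * ([:0, 1:] + [:1, -1:]) ^ (N - k))"
  proof -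
    have "(\<Sum>j\<in>A. smult c (f j)) = smult c (\<Sum>j\<in>A. f j)" for c :: real and A :: "nat set" and f
      by (induction A rule: infinite_finite_induct) (simp_all add: smult_add_right)
    then show ?thesis by (simp only: binomial_ring sum_distrib_left)
  qed
  also have "\<dots> = smult (real (N choose k)) (monom 1 k)"
    unfolding one by (simp add: monom_altdef)
  finally show ?thesis .
qed

text \<open>Both quantities are products of \<open>k\<close> factors of modulus at most 1, so their
  difference is bounded by the sum of the differences of the factors.\<close>

lemma choose_ratio_approx:
  assumes "i \<le> N" "2 * k \<le> N" "0 < N"
  shows "\<bar>(real i / real N) ^ k - real (i choose k) / real (N choose k)\<bar> \<le> real k * (real k / real (N - k))"
proof -
  have ratio: "real (i choose k) / real (N choose k) = (\<Prod>l\<in>{0..<k}. (real i - real l) / (real N - real l))"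
  proof -
    have "real (a choose k) = (\<Prod>l\<in>{0..<k}. real a - real l) / fact k" for a
      by (metis binomial_gbinomial gbinomial_prod_rev)
    then show ?thesis by (simp add: prod_dividef)
  qed
  have *: "norm (real i / real N - (real i - real l) / (real N - real l)) \<le> real k / real (N - k)" and
    **: "norm ((real i - real l) / (real N - real l)) \<le> 1" if "l \<in> {0..<k}" for l
  proof -
    have l: "l < k" using that by simp
    have pos: "real N - real l > 0" "real N - real k > 0" using assms l by linarith+
    have "real i / real N - (real i - real l) / (real N - real l) = (real l * (real N - real i)) / (real N * (real N - real l))"
      using pos assms by (simp add: field_simps)
    then have "norm (real i / real N - (real i - real l) / (real N - real l)) =
        (real l * (real N - real i)) / (real N * (real N - real l))"
      using pos assms by simp
    also have "\<dots> \<le> (real k * real N) / (real N * (real N - real k))"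
      using pos assms l by (intro frac_le mult_mono mult_pos_pos) auto
    also have "\<dots> = real k / real (N - k)" using assms by (simp add: of_nat_diff)
    finally show "norm (real i / real N - (real i - real l) / (real N - real l)) \<le> real k / real (N - k)" .
    have "\<bar>real i - real l\<bar> \<le> real N - real l" using assms l by linarith
    then show "norm ((real i - real l) / (real N - real l)) \<le> 1" using pos by (simp add: field_simps)
  qed
  have "norm ((\<Prod>l\<in>{0..<k}. real i / real N) - (\<Prod>l\<in>{0..<k}. (real i - real l) / (real N - real l))) \<le>
      (\<Sum>l\<in>{0..<k}. norm (real i / real N - (real i - real l) / (real N - real l)))"
    using assms ** by (intro norm_prod_diff) auto
  also have "\<dots> \<le> (\<Sum>l\<in>{0..<k}. real k / real (N - k))" using * by (intro sum_mono) auto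
  finally show ?thesis by (simp add: ratio)
qed

text \<open>A continuous retraction of the line onto the unit interval: it makes powers bounded test
  functions for weak convergence and pushes the limit measure into the interval.\<close>

definition clamp01 :: "real \<Rightarrow> real" where
  "clamp01 x = max 0 (min 1 x)"

lemma clamp01_bounds: "0 \<le> clamp01 x" "clamp01 x \<le> 1"
  by (auto simp: clamp01_def)

lemma clamp01_id: "0 \<le> x \<Longrightarrow> x \<le> 1 \<Longrightarrow> clamp01 x = x"
  by (auto simp: clamp01_def)

lemma isCont_clamp01: "isCont clamp01 x"
  unfolding clamp01_def by (intro continuous_intros)

text \<open>Discrete measures on the points \<open>i / N\<close> with Bernstein weights have the
  right factorial moments, hence asymptotically the right moments. Tightness yields a weakly
  convergent subsequence, whose limit is the measure sought.\<close>

lemma prob_space_moments_exist: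
  assumes y: "hausdorff_pos y" "y 0 = 1"
  shows "\<exists>\<mu>. prob_space \<mu> \<and> sets \<mu> = sets (restrict_space borel {0..1::real}) \<and> (\<forall>k. (\<integral>t. t ^ k \<partial>\<mu>) = y k)"
proof -
  \<comment> \<open>For a moment sequence this is the mixture of the binomial probabilities of
    \<open>i\<close> over the success probability.\<close>
  define w where "w N i = real (N choose i) * mfun y ([:0, 1:] ^ i * [:1, -1:] ^ (N - i))" for N i
  have w0: "0 \<le> w N i" for N i
    unfolding w_def using hausdorff_pos_bernstein[OF y(1)] by simp
  have wk: "(\<Sum>i\<le>N. w N i * real (i choose k)) = real (N choose k) * y k" for N k
  proof -
    have "mfun y (monom 1 k) = y k"
      using mfun_eq[of "monom 1 k" k y] by (simp add: degree_monom_le if_distrib[where f = "\<lambda>x. x * _"] cong: if_cong)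
    moreover have "(\<Sum>i\<le>N. w N i * real (i choose k)) =
        mfun y (\<Sum>i\<le>N. smult (real (N choose i) * real (i choose k)) ([:0, 1:] ^ i * [:1, -1:] ^ (N - i)))"
      unfolding mfun_sum mfun_smult w_def by (simp add: mult_ac)
    ultimately show ?thesis unfolding bernstein_factorial_moment mfun_smult by simp
  qed
  have w1: "(\<Sum>i\<le>N. w N i) = 1" for N using wk[of N 0] y(2) by simp
  define P where "P N = point_measure {..N} (\<lambda>i. ennreal (w N i))" for N
  have prob_P: "prob_space (P N)" for N
    unfolding P_def using w0 w1[of N] by (intro prob_space_point_measure) (auto simp: sum_ennreal)
  define \<mu> where "\<mu> N = distr (P N) borel (\<lambda>i. real i / real N)" for N
  have meas: "(\<lambda>i. real i / real N) \<in> P N \<rightarrow>\<^sub>M borel" for N by (simp add: P_def)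
  have real_distr: "real_distribution (\<mu> N)" for N
  proof -
    interpret prob_space "P N" by (rule prob_P)
    show ?thesis unfolding \<mu>_def by (rule real_distribution_distr) (rule meas)
  qed
  have int: "(\<integral>x. f x \<partial>\<mu> N) = (\<Sum>i\<le>N. w N i * f (real i / real N))"
    if "f \<in> borel_measurable borel" for f :: "real \<Rightarrow> real" and N
  proof -
    have "(\<integral>x. f x \<partial>\<mu> N) = (\<integral>i. f (real i / real N) \<partial>P N)"
      unfolding \<mu>_def by (rule integral_distr[OF meas that])
    also have "\<dots> = (\<Sum>i\<le>N. w N i * f (real i / real N))"
      unfolding P_def using w0 by (subst lebesgue_integral_point_measure_finite) auto
    finally show ?thesis .
  qed
  \<comment> \<open>All these measures live on the unit interval. Tightness is phrased with
    half-open intervals, so the left end is taken as -1 in order to include 0.\<close>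
  have tight: "tight \<mu>"
    unfolding tight_def
  proof safe
    fix \<epsilon> :: real assume "\<epsilon> > 0"
    have "measure (\<mu> N) {-1<..1} = 1" for N
    proof -
      interpret real_distribution "\<mu> N" by (rule real_distr)
      have "AE i in P N. real i / real N \<in> {-1<..1}"
      proof (rule AE_I2)
        fix i assume "i \<in> space (P N)"
        then have "0 \<le> real i / real N" "real i / real N \<le> 1"
          by (auto simp: P_def space_point_measure divide_le_eq)
        then show "real i / real N \<in> {-1<..1}" unfolding greaterThanAtMost_iff by linarith
      qed
      then have "AE x in \<mu> N. x \<in> {-1<..1}"
        unfolding \<mu>_def by (subst AE_distr_iff[OF meas]) auto
      then show ?thesis by (subst prob_eq_1) auto
    qed
    then show "\<exists>a b. a < b \<and> (\<forall>n. 1 - \<epsilon> < measure (\<mu> n) {a<..b})"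
      using \<open>\<epsilon> > 0\<close> by (intro exI[of _ "-1"] exI[of _ 1]) auto
  qed (rule real_distr)
  then obtain r M where r: "strict_mono (r :: nat \<Rightarrow> nat)" and M: "real_distribution M"
    and conv: "weak_conv_m (\<lambda>n. \<mu> (r n)) M"
    using tight_imp_convergent_subsubsequence[OF tight, of id] by (auto simp: strict_mono_def o_def)
  interpret M: real_distribution M by fact
  have mom: "(\<integral>x. clamp01 x ^ k \<partial>M) = y k" for k
  proof (rule LIMSEQ_unique)
    have cont: "isCont (\<lambda>x. clamp01 x ^ k) x" for x
      by (intro continuous_power isCont_clamp01)
    show "(\<lambda>n. \<integral>x. clamp01 x ^ k \<partial>\<mu> (r n)) \<longlonglongrightarrow> (\<integral>x. clamp01 x ^ k \<partial>M)"
      by (rule weak_conv_imp_integral_bdd_continuous_conv[OF real_distr M conv, of _ 1])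
        (use cont clamp01_bounds in \<open>auto simp: power_le_one\<close>)
    have "(\<lambda>N. \<integral>x. clamp01 x ^ k \<partial>\<mu> N) \<longlonglongrightarrow> y k"
    proof -
      have "\<bar>(\<integral>x. clamp01 x ^ k \<partial>\<mu> N) - y k\<bar> \<le> real k * (real k / real (N - k))" if N: "N > 2 * k" for N
      proof -
        have "(\<integral>x. clamp01 x ^ k \<partial>\<mu> N) = (\<Sum>i\<le>N. w N i * (real i / real N) ^ k)"
          using cont by (subst int) (auto intro!: borel_measurable_continuous_onI continuous_at_imp_continuous_on
            sum.cong simp: clamp01_id divide_le_eq)
        moreover have "y k = (\<Sum>i\<le>N. w N i * (real (i choose k) / real (N choose k)))"
        proof -
          have "N choose k \<noteq> 0" using N by (simp add: binomial_eq_0_iff)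
          then show ?thesis using wk[of N k] by (simp add: field_simps flip: sum_divide_distrib)
        qed
        ultimately have "\<bar>(\<integral>x. clamp01 x ^ k \<partial>\<mu> N) - y k\<bar> =
            \<bar>\<Sum>i\<le>N. w N i * ((real i / real N) ^ k - real (i choose k) / real (N choose k))\<bar>"
          by (simp add: right_diff_distrib sum_subtractf)
        also have "\<dots> \<le> (\<Sum>i\<le>N. w N i * (real k * (real k / real (N - k))))"
        proof (intro order_trans[OF sum_abs] sum_mono)
          fix i assume "i \<in> {..N}"
          then show "\<bar>w N i * ((real i / real N) ^ k - real (i choose k) / real (N choose k))\<bar> \<le>
              w N i * (real k * (real k / real (N - k)))"
            unfolding abs_mult abs_of_nonneg[OF w0] using N
            by (intro mult_left_mono choose_ratio_approx w0) auto
        qed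
        also have "\<dots> = real k * (real k / real (N - k))"
          unfolding sum_distrib_right[symmetric] w1 by simp
        finally show ?thesis .
      qed
      then have *: "norm ((\<integral>x. clamp01 x ^ k \<partial>\<mu> N) - y k) \<le> real k * (real k / real (N - k))" if "2 * k < N" for N
        using that unfolding real_norm_def by blast
      have "eventually (\<lambda>N. norm ((\<integral>x. clamp01 x ^ k \<partial>\<mu> N) - y k) \<le> real k * (real k / real (N - k))) sequentially"
        by (rule eventually_mono[OF eventually_gt_at_top[of "2 * k"]]) (rule *)
      moreover have "(\<lambda>N. real k * (real k / real (N - k))) \<longlonglongrightarrow> 0"
      proof -
        have "(\<lambda>n. real k * (real k * inverse (real n))) \<longlonglongrightarrow> real k * (real k * 0)"
          by (intro tendsto_intros LIMSEQ_inverse_real_of_nat lim_inverse_n)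
        then have "(\<lambda>n. real k * (real k / real ((n + k) - k))) \<longlonglongrightarrow> 0" by (simp add: divide_inverse)
        then show ?thesis by (rule LIMSEQ_offset)
      qed
      ultimately have "(\<lambda>N. (\<integral>x. clamp01 x ^ k \<partial>\<mu> N) - y k) \<longlonglongrightarrow> 0"
        by (rule Lim_null_comparison)
      then show ?thesis by (simp add: LIM_zero_iff)
    qed
    then show "(\<lambda>n. \<integral>x. clamp01 x ^ k \<partial>\<mu> (r n)) \<longlonglongrightarrow> y k"
      using LIMSEQ_subseq_LIMSEQ[OF _ r] by (auto simp: o_def)
  qed
  \<comment> \<open>The image under \<open>clamp01\<close> is a measure on the interval itself, and
    its moments are the integrals computed in \<open>mom\<close>.\<close>
  define \<nu> where "\<nu> = distr M (restrict_space borel {0..1}) clamp01"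
  have m: "clamp01 \<in> M \<rightarrow>\<^sub>M restrict_space borel {0..1}"
    unfolding measurable_cong_sets[OF M.events_eq_borel refl] using isCont_clamp01 clamp01_bounds
    by (intro measurable_restrict_space2 borel_measurable_continuous_onI continuous_at_imp_continuous_on) auto
  have "prob_space \<nu>" unfolding \<nu>_def by (rule M.prob_space_distr) (rule m)
  moreover have "(\<integral>t. t ^ k \<partial>\<nu>) = y k" for k
    unfolding \<nu>_def by (subst integral_distr[OF m]) (auto simp: mom intro: measurable_restrict_space1)
  ultimately show ?thesis by (intro exI[of _ \<nu>]) (auto simp: \<nu>_def)
qed

lemma hausdorff_pos_moments:
  assumes "prob_space \<mu>" and sets: "sets \<mu> = sets (restrict_space borel {0..1::real})"
  shows "hausdorff_pos (\<lambda>k. \<integral>t. t ^ k \<partial>\<mu>)"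
proof -
  interpret prob_space \<mu> by fact
  let ?y = "\<lambda>k. \<integral>t. t ^ k \<partial>\<mu>"
  have sp: "space \<mu> = {0..1}" using sets_eq_imp_space_eq[OF sets] by (simp add: space_restrict_space)
  have int: "integrable \<mu> (poly p)" for p :: "real poly"
  proof -
    obtain C where "\<forall>x\<in>{0..1}. \<bar>poly p x\<bar> \<le> C" using poly_bounded_unit by blast
    moreover have "poly p \<in> borel_measurable \<mu>"
      unfolding measurable_cong_sets[OF sets refl] by (rule measurable_restrict_space1) simp
    ultimately show ?thesis by (intro integrable_const_bound[of _ C]) (auto simp: sp)
  qed
  have intp: "integrable \<mu> (\<lambda>t. t ^ k)" for k :: nat 
  proof -
    have "poly (monom 1 k) = (\<lambda>t::real. t ^ k)" by (simp add: fun_eq_iff poly_monom)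
    then show ?thesis using int[of "monom 1 k"] by simp
  qed
  have mfun: "mfun ?y p = (\<integral>t. poly p t \<partial>\<mu>)" for p
    by (simp add: mfun_def poly_altdef intp)
  have nonneg: "0 \<le> mfun ?y p" if "\<And>x. x \<in> {0..1} \<Longrightarrow> 0 \<le> poly p x" for p
    unfolding mfun using that by (intro integral_nonneg_AE AE_I2) (auto simp: sp)
  have "0 \<le> mfun ?y (p * p)" "0 \<le> mfun ?y ([:0, 1:] * (p * p))" "0 \<le> mfun ?y ([:1, -1:] * (p * p))"
    "0 \<le> mfun ?y ([:0, 1:] * ([:1, -1:] * (p * p)))" for p
    by (rule nonneg; simp only: poly_mult; intro zero_le_square mult_nonneg_nonneg; simp)+
  then show ?thesis
    unfolding hausdorff_pos_def pos_seq_def mfun_X mfun_1X shift_ndiff by blast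
qed

text \<open>By the solved moment problem, measures can be replaced by positive sequences extending
  the given vector; entry 0 is the total mass.\<close>

lemma moment_space_iff:
  "y \<in> moment_space n \<longleftrightarrow> y \<in> extensional {1..n} \<and>
     (\<exists>z. hausdorff_pos z \<and> z 0 = 1 \<and> (\<forall>i\<in>{1..n}. y i = z i))"
proof
  assume "y \<in> moment_space n"
  then obtain \<mu> where \<mu>: "prob_space \<mu>" "sets \<mu> = sets (restrict_space borel {0..1::real})"
    and y: "y = (\<lambda>i\<in>{1..n}. \<integral>t. t ^ i \<partial>\<mu>)" by (auto simp: moment_space_def)
  then show "y \<in> extensional {1..n} \<and> (\<exists>z. hausdorff_pos z \<and> z 0 = 1 \<and> (\<forall>i\<in>{1..n}. y i = z i))"
    using hausdorff_pos_moments[OF \<mu>] prob_space.prob_space[OF \<mu>(1)]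
    by (intro conjI exI[of _ "\<lambda>k. \<integral>t. t ^ k \<partial>\<mu>"]) auto
next
  assume "y \<in> extensional {1..n} \<and> (\<exists>z. hausdorff_pos z \<and> z 0 = 1 \<and> (\<forall>i\<in>{1..n}. y i = z i))"
  then obtain z where z: "y \<in> extensional {1..n}" "hausdorff_pos z" "z 0 = 1" "\<forall>i\<in>{1..n}. y i = z i" by blast
  from prob_space_moments_exist[OF z(2,3)] obtain \<mu> where
    \<mu>: "prob_space \<mu>" "sets \<mu> = sets (restrict_space borel {0..1::real})" "\<forall>k. (\<integral>t. t ^ k \<partial>\<mu>) = z k" by blast
  have "y = (\<lambda>i\<in>{1..n}. \<integral>t. t ^ i \<partial>\<mu>)"
    using z \<mu>(3) by (auto simp: extensional_def restrict_def)
  then show "y \<in> moment_space n" using \<mu>(1,2) unfolding moment_space_def by blast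
qed

section \<open>Stripping the first canonical moment off a moment vector\<close>

declare sum.cong [fundef_cong]

text \<open>Relation \<open>k\<close> of \<open>canonical_step\<close> is linear in
  \<open>v k\<close> with coefficient \<open>y 1 * (1 - y 1)\<close>; this is its solution.\<close>

fun canon_down :: "(nat \<Rightarrow> real) \<Rightarrow> nat \<Rightarrow> real" where
  "canon_down y k = (if k = 0 then 1 else
     (y (Suc k) - y 1 * y k - y 1 * (\<Sum>i\<in>{1..<k}. canon_down y i * ndiff y (k - i))) / (y 1 * (1 - y 1)))"

text \<open>The same relation solved for \<open>y (Suc k)\<close>, which enters on both sides
  because the summand with index 0 is \<open>y k - y (Suc k)\<close>.\<close>

fun canon_up :: "real \<Rightarrow> (nat \<Rightarrow> real) \<Rightarrow> nat \<Rightarrow> real" where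
  "canon_up p v 0 = 1"
| "canon_up p v (Suc k) = p * canon_up p v k +
     p * (\<Sum>i\<in>{1..k}. v i * (canon_up p v (k - i) - canon_up p v (Suc (k - i))))"

declare canon_down.simps [simp del] canon_up.simps(2) [simp del]

lemma sum_split_ends:
  fixes f :: "nat \<Rightarrow> real"
  assumes "k > 0"
  shows "(\<Sum>i\<le>k. f i) = f 0 + (\<Sum>i\<in>{1..<k}. f i) + f k"
proof -
  have "{..k} = insert 0 (insert k {1..<k})" using assms by auto
  then show ?thesis using assms by simp
qed

lemma canonical_step_iff:
  assumes "y 0 = 1" "v 0 = 1" "0 < y 1" "y 1 < 1"
  shows "(1 - y 1) * y (Suc k) = y 1 * (\<Sum>i\<le>k. v i * ndiff y (k - i)) \<longleftrightarrow>
    k = 0 \<or> v k = (y (Suc k) - y 1 * y k - y 1 * (\<Sum>i\<in>{1..<k}. v i * ndiff y (k - i))) / (y 1 * (1 - y 1))"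
proof (cases "k = 0")
  case True
  then show ?thesis using assms by (simp add: ndiff_def)
next
  case False
  have "(\<Sum>i\<le>k. v i * ndiff y (k - i)) = (y k - y (Suc k)) + (\<Sum>i\<in>{1..<k}. v i * ndiff y (k - i)) + v k * (1 - y 1)"
    using False assms by (subst sum_split_ends) (auto simp: ndiff_def)
  moreover have "(1 - p) * a = p * ((b - a) + T + x * (1 - p)) \<longleftrightarrow> x = (a - p * b - p * T) / (p * (1 - p))"
    if "p * (1 - p) \<noteq> 0" for p a b T x :: real
    unfolding eq_divide_eq using that by (simp only: if_False refl simp_thms) (auto simp: algebra_simps)
  moreover have "y 1 * (1 - y 1) \<noteq> 0" using assms by simp
  ultimately show ?thesis using False by (simp only: simp_thms)
qed

lemma canonical_step_canon_down:
  assumes "y 0 = 1" "0 < y 1" "y 1 < 1"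
  shows "canonical_step y (canon_down y)"
proof
  show "canon_down y 0 = 1" by (simp add: canon_down.simps)
  fix k
  show "(1 - y 1) * y (Suc k) = y 1 * (\<Sum>i\<le>k. canon_down y i * ndiff y (k - i))"
    using assms by (subst canonical_step_iff) (auto simp: canon_down.simps[of y 0] canon_down.simps[of y k])
qed (use assms in auto)

lemma canonical_step_canon_up:
  assumes "v 0 = 1" "0 < p" "p < 1"
  shows "canonical_step (canon_up p v) v"
proof -
  let ?y = "canon_up p v"
  have solve: "(1 - p) * a = p * (d + T)" if "a = p * b + p * T" "d = b - a" for a b d T
  proof -
    have "p * (d + T) = (p * b + p * T) - p * a" unfolding that(2) by (simp only: algebra_simps)
    then show ?thesis unfolding that(1)[symmetric] by (simp only: left_diff_distrib mult_1_left)
  qed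
  have 1: "?y 1 = p" using canon_up.simps(2)[of p v 0] by simp
  show ?thesis
  proof
    fix k
    define T where "T = (\<Sum>i\<in>{1..k}. v i * ndiff ?y (k - i))"
    have S: "(\<Sum>i\<le>k. v i * ndiff ?y (k - i)) = ndiff ?y k + T"
    proof -
      have *: "{..k} = insert 0 {1..k}" by auto
      show ?thesis unfolding T_def by (subst *) (simp add: assms(1))
    qed
    have up: "?y (Suc k) = p * ?y k + p * T"
      unfolding T_def ndiff_def by (rule canon_up.simps(2))
    show "(1 - ?y 1) * ?y (Suc k) = ?y 1 * (\<Sum>i\<le>k. v i * ndiff ?y (k - i))"
      unfolding S 1 by (rule solve[OF up]) (simp only: ndiff_def)
  qed (use assms 1 in auto)
qed

lemma canon_down_cong:
  assumes "\<And>i. i \<le> Suc k \<Longrightarrow> y i = y' i"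
  shows "canon_down y k = canon_down y' k"
  using assms
proof (induction k rule: less_induct)
  case (less k)
  show ?case
  proof (cases "k = 0")
    case False
    have "(\<Sum>i\<in>{1..<k}. canon_down y i * ndiff y (k - i)) = (\<Sum>i\<in>{1..<k}. canon_down y' i * ndiff y' (k - i))"
      using less.IH less.prems by (intro sum.cong arg_cong2[where f = "(*)"]) (auto simp: ndiff_def)
    moreover have "y (Suc k) = y' (Suc k)" "y k = y' k" "y 1 = y' 1" using less.prems False by auto
    ultimately show ?thesis unfolding canon_down.simps[of y k] canon_down.simps[of y' k] by simp
  qed (simp add: canon_down.simps)
qed

text \<open>Induction over the relations of the step, each of which determines the next entry. The
  truncated form is needed because a moment vector fixes only finitely many entries.\<close>

lemma canonical_step_unique:
  assumes "canonical_step z w" "z 1 = y 1" "y 0 = 1" "0 < y 1" "y 1 < 1"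
    and v: "\<And>k. 1 \<le> k \<Longrightarrow> k \<le> n \<Longrightarrow> w k = canon_down y k"
  shows "i \<le> Suc n \<Longrightarrow> z i = y i"
proof (induction i rule: less_induct)
  case (less i)
  interpret canonical_step z w by fact
  interpret y: canonical_step y "canon_down y" using assms by (intro canonical_step_canon_down) auto
  consider "i = 0" | "i = 1" | k where "i = Suc k" "k > 0" by (metis One_nat_def not0_implies_Suc neq0_conv)
  then show ?case
  proof cases
    case 3
    have z: "z j = y j" if "j \<le> k" for j using less that 3 by auto
    have "(\<Sum>j\<in>{1..<k}. w j * ndiff z (k - j)) = (\<Sum>j\<in>{1..<k}. canon_down y j * ndiff y (k - j))"
      using z v less.prems 3 by (intro sum.cong arg_cong2[where f = "(*)"]) (auto simp: ndiff_def)
    moreover have "w k = (z (Suc k) - z 1 * z k - z 1 * (\<Sum>i\<in>{1..<k}. w i * ndiff z (k - i))) / (z 1 * (1 - z 1))"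
      using canonical_step_iff[of z w k] conv[of k] 3 y0 v0 y1 by simp
    moreover have "canon_down y k = (y (Suc k) - y 1 * y k - y 1 * (\<Sum>i\<in>{1..<k}. canon_down y i * ndiff y (k - i))) / (y 1 * (1 - y 1))"
      using 3 by (simp add: canon_down.simps[of y k])
    moreover have "w k = canon_down y k" using v 3 less.prems by simp
    moreover have "y 1 * (1 - y 1) \<noteq> 0" using assms by simp
    ultimately have "z (Suc k) = y (Suc k)" using assms(2) z[of k] by simp
    then show ?thesis using 3 by simp
  qed (use assms y0 in auto)
qed

text \<open>Vectors start at index 1, so the mass 1 is inserted at index 0. One coordinate is lost,
  as the first moment is stripped off.\<close>

definition peel :: "nat \<Rightarrow> (nat \<Rightarrow> real) \<Rightarrow> nat \<Rightarrow> real" where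
  "peel n y = (\<lambda>k\<in>{1..n}. canon_down (y(0 := 1)) k)"

text \<open>Both directions extend the vector to a positive sequence and apply
  \<open>hausdorff_pos_iff\<close>, using \<open>canon_down\<close> one way and
  \<open>canon_up\<close> with \<open>p = y 1\<close> the other. Congruence and uniqueness compare
  the entries within the truncation.\<close>

lemma moment_space_peel:
  assumes "y \<in> extensional {1..Suc n}" "0 < y 1" "y 1 < 1"
  shows "y \<in> moment_space (Suc n) \<longleftrightarrow> peel n y \<in> moment_space n"
proof -
  let ?y = "y(0 := 1)"
  have y: "?y 0 = 1" "0 < ?y 1" "?y 1 < 1" using assms by auto
  show ?thesis
  proof
    assume "y \<in> moment_space (Suc n)"
    then obtain z where z: "hausdorff_pos z" "z 0 = 1" "\<forall>i\<in>{1..Suc n}. y i = z i"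
      unfolding moment_space_iff by blast
    then have z1: "0 < z 1" "z 1 < 1" using assms by auto
    interpret canonical_step z "canon_down z" using z z1 by (intro canonical_step_canon_down) auto
    have "peel n y k = canon_down z k" if "k \<in> {1..n}" for k
    proof -
      have "canon_down ?y k = canon_down z k" using that z by (intro canon_down_cong) auto
      then show ?thesis using that by (simp add: peel_def)
    qed
    moreover have "peel n y \<in> extensional {1..n}" by (simp add: peel_def)
    ultimately show "peel n y \<in> moment_space n"
      unfolding moment_space_iff using z hausdorff_pos_iff v0 by blast
  next
    assume "peel n y \<in> moment_space n"
    then obtain w where w: "hausdorff_pos w" "w 0 = 1" "\<forall>i\<in>{1..n}. peel n y i = w i"
      unfolding moment_space_iff by blast
    let ?z = "canon_up (y 1) w"
    interpret canonical_step ?z w using w assms by (intro canonical_step_canon_up) auto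
    have "?z 1 = ?y 1" using canon_up.simps(2)[of "y 1" w 0] by simp
    moreover have "w k = canon_down ?y k" if "1 \<le> k" "k \<le> n" for k using w(3) that by (auto simp: peel_def)
    ultimately have "?z i = ?y i" if "i \<le> Suc n" for i
      using canonical_step_unique[OF canonical_step_axioms _ y _ that] by blast
    then have "\<forall>i\<in>{1..Suc n}. y i = ?z i" by auto
    then show "y \<in> moment_space (Suc n)"
      unfolding moment_space_iff using assms w hausdorff_pos_iff y0 by blast
  qed
qed

text \<open>Here the measure is a point mass at an endpoint. In terms of sequences: a nonnegative
  decreasing sequence that reaches 0 stays there, and nonnegative decreasing differences starting at
  0 stay 0.\<close>

lemma moment_space_ends:
  assumes "y \<in> moment_space (Suc n)" "\<not> (0 < y 1 \<and> y 1 < 1)"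
  shows "y \<in> {(\<lambda>i\<in>{1..Suc n}. 0), (\<lambda>i\<in>{1..Suc n}. 1)}"
proof -
  from assms obtain z where z: "y \<in> extensional {1..Suc n}" "hausdorff_pos z" "z 0 = 1" "\<forall>i\<in>{1..Suc n}. y i = z i"
    by (auto simp: moment_space_iff)
  note m = hausdorff_pos_antimono[OF z(2)]
  have z1: "0 \<le> z 1" "z 1 \<le> 1" using m(1)[of 1] m(2)[of 0] z(3) by auto
  then consider "z 1 = 0" | "z 1 = 1" using assms z(4) by force
  then show ?thesis
  proof cases
    case 1
    have "z (Suc k) = 0" for k
    proof (induction k)
      case (Suc k) then show ?case using m(1)[of "Suc (Suc k)"] m(2)[of "Suc k"] by simp
    qed (use 1 in simp)
    then have "y i = 0" if "i \<in> {1..Suc n}" for i using that z(4) by (cases i) auto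
    then have "y = (\<lambda>i\<in>{1..Suc n}. 0)" using z(1) by (auto simp: extensional_def restrict_def)
    then show ?thesis by blast
  next
    case 2
    have "z k - z (Suc k) \<le> 0" for k
    proof (induction k)
      case (Suc k) then show ?case using m(3)[of k] by simp
    qed (use 2 z(3) in simp)
    then have "z (Suc k) = z k" for k using m(2)[of k] by (simp add: antisym)
    then have "z k = 1" for k by (induction k) (simp_all add: z(3))
    then have "y i = 1" if "i \<in> {1..Suc n}" for i using that z(4) by auto
    then have "y = (\<lambda>i\<in>{1..Suc n}. 1)" using z(1) by (auto simp: extensional_def restrict_def)
    then show ?thesis by blast
  qed
qed

section \<open>The volume of the moment space\<close>

lemma Leb_Suc: "Leb (Suc n) = Pi\<^sub>M (insert (Suc n) {1..n}) (\<lambda>_. lborel)"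
  by (simp add: Leb_def atLeastAtMostSuc_conv)

lemma measurable_Leb_coord [measurable]: "i \<in> {1..n} \<Longrightarrow> (\<lambda>y. y i) \<in> borel_measurable (Leb n)"
  using measurable_component_singleton[of i "{1..n}" "\<lambda>_. lborel :: real measure"] by (simp add: Leb_def)

lemma measurable_canon_down:
  assumes "k \<le> n"
  shows "(\<lambda>y. canon_down (y(0 := 1)) k) \<in> borel_measurable (Leb (Suc n))"
  using assms
proof (induction k rule: less_induct)
  case (less k)
  have c: "(\<lambda>y. (y(0 := 1)) i) \<in> borel_measurable (Leb (Suc n))" if "i \<le> Suc n" for i
    using that by (cases "i = 0") (auto intro: measurable_Leb_coord)
  show ?case
  proof (cases "k = 0")
    case False
    have "(\<lambda>y. ((y(0 := 1)) (Suc k) - (y(0 := 1)) 1 * (y(0 := 1)) k - (y(0 := 1)) 1 *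
        (\<Sum>i\<in>{1..<k}. canon_down (y(0 := 1)) i * ((y(0 := 1)) (k - i) - (y(0 := 1)) (Suc (k - i))))) /
        ((y(0 := 1)) 1 * (1 - (y(0 := 1)) 1))) \<in> borel_measurable (Leb (Suc n))"
      using less.prems
      by (intro borel_measurable_divide borel_measurable_diff borel_measurable_times borel_measurable_sum
        borel_measurable_const c less.IH) auto
    then show ?thesis
      using False by (subst canon_down.simps) (simp add: ndiff_def)
  qed (simp add: canon_down.simps)
qed

lemma measurable_peel: "peel n \<in> Leb (Suc n) \<rightarrow>\<^sub>M Leb n"
proof -
  have "(\<lambda>y. \<lambda>k\<in>{1..n}. canon_down (y(0 := 1)) k) \<in> Leb (Suc n) \<rightarrow>\<^sub>M Pi\<^sub>M {1..n} (\<lambda>_. lborel)"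
    by (intro measurable_restrict) (use measurable_canon_down in auto)
  then show ?thesis unfolding peel_def[abs_def] Leb_def[of n] .
qed

text \<open>The triangular shape of the Jacobian: the last moment enters only the last coordinate,
  affinely with slope \<open>1 / (y 1 * (1 - y 1))\<close>.\<close>

lemma peel_Suc_upd:
  "peel (Suc n) (y(Suc (Suc n) := x)) =
     (peel n y)(Suc n := (x - y 1 * (y(0 := 1)) (Suc n) - y 1 * (\<Sum>i\<in>{1..<Suc n}. canon_down (y(0 := 1)) i * ndiff (y(0 := 1)) (Suc n - i))) / (y 1 * (1 - y 1)))"
proof -
  let ?y = "y(0 := 1)" and ?y' = "(y(Suc (Suc n) := x))(0 := 1)"
  have c: "canon_down ?y' k = canon_down ?y k" if "k \<le> n" for k
    using that by (intro canon_down_cong) auto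
  have d: "ndiff ?y' k = ndiff ?y k" if "k \<le> n" for k using that by (auto simp: ndiff_def)
  have "canon_down ?y' (Suc n) = (x - y 1 * ?y (Suc n) - y 1 * (\<Sum>i\<in>{1..<Suc n}. canon_down ?y i * ndiff ?y (Suc n - i))) / (y 1 * (1 - y 1))"
  proof -
    have "(\<Sum>i\<in>{1..<Suc n}. canon_down ?y' i * ndiff ?y' (Suc n - i)) = (\<Sum>i\<in>{1..<Suc n}. canon_down ?y i * ndiff ?y (Suc n - i))"
      by (intro sum.cong refl) (auto simp: c d)
    moreover have "?y' (Suc (Suc n)) = x" "?y' 1 = y 1" "?y' (Suc n) = ?y (Suc n)" by auto
    ultimately show ?thesis by (subst canon_down.simps) (simp only: nat.distinct if_False simp_thms)
  qed
  then show ?thesis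
    unfolding peel_def fun_eq_iff using c by (auto simp: le_Suc_eq simp del: fun_upd_apply) (auto simp: fun_upd_def)
qed

text \<open>Integrating out the last moment is an affine substitution that yields one factor
  \<open>p * (1 - p)\<close>. The weight \<open>u\<close> is arbitrary so that the induction can
  absorb this factor, and it vanishes off the open unit interval, where the factor need not be
  positive.\<close>

lemma nn_integral_peel:
  assumes "h \<in> borel_measurable (Leb n)" "u \<in> borel_measurable borel"
    and u: "\<And>p. \<not> (0 < p \<and> p < 1) \<Longrightarrow> u p = 0"
  shows "(\<integral>\<^sup>+y. u (y 1) * h (peel n y) \<partial>Leb (Suc n)) =
    (\<integral>\<^sup>+p. u p * ennreal ((p * (1 - p)) ^ n) \<partial>lborel) * (\<integral>\<^sup>+v. h v \<partial>Leb n)"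
  using assms
proof (induction n arbitrary: h u)
  case 0
  have p: "peel 0 y = (\<lambda>_. undefined)" for y by (simp add: peel_def restrict_def)
  have "(\<integral>\<^sup>+v. h v \<partial>Leb 0) = h (\<lambda>_. undefined)"
    by (simp add: Leb_def PiM_empty nn_integral_count_space_finite)
  moreover have "(\<integral>\<^sup>+y. u (y 1) \<partial>Leb (Suc 0)) = (\<integral>\<^sup>+p. u p \<partial>lborel)"
    using lborels.product_nn_integral_singleton[of u "Suc 0"] 0 by (simp add: Leb_def)
  moreover have "(\<lambda>y. u (y 1)) \<in> borel_measurable (Leb (Suc 0))"
    using 0 by (intro measurable_compose[OF measurable_Leb_coord]) auto
  ultimately show ?case using 0 by (simp add: p nn_integral_multc)
next
  case (Suc n)
  note h = Suc.prems(1) and u = Suc.prems(2,3)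
  define g where "g v = (\<integral>\<^sup>+x. h (v(Suc n := x)) \<partial>lborel)" for v
  have upd: "(\<lambda>(v, x). v(Suc n := x)) \<in> Leb n \<Otimes>\<^sub>M lborel \<rightarrow>\<^sub>M Leb (Suc n)"
    unfolding Leb_Suc Leb_def[of n] by (rule measurable_add_dim)
  have "(\<lambda>(v, x). h (v(Suc n := x))) \<in> borel_measurable (Leb n \<Otimes>\<^sub>M lborel)"
    using measurable_compose[OF upd h] unfolding case_prod_unfold .
  then have g: "g \<in> borel_measurable (Leb n)"
    unfolding g_def[abs_def] by (rule lborel.borel_measurable_nn_integral)
  have gh: "(\<integral>\<^sup>+v. h v \<partial>Leb (Suc n)) = (\<integral>\<^sup>+v. g v \<partial>Leb n)"
    using lborels.product_nn_integral_insert[of "{1..n}" "Suc n" h] h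
    unfolding g_def Leb_Suc Leb_def[of n] by simp
  \<comment> \<open>The new weight after one substitution, passed to the induction
    hypothesis.\<close>
  define u' where "u' p = u p * ennreal (p * (1 - p))" for p
  have u': "u' \<in> borel_measurable borel" "\<And>p. \<not> (0 < p \<and> p < 1) \<Longrightarrow> u' p = 0"
    unfolding u'_def[abs_def] using u by auto
  have m: "(\<lambda>y. u (y 1) * h (peel (Suc n) y)) \<in> borel_measurable (Leb (Suc (Suc n)))"
    using u by (intro borel_measurable_times_ennreal measurable_compose[OF measurable_peel h]
      measurable_compose[OF measurable_Leb_coord]) auto
  have inner: "(\<integral>\<^sup>+x. u ((y(Suc (Suc n) := x)) 1) * h (peel (Suc n) (y(Suc (Suc n) := x))) \<partial>lborel) =
      u' (y 1) * g (peel n y)" if y: "y \<in> space (Leb (Suc n))" for y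
  proof (cases "0 < y 1 \<and> y 1 < 1")
    case False
    then show ?thesis using u u' by simp
  next
    case True
    let ?d = "y 1 * (1 - y 1)"
    have d: "0 < ?d" using True by simp
    define c where "c = y 1 * (y(0 := 1)) (Suc n) + y 1 * (\<Sum>i\<in>{1..<Suc n}. canon_down (y(0 := 1)) i * ndiff (y(0 := 1)) (Suc n - i))"
    have py: "peel n y \<in> space (Leb n)" using measurable_space[OF measurable_peel y] .
    have hm: "(\<lambda>x. h ((peel n y)(Suc n := x))) \<in> borel_measurable lborel"
      using measurable_compose[OF measurable_Pair1' upd[THEN measurable_compose, OF h], OF py]
      unfolding case_prod_conv .
    have "(\<integral>\<^sup>+x. u ((y(Suc (Suc n) := x)) 1) * h (peel (Suc n) (y(Suc (Suc n) := x))) \<partial>lborel) =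
        (\<integral>\<^sup>+x. u (y 1) * h ((peel n y)(Suc n := (x - c) / ?d)) \<partial>lborel)"
      unfolding peel_Suc_upd c_def diff_diff_eq by simp
    also have "\<dots> = ennreal \<bar>?d\<bar> * (\<integral>\<^sup>+x. u (y 1) * h ((peel n y)(Suc n := ((c + ?d * x) - c) / ?d)) \<partial>lborel)"
    proof (rule nn_integral_real_affine)
      have "(\<lambda>x. (x - c) / ?d) \<in> borel \<rightarrow>\<^sub>M lborel" by simp
      from measurable_compose[OF this hm]
      show "(\<lambda>x. u (y 1) * h ((peel n y)(Suc n := (x - c) / ?d))) \<in> borel_measurable borel"
        by simp
    qed (use d in auto)
    also have "(\<integral>\<^sup>+x. u (y 1) * h ((peel n y)(Suc n := ((c + ?d * x) - c) / ?d)) \<partial>lborel) = u (y 1) * g (peel n y)"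
    proof -
      have e: "((c + ?d * x) - c) / ?d = x" for x
        unfolding add_diff_cancel_left' using less_imp_neq[OF d, symmetric] by (rule nonzero_mult_div_cancel_left)
      show ?thesis unfolding e g_def using hm by (rule nn_integral_cmult)
    qed
    also have "\<bar>?d\<bar> = ?d" using d by simp
    finally show ?thesis unfolding u'_def by (simp only: mult_ac)
  qed
  have "(\<integral>\<^sup>+y. u (y 1) * h (peel (Suc n) y) \<partial>Leb (Suc (Suc n))) =
      (\<integral>\<^sup>+y. (\<integral>\<^sup>+x. u ((y(Suc (Suc n) := x)) 1) * h (peel (Suc n) (y(Suc (Suc n) := x))) \<partial>lborel) \<partial>Leb (Suc n))"
    using lborels.product_nn_integral_insert[of "{1..Suc n}" "Suc (Suc n)"
      "\<lambda>y. u (y 1) * h (peel (Suc n) y)"] m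
    unfolding Leb_Suc[of "Suc n"] Leb_def[of "Suc n"] by simp
  also have "\<dots> = (\<integral>\<^sup>+y. u' (y 1) * g (peel n y) \<partial>Leb (Suc n))"
    by (intro nn_integral_cong inner)
  also have "\<dots> = (\<integral>\<^sup>+p. u' p * ennreal ((p * (1 - p)) ^ n) \<partial>lborel) * (\<integral>\<^sup>+v. g v \<partial>Leb n)"
    by (rule Suc.IH[OF g u'])
  also have "(\<integral>\<^sup>+p. u' p * ennreal ((p * (1 - p)) ^ n) \<partial>lborel) = (\<integral>\<^sup>+p. u p * ennreal ((p * (1 - p)) ^ Suc n) \<partial>lborel)"
  proof (rule nn_integral_cong)
    fix p :: real
    show "u' p * ennreal ((p * (1 - p)) ^ n) = u p * ennreal ((p * (1 - p)) ^ Suc n)"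
    proof (cases "0 < p \<and> p < 1")
      case True
      then show ?thesis by (simp add: u'_def ennreal_mult' mult_ac)
    qed (use u u' in auto)
  qed
  finally show ?case unfolding gh .
qed

lemma nn_integral_beta:
  "(\<integral>\<^sup>+p. indicator {0<..<1} p * ennreal ((p * (1 - p)) ^ n) \<partial>lborel) = ennreal (fact n * fact n / fact (2 * n + 1))"
proof -
  let ?p = "[:0, 1:] ^ n * [:1, -1:] ^ n :: real poly"
  have p: "poly ?p x = (x * (1 - x)) ^ n" for x by (simp add: power_mult_distrib)
  have "(\<integral>\<^sup>+p. indicator {0<..<1} p * ennreal ((p * (1 - p)) ^ n) \<partial>lborel) =
      (\<integral>\<^sup>+p. ennreal (poly ?p p) * indicator {0..1} p \<partial>lborel)"
  proof (rule nn_integral_cong_AE)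
    have "AE x in lborel. x \<noteq> (0::real)" "AE x in lborel. x \<noteq> (1::real)" by (rule AE_lborel_singleton)+
    then show "AE x in lborel. indicator {0<..<1} x * ennreal ((x * (1 - x)) ^ n) = ennreal (poly ?p x) * indicator {0..1} x"
      unfolding p by eventually_elim (auto simp: indicator_def)
  qed
  also have "\<dots> = (\<integral>\<^sup>+p. ennreal (poly ?p p) \<partial>unif)"
    unfolding unif_def by (subst nn_integral_restrict_space) simp_all
  also have "\<dots> = ennreal (pint ?p)"
    unfolding pint_def
  proof (intro nn_integral_eq_integral integrable_unif_poly AE_I2)
    fix x assume "x \<in> space unif"
    then show "0 \<le> poly ?p x" unfolding p by (intro zero_le_power mult_nonneg_nonneg) auto
  qed
  also have "pint ?p = fact n * fact n / fact (2 * n + 1)"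
    using pint_beta[of n n] by (simp only: mult_2)
  finally show ?thesis .
qed

text \<open>Each dimension contributes one beta integral over the first moment by
  \<open>nn_integral_peel\<close>. Measurability is carried along in the induction because the next
  set is described by a preimage of the previous one.\<close>

lemma moment_space_measurable_emeasure:
  "moment_space n \<in> sets (Leb n) \<and>
   emeasure (Leb n) (moment_space n) = ennreal (\<Prod>k<n. fact k * fact k / fact (2 * k + 1))"
proof (induction n)
  case 0
  have "hausdorff_pos (\<lambda>_. 1)"
  proof -
    have "prob_space (return (restrict_space borel {0..1}) (1::real))"
      by (rule prob_space_return) (simp add: space_restrict_space)
    then have "hausdorff_pos (\<lambda>k. \<integral>t. t ^ k \<partial>return (restrict_space borel {0..1}) (1::real))"
      by (rule hausdorff_pos_moments) simp
    moreover have "(\<integral>t. t ^ k \<partial>return (restrict_space borel {0..1}) (1::real)) = 1" for k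
      by (subst integral_return) (auto simp: space_restrict_space intro: measurable_restrict_space1)
    ultimately show ?thesis by simp
  qed
  then have "moment_space 0 = {\<lambda>_. undefined}"
    by (auto simp: moment_space_iff intro!: exI[of _ "\<lambda>_. 1"])
  then show ?case by (simp add: Leb_def PiM_empty)
next
  case (Suc n)
  let ?M = "moment_space (Suc n)"
  let ?S = "{y \<in> space (Leb (Suc n)). 0 < y 1 \<and> y 1 < 1 \<and> peel n y \<in> moment_space n}"
  let ?E = "{(\<lambda>i\<in>{1..Suc n}. 0), (\<lambda>i\<in>{1..Suc n}. 1 :: real)}"
  have sp: "space (Leb (Suc n)) = extensional {1..Suc n}" by (simp add: Leb_def space_PiM PiE_UNIV_domain PiE_def)
  \<comment> \<open>Apart from at most two points, which form a null set, the first moment lies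
    strictly between 0 and 1 and \<open>moment_space_peel\<close> applies.\<close>
  have M: "?M = ?S \<union> (?M \<inter> ?E)"
  proof (intro equalityI subsetI)
    fix y assume y: "y \<in> ?M"
    then have ext: "y \<in> extensional {1..Suc n}" unfolding moment_space_iff by blast
    show "y \<in> ?S \<union> (?M \<inter> ?E)"
    proof (cases "0 < y 1 \<and> y 1 < 1")
      case True
      then have "peel n y \<in> moment_space n" using moment_space_peel[OF ext] y by blast
      then show ?thesis using True ext sp by blast
    next
      case False
      then show ?thesis using moment_space_ends[OF y] y by blast
    qed
  next
    fix y assume "y \<in> ?S \<union> (?M \<inter> ?E)"
    then show "y \<in> ?M" using moment_space_peel[of y n] sp by blast
  qed
  have single: "{\<lambda>i\<in>{1..Suc n}. c} \<in> null_sets (Leb (Suc n))" for c :: real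
  proof -
    have "{\<lambda>i\<in>{1..Suc n}. c} = Pi\<^sub>E {1..Suc n} (\<lambda>_. {c})" by (auto simp: PiE_iff extensional_def fun_eq_iff)
    moreover have "Pi\<^sub>E {1..Suc n} (\<lambda>_. {c}) \<in> sets (Leb (Suc n))" unfolding Leb_def by (intro sets_PiM_I_finite) auto
    moreover have "emeasure (Leb (Suc n)) (Pi\<^sub>E {1..Suc n} (\<lambda>_. {c})) = 0"
      unfolding Leb_def by (subst lborels.emeasure_PiM) auto
    ultimately show ?thesis by (simp add: null_setsI)
  qed
  have E: "?M \<inter> ?E \<in> null_sets (Leb (Suc n))"
  proof -
    have "?M \<inter> ?E = \<Union> ((\<lambda>e. {e}) ` (?M \<inter> ?E))" by auto
    also have "\<dots> \<in> null_sets (Leb (Suc n))"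
      using single by (intro null_sets_UN') auto
    finally show ?thesis .
  qed
  have c1: "(\<lambda>y. y 1) \<in> borel_measurable (Leb (Suc n))" by (rule measurable_Leb_coord) simp
  have mS: "peel n -` moment_space n \<inter> space (Leb (Suc n)) \<in> sets (Leb (Suc n))"
    using Suc by (intro measurable_sets[OF measurable_peel]) auto
  have S: "?S \<in> sets (Leb (Suc n))"
  proof -
    have "?S = {y \<in> space (Leb (Suc n)). 0 < y 1} \<inter> {y \<in> space (Leb (Suc n)). y 1 < 1} \<inter>
        (peel n -` moment_space n \<inter> space (Leb (Suc n)))" by auto
    also have "\<dots> \<in> sets (Leb (Suc n))" 
      by (rule sets.Int[OF sets.Int[OF c1[unfolded borel_measurable_iff_greater, rule_format]
            c1[unfolded borel_measurable_iff_less, rule_format]] mS])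
    finally show ?thesis .
  qed
  have "?M \<in> sets (Leb (Suc n))" using sets.Un[OF S null_setsD2[OF E]] unfolding M[symmetric] .
  moreover have "emeasure (Leb (Suc n)) ?M = emeasure (Leb (Suc n)) ?S"
    using emeasure_Un_null_set[OF S E] unfolding M[symmetric] .
  moreover have "emeasure (Leb (Suc n)) ?S = (\<integral>\<^sup>+y. indicator {0<..<1} (y 1) * indicator (moment_space n) (peel n y) \<partial>Leb (Suc n))"
  proof (subst nn_integral_indicator[OF S, symmetric], intro nn_integral_cong)
    fix y assume "y \<in> space (Leb (Suc n))"
    then show "indicator ?S y = (indicator {0<..<1} (y 1) * indicator (moment_space n) (peel n y) :: ennreal)"
      by (cases "peel n y \<in> moment_space n") (simp_all add: indicator_def)
  qed
  moreover have "\<dots> = (\<integral>\<^sup>+p. indicator {0<..<1} p * ennreal ((p * (1 - p)) ^ n) \<partial>lborel) *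
      (\<integral>\<^sup>+v. indicator (moment_space n) v \<partial>Leb n)"
    using Suc by (intro nn_integral_peel) auto
  moreover have "(\<integral>\<^sup>+v. indicator (moment_space n) v \<partial>Leb n) = ennreal (\<Prod>k<n. fact k * fact k / fact (2 * k + 1))"
    using Suc by simp
  ultimately show ?case
    unfolding nn_integral_beta by (simp add: mult.commute prod_nonneg flip: ennreal_mult)
qed

lemma measure_moment_space:
  "measure (Leb n) (moment_space n) = (\<Prod>k<n. fact k * fact k / fact (2 * k + 1))"
  using moment_space_measurable_emeasure[of n] by (simp add: measure_def prod_nonneg)

text \<open>Both sides equal 1 at \<open>N = 0\<close> and satisfy the same first-order recursion,
  that of the left-hand side being \<open>selberg_int_Suc\<close>.\<close>

lemma selberg_int_eq_volume: "selberg_int N = measure (Leb (2 * N + 1)) (moment_space (2 * N + 1)) * fact (2 * N + 1) * fact N"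
proof (induction N)
  case 0
  show ?case by (simp add: selberg_int_0 measure_moment_space)
next
  case (Suc N)
  let ?V = "measure (Leb (2 * N + 1)) (moment_space (2 * N + 1))"
  define F G H x b a where "F = (fact (2 * N + 1) :: real)" and "G = (fact (4 * N + 5) :: real)"
    and "H = (fact (4 * N + 3) :: real)" and "x = real N" and "b = (2 * x + 2) * F" and "a = (2 * x + 3) * b"
  have f: "fact (2 * N + 2) = b" "fact (2 * N + 3) = a" "fact (4 * N + 6) = 2 * (2 * x + 3) * G"
    "fact (Suc N) = (x + 1) * fact N"
    by (simp_all add: F_def G_def a_def b_def x_def numeral_eq_Suc algebra_simps)
  have "2 * x + 3 \<noteq> 0" by (simp add: x_def add_nonneg_eq_0_iff)
  moreover have "c * b * (c * b) / (2 * c * G) = c * b * b / (2 * G)" if "c \<noteq> 0" for c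
    using that by simp
  ultimately have a: "a * a / (2 * (2 * x + 3) * G) = a * b / (2 * G)" unfolding a_def by blast
  \<comment> \<open>The dimension grows by two, so the volume gains the two beta factors with
    indices \<open>2 * N + 1\<close> and \<open>2 * N + 2\<close>.\<close>
  have "{..<2 * Suc N + 1} = insert (2 * N + 2) (insert (2 * N + 1) {..<2 * N + 1})" by auto
  then have "measure (Leb (2 * Suc N + 1)) (moment_space (2 * Suc N + 1)) =
      fact (2 * N + 2) * fact (2 * N + 2) / fact (2 * (2 * N + 2) + 1) *
      (fact (2 * N + 1) * fact (2 * N + 1) / fact (2 * (2 * N + 1) + 1) * ?V)"
    unfolding measure_moment_space by (simp del: fact_Suc)
  moreover have "2 * (2 * N + 2) + 1 = 4 * N + 5" "2 * (2 * N + 1) + 1 = 4 * N + 3" by simp_all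
  ultimately have V: "measure (Leb (2 * Suc N + 1)) (moment_space (2 * Suc N + 1)) = b * b / G * (F * F / H * ?V)"
    by (simp only: f F_def[symmetric] G_def[symmetric] H_def[symmetric])
  have "real (Suc N) = x + 1" "real (2 * N + 2) = 2 * x + 2" by (simp_all add: x_def)
  then have "selberg_int (Suc N) = ?V * F * fact N * 2 * (x + 1) * (2 * x + 2) * (F * F / H) * (a * b / (2 * G))"
    unfolding selberg_int_Suc Suc.IH by (simp only: f F_def[symmetric] H_def[symmetric] a)
  also have "\<dots> = ?V * F * fact N * (x + 1) * (2 * x + 2) * (F * F / H) * (a * b / G)"
    by simp
  also have "\<dots> = b * b / G * (F * F / H * ?V) * a * ((x + 1) * fact N)"
    by (simp add: b_def) (simp only: mult_ac)
  finally have "selberg_int (Suc N) = measure (Leb (2 * Suc N + 1)) (moment_space (2 * Suc N + 1)) * fact (2 * N + 3) * fact (Suc N)"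
    unfolding V f .
  moreover have "2 * Suc N + 1 = 2 * N + 3" by simp
  ultimately show ?case by presburger
qed

theorem theorem8p4:
  fixes m j k :: nat
  assumes "m \<ge> 2"
    and "j \<in> {2..2*m-1}" and "k \<in> {2..2*m-1}"
    and "j mod 2 = k mod 2"
  shows "(LINT t : unit_cube (m - 1) | Leb (m - 1).
            h_tilde m k t * SigmaQ (m - 1) j t * (\<Prod>i = 1..m-1. (t i)\<^sup>2) * vandermonde (m - 1) t ^ 4)
       = measure (Leb (2*m - 1)) (moment_space (2*m - 1)) * fact (2*m - 1) * fact (m - 1)
           * (fact (k + 2) / ((8 * real k + 4) * fact (k - 2))) * (if j = k then 1 else 0)"
proof -
  obtain N where m: "m = Suc N" using assms(1) by (cases m) auto
  have n: "2 * m - 1 = 2 * N + 1" "m - 1 = N" using m by simp_all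
  have jk: "2 \<le> j" "j \<le> 2 * N + 1" "2 \<le> k" "k \<le> 2 * N + 1" "even (j + k)"
    using assms n by (auto simp: even_iff_mod_2_eq_zero mod_add_eq[symmetric, of j k])
  \<comment> \<open>The factor 1/4 from the skew relation combines with \<open>2 * k + 1\<close>
    from the norm of \<open>Q_k\<close> to \<open>8 * k + 4\<close>.\<close>
  have norm: "selberg_int N / 4 * (fact (k + 2) / ((2 * real k + 1) * fact (k - 2))) =
      selberg_int N * (fact (k + 2) / ((8 * real k + 4) * fact (k - 2)))"
  proof -
    have "s / 4 * (f / (x * g)) = s * (f / ((4 * x) * g))" for s f x g :: real by simp
    moreover have "8 * real k + 4 = 4 * (2 * real k + 1)" by simp
    ultimately show ?thesis by presburger
  qed
  show ?thesis
    unfolding n unfolding m lint_eq_selberg_int[OF jk] pint_assoc_legendre2[OF jk(1,3)] selberg_int_eq_volume[symmetric]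
    by (cases "j = k") (simp_all only: norm if_True if_False simp_thms mult_1_right mult_zero_right)
qed

end
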